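(* Let $k\ge 1$ and let $0=t_0<t_1<\cdots<t_k$ be integers. Let $d_1,\dots,d_{t_k}$ be positive integers such that $$d_1=\cdots=d_{t_1}>d_{t_1+1}=\cdots=d_{t_2}>\cdots>d_{t_{k-1}+1}=\cdots=d_{t_k},$$ and set $d_{t_{k+1}}:=0$. For $1\le j\le t_k$ let $a_j,b_j$ be positive integers with $\gcd(a_j,b_j)=1$, and assume $a_{j_1}b_{j_2}\ne a_{j_2}b_{j_1}$ for all $1\le j_1\ne j_2\le t_k$. Let $$f(x):=\prod_{i=1}^k\prod_{j=t_{i-1}+1}^{t_i}(a_jx+b_j)^{d_j}$$ and $q:=\operatorname{lcm}_{1\le j\le t_k}\{a_j\}$. Then, as $n\to\infty$, $$\log \operatorname{lcm}(f(1),\dots,f(n))\sim \frac{n}{\varphi(q)}\sum_{\substack{r=1\\ \gcd(r,q)=1}}^{q}\ \sum_{i=1}^k (d_{t_i}-d_{t_{i+1}})\max_{1\le j\le t_i}\Big\{\frac{a_j}{\langle b_jr\rangle_{a_j}}\Big\}.$$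
   Context: $\varphi$ is Euler's totient function. For positive integers $a$ and an integer $b$ with $\gcd(a,b)=1$, $\langle b\rangle_a$ denotes the least positive integer congruent to $b$ modulo $a$ (for $a\ge 2$ this is the least nonnegative residue of $b$ mod $a$, which is nonzero since $\gcd(b,a)=1$; for $a=1$ it equals $1$). Note that $\gcd(b_jr,a_j)=1$ whenever $\gcd(r,q)=1$. The notation $f(n)\sim g(n)$ means $f(n)/g(n)\to 1$. *)

theory Defs
  imports "HOL-Library.Landau_Symbols" "HOL-Number_Theory.Number_Theory"
begin

definition least_pos_res :: "nat \<Rightarrow> nat \<Rightarrow> nat" where
  "least_pos_res a b = (LEAST m. m > 0 \<and> [m = b] (mod a))"

end

theory Submission
  imports Defs "HOL-Complex_Analysis.Complex_Analysis" "HOL-Real_Asymp.Real_Asymp"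
begin

text \<open>
  The prime number theorem for arithmetic progressions comes from Newman's contour argument,
  applied to the sum over \<open>n\<close> of \<open>(\<phi>(q) \<psi>(n; q, a) - n) / (n (n + 1))\<close>; its convergence forces
  \<open>\<psi>(n; q, a) \<sim> n / \<phi>(q)\<close> because \<open>\<psi>\<close> is monotone. The analytic input is that no Dirichlet
  \<open>L\<close>-function vanishes on the line \<open>Re s = 1\<close>: positivity of \<open>3 + 4 cos \<theta> + cos 2\<theta>\<close> settles every
  case except a real character at \<open>s = 1\<close>, which is handled by Monsky's Lambert series argument.

  For a prime \<open>p\<close> with \<open>p\<^sup>2\<close> exceeding all values \<open>a\<^sub>j m + b\<^sub>j\<close>, \<open>m \<le> n\<close>, at most one factor of
  \<open>f(m)\<close> is divisible by \<open>p\<close>, and only once, so the exponent of \<open>p\<close> in the lcm is the largest \<open>d\<^sub>j\<close>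
  such that \<open>p\<close> divides some \<open>a\<^sub>j m + b\<^sub>j\<close>. If \<open>p r = 1\<close> modulo \<open>q\<close>, the least positive multiple of
  \<open>p\<close> in the class of \<open>b\<^sub>j\<close> modulo \<open>a\<^sub>j\<close> is \<open>p\<close> times the least positive residue of \<open>b\<^sub>j r\<close>, so this
  happens exactly when \<open>p\<close> is at most \<open>a\<^sub>j n + b\<^sub>j\<close> divided by that residue. Summing
  \<open>log p\<close> over residue classes gives the main term; the primes up to the square root of the largest
  value contribute \<open>O(\<surd>n log n)\<close>.
\<close>

text \<open>The inequality behind 3 + 4 cos + cos 2 weighs a zero of L(\<chi>) at 1 + iu against the
  pole of the principal L-function at 1. It is inconclusive in one situation: if \<chi> is
  non-principal, \<chi>^2 is principal and u = 0, then L(\<chi>^2) has a pole as well, the balance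
  becomes 4 - 4 m >= 0 and a simple zero is compatible with it. This gap forces the separate
  treatment of real characters at 1. The inner sum of the formula is a layer-cake decomposition. A
  maximum of exponents is not additive, but the indicators "some factor from the first i blocks is
  hit" turn on at one block and stay on, so the weighted sum of indicators telescopes to that
  block's exponent. Within one residue class each indicator is a threshold condition on p, so each
  layer contributes a value of \<open>theta_ap\<close>. Since r stands for the inverse of the class
  of p and inversion permutes the reduced classes, each prime coprime to q is counted for exactly
  one r.\<close>

unbundle no vec_syntax

section \<open>Newman's Tauberian theorem\<close>

text \<open>Meant for the two segments joining the imaginary axis to \<open>- \<delta>\<close>, with
  \<open>c\<close> a multiple of \<open>ln N\<close>: the explicit factor \<open>1 / c\<close> then
  sends the integral to zero, without any dominated convergence.\<close>

lemma contour_integral_linepath_exp_bound: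
  assumes cont: "continuous_on (closed_segment a b) f" and c: "c > 0"
    and bd: "\<And>s. s \<in> {0..1} \<Longrightarrow> norm (f (linepath a b s)) \<le> M * exp (- c * s)"
  shows "norm (contour_integral (linepath a b) f) \<le> M * norm (b - a) / c"
proof -
  have M: "M \<ge> 0"
    using order_trans[OF norm_ge_zero bd[of 0]] by simp
  have "f contour_integrable_on linepath a b"
    by (rule contour_integrable_continuous_linepath[OF cont])
  then have hi: "((\<lambda>x. f (linepath a b x) * (b - a)) has_integral
      contour_integral (linepath a b) f) {0..1}"
    using has_contour_integral_integral has_contour_integral_linepath by blast
  have hg: "((\<lambda>s. M * norm (b - a) * exp (- c * s)) has_integral
      (- (M * norm (b - a) / c) * exp (- c * 1) - (- (M * norm (b - a) / c) * exp (- c * 0)))) {0..1}"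
    using c by (intro fundamental_theorem_of_calculus)
      (auto intro!: derivative_eq_intros simp flip: has_real_derivative_iff_has_vector_derivative)
  have "norm (contour_integral (linepath a b) f)
      = norm (integral {0..1} (\<lambda>x. f (linepath a b x) * (b - a)))"
    using integral_unique[OF hi] by simp
  also have "\<dots> \<le> integral {0..1} (\<lambda>s. M * norm (b - a) * exp (- c * s))"
  proof (rule integral_norm_bound_integral)
    show "norm (f (linepath a b x) * (b - a)) \<le> M * norm (b - a) * exp (- c * x)"
      if "x \<in> {0..1}" for x
      using mult_right_mono[OF bd[OF that] norm_ge_zero[of "b - a"]]
      by (simp add: norm_mult mult_ac)
  qed (use hi hg in \<open>auto intro: has_integral_integrable\<close>)
  also have "\<dots> = M * norm (b - a) / c - M * norm (b - a) / c * exp (- c)"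
    using integral_unique[OF hg] by simp
  also have "\<dots> \<le> M * norm (b - a) / c"
    using M c by simp
  finally show ?thesis .
qed

text \<open>On the circle \<open>R\<^sup>2\<close> equals \<open>z * cnj z\<close>, so the kernel
  collapses to \<open>(cnj z + z) / R\<^sup>2\<close>, which is real.\<close>

lemma newman_kernel_norm:
  fixes z :: complex
  assumes "norm z = R" "R > 0"
  shows "norm ((1 + z\<^sup>2 / of_real R ^ 2) / z) = 2 * \<bar>Re z\<bar> / R\<^sup>2"
proof -
  have z: "z \<noteq> 0" using assms by auto
  have zz: "of_real R ^ 2 = z * cnj z"
    using assms by (metis complex_norm_square of_real_power)
  have "(1 + z\<^sup>2 / of_real R ^ 2) / z = (cnj z + z) / of_real R ^ 2"
    using z unfolding zz by (simp add: field_simps power2_eq_square)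
  also have "cnj z + z = of_real (2 * Re z)"
    by (simp add: complex_eq_iff)
  finally have "norm ((1 + z\<^sup>2 / of_real R ^ 2) / z) = norm (complex_of_real (2 * Re z)) / norm (of_real R ^ 2 :: complex)"
    by (simp add: norm_divide)
  then show ?thesis by (simp add: norm_power abs_mult)
qed

text \<open>The cuts lie where the real part changes sign. The right half of the circle comes in two
  arcs because \<open>circlepath\<close> starts at angle 0.\<close>

lemma contour_integral_circlepath_split3:
  assumes "continuous_on (sphere 0 R) f" and R: "R > 0"
  shows "contour_integral (circlepath 0 R) f =
     contour_integral (part_circlepath 0 R 0 (pi/2)) f
   + contour_integral (part_circlepath 0 R (pi/2) (3*pi/2)) f
   + contour_integral (part_circlepath 0 R (3*pi/2) (2*pi)) f"
proof -
  define J where "J = (\<lambda>t. f (0 + of_real R * cis t) * of_real R * \<i> * cis t)"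
  have "continuous_on {0..2*pi} J"
    unfolding J_def using R
    by (auto intro!: continuous_intros continuous_on_compose2[OF assms(1)] simp: norm_mult)
  then have J: "J integrable_on {0..2*pi}"
    by (rule integrable_continuous_interval)
  have e: "contour_integral (part_circlepath 0 R a b) f = integral {a..b} J" if "a < b" for a b
    using that by (simp add: contour_integral_part_circlepath_eq J_def)
  have J2: "J integrable_on {pi/2..2*pi}"
    by (rule integrable_on_subinterval[OF J]) auto
  have "integral {0..2*pi} J = integral {0..pi/2} J + integral {pi/2..2*pi} J"
    by (rule Henstock_Kurzweil_Integration.integral_combine[symmetric]) (use J in auto)
  also have "integral {pi/2..2*pi} J = integral {pi/2..3*pi/2} J + integral {3*pi/2..2*pi} J"
    by (rule Henstock_Kurzweil_Integration.integral_combine[symmetric]) (use J2 in auto)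
  finally show ?thesis
    unfolding circlepath_def by (subst (1 2 3 4) e) auto
qed

lemma Re_part_circlepath_nonneg:
  assumes "z \<in> path_image (part_circlepath 0 R a b)" "a \<le> b" "R > 0"
    and "\<And>t. a \<le> t \<Longrightarrow> t \<le> b \<Longrightarrow> cos t \<ge> 0"
  shows "Re z \<ge> 0"
  using assms by (auto simp: path_image_part_circlepath Re_exp)

text \<open>
  On the circle of radius \<open>R\<close> the kernel \<open>1 / z + z / R\<^sup>2\<close> has modulus \<open>2 |Re z| / R\<^sup>2\<close>, which cancels
  the factor \<open>1 / |Re z|\<close> in both bounds. To the right of the axis \<open>S N - F\<close> is integrated along the
  circle, to the left \<open>S N\<close> (being entire) along the circle and \<open>F\<close> along a path through \<open>- \<delta>\<close>, where
  \<open>N\<^sup>z\<close> tends to zero.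
\<close>

lemma newman_tauberian_aux:
  fixes F :: "complex \<Rightarrow> complex" and S :: "nat \<Rightarrow> complex \<Rightarrow> complex"
  assumes U: "open U" "{z. Re z \<ge> 0} \<subseteq> U" and F: "F holomorphic_on U" and F0: "F 0 = 0"
    and S: "\<And>N. S N holomorphic_on UNIV"
    and right: "\<And>N z. N \<ge> 3 \<Longrightarrow> Re z > 0 \<Longrightarrow> norm (F z - S N z) \<le> C * real N powr (- Re z) / Re z"
    and left: "\<And>N z. N \<ge> 3 \<Longrightarrow> Re z < 0 \<Longrightarrow> norm (S N z) \<le> C * real N powr (- Re z) / (- Re z)"
    and C: "C > 0"
  shows "(\<lambda>N. S N 0) \<longlonglongrightarrow> 0"
proof (rule LIMSEQ_I)
  fix \<epsilon> :: real assume eps: "\<epsilon> > 0"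
  \<comment> \<open>The arcs will contribute \<open>2 * C / R\<close>; this radius makes that
    \<open>\<epsilon> / 2\<close>.\<close>
  define R where "R = 4 * C / \<epsilon>"
  have R: "R > 0" using eps C by (simp add: R_def)
  let ?seg = "closed_segment (- \<i> * of_real R) (\<i> * of_real R)"
  have segi: "z \<in> ?seg" if "Re z = 0" "\<bar>Im z\<bar> \<le> R" for z
  proof -
    have "z = (1 - (Im z + R) / (2*R)) *\<^sub>R (- \<i> * of_real R) + ((Im z + R) / (2*R)) *\<^sub>R (\<i> * of_real R)"
      using R that by (simp add: complex_eq_iff field_simps)
    moreover have "0 \<le> (Im z + R) / (2*R)" "(Im z + R) / (2*R) \<le> 1"
      using R that by (auto simp: field_simps)
    ultimately show ?thesis unfolding closed_segment_def by blast
  qed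
  have "?seg \<subseteq> U"
    using U(2) by (auto simp: closed_segment_def)
  then obtain e where e: "e > 0" "(\<Union>x\<in>?seg. ball x e) \<subseteq> U"
    using compact_subset_open_imp_ball_epsilon_subset[of ?seg U] U(1) by auto
  \<comment> \<open>The indentation to the left of the axis stays in \<open>U\<close> because it is
    less than \<open>e\<close>, and inside the circle because it is less than
    \<open>R\<close>.\<close>
  define \<delta> where "\<delta> = min (e/2) (R/2)"
  have d: "\<delta> > 0" "\<delta> < e" "\<delta> < R" using e R by (auto simp: \<delta>_def)
  define V where "V = {z. Re z \<ge> - \<delta>} \<inter> cball 0 R"
  have VU: "V \<subseteq> U"
  proof
    fix z assume z: "z \<in> V"
    show "z \<in> U"
    proof (cases "Re z \<ge> 0")
      case False
      let ?w = "\<i> * of_real (Im z)"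
      have "\<bar>Im z\<bar> \<le> R" using z abs_Im_le_cmod[of z] by (auto simp: V_def)
      then have "?w \<in> ?seg" by (intro segi) auto
      moreover have "dist ?w z < e"
      proof -
        have "?w - z = of_real (- Re z)" by (simp add: complex_eq_iff)
        then have "dist ?w z = \<bar>Re z\<bar>" by (metis abs_minus_cancel dist_norm norm_of_real)
        then show ?thesis using False z d by (auto simp: V_def)
      qed
      ultimately show ?thesis using e by (auto simp: subset_iff)
    qed (use U(2) in auto)
  qed
  have convV: "convex V" unfolding V_def
    by (intro convex_Int convex_halfspace_Re_ge convex_cball)
  have compV: "compact V" unfolding V_def
    by (intro closed_Int_compact closed_halfspace_Re_ge compact_cball)
  \<comment> \<open>Because \<open>F 0 = 0\<close>, division by \<open>z\<close> leaves no pole.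
    Hence \<open>h\<close> below has vanishing integral over closed paths in \<open>V\<close>,
    whereas \<open>g\<close> keeps a simple pole at 0 with residue \<open>S N 0\<close>.\<close>
  define Q where "Q = (\<lambda>z. if z = 0 then deriv F 0 else (F z - F 0) / (z - 0))"
  have holQ: "Q holomorphic_on U" unfolding Q_def
    by (rule pole_lemma_open[OF F U(1)])
  have Qz: "Q z = F z / z" if "z \<noteq> 0" for z using that F0 by (simp add: Q_def)
  define K where "K = (\<lambda>z::complex. 1 + z\<^sup>2 / of_real R ^ 2)"
  have holK: "K holomorphic_on A" for A unfolding K_def
    using R by (intro holomorphic_intros) auto
  have "continuous_on V (\<lambda>z. Q z * K z)"
    by (intro holomorphic_on_imp_continuous_on holomorphic_on_mult
          holomorphic_on_subset[OF holQ VU] holK)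
  then have "bounded ((\<lambda>z. Q z * K z) ` V)"
    using compV compact_continuous_image compact_imp_bounded by blast
  then obtain M where M: "M > 0" "\<And>z. z \<in> V \<Longrightarrow> norm (Q z * K z) \<le> M"
    by (auto simp: bounded_pos)
  define P where "P = (\<lambda>N z. of_nat N powr (z::complex))"
  have Pn: "norm (P N z) = real N powr Re z" for N z
    by (simp add: P_def norm_powr_real_powr)
  have holP: "P N holomorphic_on A" if "N \<ge> 3" for N A
    unfolding P_def using that by (intro holomorphic_intros) auto
  define h where "h = (\<lambda>N z. Q z * P N z * K z)"
  define g where "g = (\<lambda>N z. S N z * P N z * K z / z)"
  have holh: "h N holomorphic_on V" if "N \<ge> 3" for N unfolding h_def
    by (intro holomorphic_on_mult holomorphic_on_subset[OF holQ VU] holK holP that)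
  have conth: "continuous_on A (h N)" if "N \<ge> 3" "A \<subseteq> V" for N A
    using holomorphic_on_subset[OF holh[OF that(1)] that(2)] holomorphic_on_imp_continuous_on by blast
  have contg: "continuous_on A (g N)" if "N \<ge> 3" "0 \<notin> A" for N A
    unfolding g_def using that
    by (intro continuous_intros holomorphic_on_imp_continuous_on[OF holK]
       holomorphic_on_imp_continuous_on[OF holP]
       holomorphic_on_imp_continuous_on[OF holomorphic_on_subset[OF S]]) auto
  define A1 where "A1 = part_circlepath 0 R 0 (pi/2)"
  define A2 where "A2 = part_circlepath 0 R (pi/2) (3*pi/2)"
  define A3 where "A3 = part_circlepath 0 R (3*pi/2) (2*pi)"
  define L1 where "L1 = linepath (\<i> * of_real R) (- of_real \<delta>)"
  define L2 where "L2 = linepath (- of_real \<delta>) (- \<i> * of_real R)"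
  have cos3: "cos t \<ge> 0" if "3*pi/2 \<le> t" "t \<le> 2*pi" for t
    using cos_ge_zero[of "t - 2*pi"] that by (simp add: cos_diff)
  have cos2: "cos t \<le> 0" if "pi/2 \<le> t" "t \<le> 3*pi/2" for t
    using cos_ge_zero[of "t - pi"] that by (simp add: cos_diff)
  have sph: "norm z = R" if "z \<in> path_image A1 \<or> z \<in> path_image A2 \<or> z \<in> path_image A3" for z
    using that R path_image_part_circlepath_subset[of 0 "pi/2" R 0]
      path_image_part_circlepath_subset[of "pi/2" "3*pi/2" R 0]
      path_image_part_circlepath_subset[of "3*pi/2" "2*pi" R 0]
    by (auto simp: A1_def A2_def A3_def sphere_def dist_norm)
  have re1: "Re z \<ge> 0" if "z \<in> path_image A1" for z
    by (rule Re_part_circlepath_nonneg[OF that[unfolded A1_def]]) (use R in \<open>auto intro!: cos_ge_zero\<close>)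
  have re3: "Re z \<ge> 0" if "z \<in> path_image A3" for z
    by (rule Re_part_circlepath_nonneg[OF that[unfolded A3_def]]) (use R cos3 in auto)
  have re2: "Re z \<le> 0" if "z \<in> path_image A2" for z
    using that R cos2 by (auto simp: A2_def path_image_part_circlepath Re_exp mult_nonneg_nonpos)
  have arcV: "path_image A1 \<subseteq> V" "path_image A3 \<subseteq> V"
    using re1 re3 sph d(1) unfolding V_def by (fastforce simp: dist_norm)+
  have ptsV: "\<i> * of_real R \<in> V" "- of_real \<delta> \<in> V" "- \<i> * of_real R \<in> V"
    using d R by (auto simp: V_def norm_mult)
  have segV: "closed_segment (\<i> * of_real R) (- of_real \<delta>) \<subseteq> V"
      "closed_segment (- of_real \<delta>) (- \<i> * of_real R) \<subseteq> V"
    using closed_segment_subset convV ptsV by blast+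
  have e1: "cis (pi/2) = \<i>" "cis (3*pi/2) = -\<i>" "cis (2*pi) = 1" "cis 0 = 1"
    using cos_3over2_pi sin_3over2_pi by (auto simp: complex_eq_iff)
  have ends: "pathstart A1 = of_real R" "pathfinish A1 = \<i> * of_real R"
     "pathstart A3 = - \<i> * of_real R" "pathfinish A3 = of_real R"
    using e1 by (simp_all add: A1_def A3_def cis_conv_exp)
  have closed_int: "contour_integral A3 (h N) + contour_integral A1 (h N) + contour_integral L1 (h N)
       + contour_integral L2 (h N) = 0" if N: "N \<ge> 3" for N
  proof -
    let ?g = "A3 +++ A1 +++ L1 +++ L2"
    have v: "valid_path A3" "valid_path A1" "valid_path L1" "valid_path L2"
      by (simp_all add: A1_def A3_def L1_def L2_def)
    have vp: "valid_path ?g"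
      by (intro valid_path_join v) (simp_all add: ends L1_def L2_def)
    have "(h N has_contour_integral 0) ?g"
    proof (rule Cauchy_theorem_convex_simple[OF holh[OF N] convV vp])
      show "path_image ?g \<subseteq> V"
        using arcV segV by (auto simp: L1_def L2_def ends path_image_join)
      show "pathfinish ?g = pathstart ?g" by (simp add: ends L2_def)
    qed
    then have "contour_integral ?g (h N) = 0" by (rule contour_integral_unique)
    moreover have i: "h N contour_integrable_on A3" "h N contour_integrable_on A1"
      using conth[OF N] arcV unfolding A1_def A3_def
      by (auto intro!: contour_integrable_continuous_part_circlepath)
    moreover have i2: "h N contour_integrable_on L1" "h N contour_integrable_on L2"
      using conth[OF N] segV unfolding L1_def L2_def
      by (auto intro!: contour_integrable_continuous_linepath)
    ultimately show ?thesis
      using v by (simp add: contour_integral_join valid_path_join ends L1_def L2_def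
          contour_integrable_joinI add.assoc)
  qed
  have circ: "contour_integral A1 (g N) + contour_integral A2 (g N) + contour_integral A3 (g N)
      = 2 * of_real pi * \<i> * S N 0" if N: "N \<ge> 3" for N
  proof -
    let ?f = "\<lambda>z. S N z * P N z * K z"
    have hol: "?f holomorphic_on A" for A
      by (intro holomorphic_on_mult holK holP[OF N] holomorphic_on_subset[OF S]) auto
    have "((\<lambda>u. ?f u / (u - 0)) has_contour_integral (2 * of_real pi * \<i> * ?f 0)) (circlepath 0 R)"
      using R by (intro Cauchy_integral_circlepath hol holomorphic_on_imp_continuous_on) auto
    then have "contour_integral (circlepath 0 R) (g N) = 2 * of_real pi * \<i> * ?f 0"
      by (simp add: g_def contour_integral_unique)
    also have "?f 0 = S N 0" using N by (simp add: P_def K_def)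
    finally show ?thesis
      using contour_integral_circlepath_split3[OF contg[OF N, of "sphere 0 R"]] R
      by (simp add: A1_def A2_def A3_def)
  qed
  have Kb: "norm (K z / z) = 2 * \<bar>Re z\<bar> / R\<^sup>2" if "norm z = R" for z
    using newman_kernel_norm[OF that R] by (simp add: K_def)
  let ?B = "2 * C / R\<^sup>2"
  have B: "?B \<ge> 0" using C R by simp
  have gh: "norm (g N z - h N z) \<le> ?B" if N: "N \<ge> 3" and z: "norm z = R" "Re z \<ge> 0" for N z
  proof -
    have z0: "z \<noteq> 0" using z R by auto
    have "g N z - h N z = (S N z - F z) * P N z * (K z / z)"
      using z0 by (simp add: g_def h_def Qz field_simps)
    then have eq: "norm (g N z - h N z) = norm (F z - S N z) * real N powr Re z * (2 * \<bar>Re z\<bar> / R\<^sup>2)"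
      by (simp only: norm_mult Kb[OF z(1)] Pn norm_minus_commute)
    \<comment> \<open>On the imaginary axis itself the kernel is zero, so bounds on the open
      half-planes suffice for the closed arcs.\<close>
    show ?thesis
    proof (cases "Re z = 0")
      case False
      with z have x: "Re z > 0" by simp
      have "norm (g N z - h N z) \<le> (C * real N powr (- Re z) / Re z) * real N powr Re z * (2 * \<bar>Re z\<bar> / R\<^sup>2)"
        unfolding eq by (intro mult_right_mono right[OF N x]) auto
      also have "\<dots> = ?B * (real N powr (- Re z) * real N powr Re z)" using x by (simp add: field_simps)
      also have "\<dots> = ?B" using N by (simp flip: powr_add)
      finally show ?thesis .
    qed (use eq B in simp)
  qed
  have gl: "norm (g N z) \<le> ?B" if N: "N \<ge> 3" and z: "norm z = R" "Re z \<le> 0" for N z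
  proof -
    have "g N z = S N z * P N z * (K z / z)" by (simp add: g_def)
    then have eq: "norm (g N z) = norm (S N z) * real N powr Re z * (2 * \<bar>Re z\<bar> / R\<^sup>2)"
      by (simp only: norm_mult Kb[OF z(1)] Pn)
    show ?thesis
    proof (cases "Re z = 0")
      case False
      with z have x: "Re z < 0" by simp
      have "norm (g N z) \<le> (C * real N powr (- Re z) / (- Re z)) * real N powr Re z * (2 * \<bar>Re z\<bar> / R\<^sup>2)"
        unfolding eq by (intro mult_right_mono left[OF N x]) auto
      also have "\<dots> = ?B * (real N powr (- Re z) * real N powr Re z)" using x by (simp add: field_simps)
      also have "\<dots> = ?B" using N by (simp flip: powr_add)
      finally show ?thesis .
    qed (use eq B in simp)
  qed
  have line: "norm (h N z) \<le> M * real N powr Re z" if "z \<in> V" for N z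
  proof -
    have "norm (h N z) = norm (Q z * K z) * real N powr Re z"
      by (simp add: h_def norm_mult Pn)
    also have "\<dots> \<le> M * real N powr Re z"
      by (intro mult_right_mono M that) auto
    finally show ?thesis .
  qed
  define L where "L = M * norm (\<i> * of_real R + of_real \<delta>) / \<delta>"
  have l1: "norm (contour_integral L1 (h N)) \<le> L / ln N" if N: "N \<ge> 3" for N
  proof -
    have ln: "ln (real N) > 0" using N by simp
    have "norm (contour_integral L1 (h N)) \<le> M * norm (- of_real \<delta> - \<i> * of_real R) / (\<delta> * ln N)"
      unfolding L1_def
    proof (rule contour_integral_linepath_exp_bound)
      show "continuous_on (closed_segment (\<i> * of_real R) (- of_real \<delta>)) (h N)"
        by (rule conth[OF N segV(1)])
      show "\<delta> * ln N > 0" using d ln by simp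
      fix s :: real assume s: "s \<in> {0..1}"
      let ?z = "linepath (\<i> * of_real R) (- of_real \<delta>) s"
      have "?z \<in> V" using segV(1) s linepath_image_01 by (metis image_subset_iff)
      moreover have "Re ?z = - \<delta> * s" by (simp add: linepath_def)
      ultimately show "norm (h N ?z) \<le> M * exp (- (\<delta> * ln N) * s)"
        using line[of ?z N] N by (simp add: powr_def mult_ac)
    qed
    also have "\<dots> = L / ln N"
      using norm_minus_cancel[of "- of_real \<delta> - \<i> * of_real R"] by (simp add: L_def add.commute)
    finally show ?thesis .
  qed
  have l2: "norm (contour_integral L2 (h N)) \<le> L / ln N" if N: "N \<ge> 3" for N
  proof -
    have ln: "ln (real N) > 0" using N by simp
    have "contour_integral L2 (h N) = - contour_integral (linepath (- \<i> * of_real R) (- of_real \<delta>)) (h N)"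
      unfolding L2_def by (rule contour_integral_reverse_linepath[OF conth[OF N segV(2)]])
    moreover have "norm (contour_integral (linepath (- \<i> * of_real R) (- of_real \<delta>)) (h N))
        \<le> M * norm (- of_real \<delta> - - \<i> * of_real R) / (\<delta> * ln N)"
    proof (rule contour_integral_linepath_exp_bound)
      show "continuous_on (closed_segment (- \<i> * of_real R) (- of_real \<delta>)) (h N)"
        using conth[OF N segV(2)] by (simp add: closed_segment_commute)
      show "\<delta> * ln N > 0" using d ln by simp
      fix s :: real assume s: "s \<in> {0..1}"
      let ?z = "linepath (- \<i> * of_real R) (- of_real \<delta>) s"
      have "?z \<in> V" using segV(2) s linepath_image_01 by (metis image_subset_iff closed_segment_commute)
      moreover have "Re ?z = - \<delta> * s" by (simp add: linepath_def)
      ultimately show "norm (h N ?z) \<le> M * exp (- (\<delta> * ln N) * s)"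
        using line[of ?z N] N by (simp add: powr_def mult_ac)
    qed
    moreover have "norm (- of_real \<delta> - - \<i> * of_real R) = norm (\<i> * of_real R + of_real \<delta>)"
      by (simp add: cmod_def)
    ultimately show ?thesis by (simp add: L_def)
  qed
  have main: "norm (S N 0) \<le> 2 * C / R + L / ln N" if N: "N \<ge> 3" for N
  proof -
    have ig: "g N contour_integrable_on A1" "g N contour_integrable_on A2" "g N contour_integrable_on A3"
      unfolding A1_def A2_def A3_def
      by (intro contour_integrable_continuous_part_circlepath contg N; use sph R in \<open>force simp: A1_def A2_def A3_def\<close>)+
    have ih: "h N contour_integrable_on A3" "h N contour_integrable_on A1"
      using conth[OF N] arcV unfolding A1_def A3_def
      by (auto intro!: contour_integrable_continuous_part_circlepath)
    have b1: "norm (contour_integral A1 (g N) - contour_integral A1 (h N)) \<le> ?B * R * (pi/2 - 0)"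
    proof (rule has_contour_integral_bound_part_circlepath)
      show "((\<lambda>z. g N z - h N z) has_contour_integral
          (contour_integral A1 (g N) - contour_integral A1 (h N))) (part_circlepath 0 R 0 (pi/2))"
        using has_contour_integral_diff[OF has_contour_integral_integral[OF ig(1)]
            has_contour_integral_integral[OF ih(2)]] by (simp add: A1_def)
    qed (use B R gh[OF N] sph re1 in \<open>auto simp: A1_def\<close>)
    have b3: "norm (contour_integral A3 (g N) - contour_integral A3 (h N)) \<le> ?B * R * (2*pi - 3*pi/2)"
    proof (rule has_contour_integral_bound_part_circlepath)
      show "((\<lambda>z. g N z - h N z) has_contour_integral
          (contour_integral A3 (g N) - contour_integral A3 (h N))) (part_circlepath 0 R (3*pi/2) (2*pi))"
        using has_contour_integral_diff[OF has_contour_integral_integral[OF ig(3)]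
            has_contour_integral_integral[OF ih(1)]] by (simp add: A3_def)
    qed (use B R gh[OF N] sph re3 in \<open>auto simp: A3_def\<close>)
    have b2: "norm (contour_integral A2 (g N)) \<le> ?B * R * (3*pi/2 - pi/2)"
    proof (rule has_contour_integral_bound_part_circlepath)
      show "(g N has_contour_integral contour_integral A2 (g N)) (part_circlepath 0 R (pi/2) (3*pi/2))"
        using has_contour_integral_integral[OF ig(2)] by (simp add: A2_def)
    qed (use B R gl[OF N] sph re2 in \<open>auto simp: A2_def\<close>)
    have "2 * of_real pi * \<i> * S N 0 =
       (contour_integral A1 (g N) - contour_integral A1 (h N)) +
       (contour_integral A3 (g N) - contour_integral A3 (h N)) +
       contour_integral A2 (g N) - contour_integral L1 (h N) - contour_integral L2 (h N)"
      using circ[OF N] closed_int[OF N] by (simp add: algebra_simps) 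
    then have "norm (2 * of_real pi * \<i> * S N 0) \<le> ?B * R * (pi/2 - 0) + ?B * R * (2*pi - 3*pi/2)
       + ?B * R * (3*pi/2 - pi/2) + L / ln N + L / ln N"
      using b1 b2 b3 l1[OF N] l2[OF N]
      by (smt (verit) norm_triangle_ineq norm_triangle_ineq4)
    also have "\<dots> = 2 * pi * (2 * C / R) + 2 * (L / ln N)"
      using R by (simp add: field_simps power2_eq_square)
    also have "\<dots> \<le> 2 * pi * (2 * C / R) + 2 * pi * (L / ln N)"
    proof -
      have "L / ln N \<ge> 0" using M d N by (auto simp: L_def)
      moreover have "2 \<le> 2 * pi" using pi_ge_two by linarith
      ultimately show ?thesis using mult_right_mono by fastforce
    qed
    finally have "2 * pi * norm (S N 0) \<le> 2 * pi * (2 * C / R + L / ln N)"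
      by (simp add: norm_mult algebra_simps)
    then show ?thesis by simp
  qed
  have "(\<lambda>N::nat. L / ln (real N)) \<longlonglongrightarrow> 0" by real_asymp
  then have "eventually (\<lambda>N::nat. L / ln (real N) < \<epsilon> / 2) sequentially"
    using eps by (intro order_tendstoD) auto
  then have "eventually (\<lambda>N. norm (S N 0) < \<epsilon>) sequentially"
    using eventually_ge_at_top[of 3]
  proof eventually_elim
    case (elim N)
    have "2 * C / R = \<epsilon> / 2" using C eps by (simp add: R_def field_simps)
    then show ?case using main[OF elim(2)] elim(1) by linarith
  qed
  then show "\<exists>no. \<forall>n\<ge>no. norm (S n 0 - 0) < \<epsilon>"
    by (simp add: eventually_sequentially)
qed

text \<open>Subtracting \<open>F 0\<close> from both functions gives the previous lemma. To the left
  of the axis the constant has to be absorbed into the bound: with x = - Re z one has x <= x ln N <=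
  N^x as soon as N >= e, so N^x / x is at least 1. This is why the previous lemma asks for its
  bounds only from \<open>N \<ge> 3\<close> on.\<close>

theorem newman_tauberian:
  fixes F :: "complex \<Rightarrow> complex" and S :: "nat \<Rightarrow> complex \<Rightarrow> complex"
  assumes U: "open U" "{z. Re z \<ge> 0} \<subseteq> U" and F: "F holomorphic_on U"
    and S: "\<And>N. S N holomorphic_on UNIV"
    and right: "\<And>N z. N \<ge> 1 \<Longrightarrow> Re z > 0 \<Longrightarrow> norm (F z - S N z) \<le> C * real N powr (- Re z) / Re z"
    and left: "\<And>N z. N \<ge> 1 \<Longrightarrow> Re z < 0 \<Longrightarrow> norm (S N z) \<le> C * real N powr (- Re z) / (- Re z)"
  shows "(\<lambda>N. S N 0) \<longlonglongrightarrow> F 0"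
proof -
  define D where "D = \<bar>C\<bar> + norm (F 0) + 1"
  have "(\<lambda>N. S N 0 - F 0) \<longlonglongrightarrow> 0"
  proof (rule newman_tauberian_aux[where F = "\<lambda>z. F z - F 0" and S = "\<lambda>N z. S N z - F 0" and C = D, OF U])
    show "(\<lambda>z. F z - F 0) holomorphic_on U"
      by (intro holomorphic_intros F)
    show "(\<lambda>z. S N z - F 0) holomorphic_on UNIV" for N
      by (intro holomorphic_intros S)
    show "D > 0" by (simp add: D_def add_nonneg_pos)
    show "norm (F z - F 0 - (S N z - F 0)) \<le> D * real N powr (- Re z) / Re z"
      if "N \<ge> 3" "Re z > 0" for N z
    proof -
      have "norm (F z - F 0 - (S N z - F 0)) \<le> C * (real N powr (- Re z) / Re z)"
        using right[of N z] that by simp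
      also have "\<dots> \<le> D * (real N powr (- Re z) / Re z)"
      proof (rule mult_right_mono)
        show "C \<le> D" using norm_ge_zero[of "F 0"] unfolding D_def by linarith
      qed (use that in auto)
      finally show ?thesis by simp
    qed
    show "norm (S N z - F 0) \<le> D * real N powr (- Re z) / (- Re z)"
      if N: "N \<ge> 3" and z: "Re z < 0" for N z
    proof -
      have "(3::real) > exp 1" using exp_le e_less_272 by linarith
      then have "exp 1 \<le> real N" using N by linarith
      then have "ln (real N) \<ge> 1" using N by (simp add: ln_ge_iff)
      then have "- Re z * 1 \<le> - Re z * ln N"
        using z by (intro mult_left_mono) auto
      also have "\<dots> \<le> exp (- Re z * ln N)"
        using exp_ge_add_one_self[of "- Re z * ln N"] by linarith
      also have "\<dots> = real N powr (- Re z)" using N by (simp add: powr_def)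
      finally have "1 \<le> real N powr (- Re z) / (- Re z)"
        using z by (simp add: field_simps)
      then have "norm (F 0) * 1 \<le> norm (F 0) * (real N powr (- Re z) / (- Re z))"
        by (intro mult_left_mono) auto
      moreover have "norm (S N z) \<le> C * (real N powr (- Re z) / (- Re z))"
        using left[of N z] that by simp
      moreover have "norm (S N z - F 0) \<le> norm (S N z) + norm (F 0)"
        by (rule norm_triangle_ineq4)
      ultimately have "norm (S N z - F 0) \<le> (C + norm (F 0)) * (real N powr (- Re z) / (- Re z))"
        unfolding distrib_right by linarith
      also have "\<dots> \<le> D * (real N powr (- Re z) / (- Re z))"
      proof (rule mult_right_mono)
        show "C + norm (F 0) \<le> D" unfolding D_def by linarith
        show "0 \<le> real N powr (- Re z) / (- Re z)"
          using z by (intro divide_nonneg_pos) auto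
      qed
      finally show ?thesis by simp
    qed
  qed (auto)
  then show ?thesis by (simp add: LIM_zero_iff)
qed

section \<open>Dirichlet characters\<close>

definition dirichlet_char :: "nat \<Rightarrow> (nat \<Rightarrow> complex) \<Rightarrow> bool" where
  "dirichlet_char q \<chi> \<longleftrightarrow> (\<forall>m n. \<chi> (m * n) = \<chi> m * \<chi> n) \<and>
     (\<forall>m n. [m = n] (mod q) \<longrightarrow> \<chi> m = \<chi> n) \<and> (\<forall>n. \<chi> n \<noteq> 0 \<longleftrightarrow> coprime n q)"

definition principal_char :: "nat \<Rightarrow> nat \<Rightarrow> complex" where
  "principal_char q n = (if coprime n q then 1 else 0)"

lemma dirichlet_char_mult: "dirichlet_char q \<chi> \<Longrightarrow> \<chi> (m * n) = \<chi> m * \<chi> n"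
  and dirichlet_char_cong: "dirichlet_char q \<chi> \<Longrightarrow> [m = n] (mod q) \<Longrightarrow> \<chi> m = \<chi> n"
  and dirichlet_char_eq_0_iff: "dirichlet_char q \<chi> \<Longrightarrow> \<chi> n = 0 \<longleftrightarrow> \<not> coprime n q"
  unfolding dirichlet_char_def by blast+

lemma dirichlet_char_1:
  assumes "dirichlet_char q \<chi>"
  shows "\<chi> 1 = 1"
  using dirichlet_char_mult[OF assms, of 1 1] dirichlet_char_eq_0_iff[OF assms, of 1] by simp

lemma dirichlet_char_power:
  assumes "dirichlet_char q \<chi>"
  shows "\<chi> (n ^ k) = \<chi> n ^ k"
  by (induction k) (use dirichlet_char_1[OF assms] in \<open>auto simp: dirichlet_char_mult[OF assms]\<close>)

lemma dirichlet_char_power_totient: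
  assumes "dirichlet_char q \<chi>" "coprime n q"
  shows "\<chi> n ^ totient q = 1"
  using dirichlet_char_power[OF assms(1), of n "totient q"]
    dirichlet_char_cong[OF assms(1) euler_theorem[OF assms(2)]] dirichlet_char_1[OF assms(1)] by simp

lemma norm_dirichlet_char:
  assumes "dirichlet_char q \<chi>" "q > 0"
  shows "norm (\<chi> n) = (if coprime n q then 1 else 0)"
proof (cases "coprime n q")
  case True
  then show ?thesis
    using power_eq_1_iff[OF dirichlet_char_power_totient[OF assms(1) True]] assms(2) by auto
qed (use dirichlet_char_eq_0_iff[OF assms(1)] in auto)

lemma norm_dirichlet_char_le:
  assumes "dirichlet_char q \<chi>" "q > 0"
  shows "norm (\<chi> n) \<le> 1"
  by (simp add: norm_dirichlet_char[OF assms])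

lemma dirichlet_char_principal: "dirichlet_char q (principal_char q)"
  unfolding dirichlet_char_def
proof (intro conjI allI impI)
  fix m n assume mn: "[m = n] (mod q)"
  show "principal_char q m = principal_char q n"
    using cong_imp_coprime[OF mn] cong_imp_coprime[OF cong_sym[OF mn]]
    by (auto simp: principal_char_def)
qed (auto simp: principal_char_def)

lemma dirichlet_char_times:
  assumes "dirichlet_char q \<chi>" "dirichlet_char q \<psi>"
  shows "dirichlet_char q (\<lambda>n. \<chi> n * \<psi> n)"
  unfolding dirichlet_char_def
  using dirichlet_char_mult[OF assms(1)] dirichlet_char_mult[OF assms(2)]
    dirichlet_char_cong[OF assms(1)] dirichlet_char_cong[OF assms(2)]
    dirichlet_char_eq_0_iff[OF assms(1)] dirichlet_char_eq_0_iff[OF assms(2)]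
  by (auto simp: mult_ac)

section \<open>Extending characters from subgroups of the unit group\<close>

text \<open>A character of a subgroup of the units modulo \<open>q\<close>. The subgroup is
  represented by the set of all naturals lying in its classes, which avoids a quotient type;
  inverses are powers by Euler's theorem.\<close>

definition partial_char :: "nat \<Rightarrow> nat set \<Rightarrow> (nat \<Rightarrow> complex) \<Rightarrow> bool" where
  "partial_char q H \<chi> \<longleftrightarrow> 1 \<in> H \<and> \<chi> 1 = 1 \<and> (\<forall>m\<in>H. coprime m q) \<and>
     (\<forall>m\<in>H. \<forall>n\<in>H. m * n \<in> H \<and> \<chi> (m * n) = \<chi> m * \<chi> n) \<and>
     (\<forall>m\<in>H. \<forall>n. [m = n] (mod q) \<longrightarrow> n \<in> H \<and> \<chi> m = \<chi> n)"

lemma partial_char_power: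
  assumes "partial_char q H \<chi>" "h \<in> H"
  shows "h ^ k \<in> H \<and> \<chi> (h ^ k) = \<chi> h ^ k"
  by (induction k) (use assms in \<open>auto simp: partial_char_def\<close>)

text \<open>The power \<open>h ^ (totient q - 1)\<close> lies in \<open>H\<close> and inverts
  \<open>h\<close> modulo \<open>q\<close>.\<close>

lemma partial_char_cancel:
  assumes "partial_char q H \<chi>" "q > 0" "h \<in> H" "h * y \<in> H"
  shows "y \<in> H"
proof -
  have t: "totient q = Suc (totient q - 1)" using assms(2) by simp
  have "h ^ (totient q - 1) * (h * y) \<in> H"
    using assms partial_char_power[OF assms(1,3)] unfolding partial_char_def by blast
  moreover have "h ^ (totient q - 1) * (h * y) = h ^ totient q * y"
    by (subst t) simp
  moreover have "[h ^ totient q * y = 1 * y] (mod q)"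
    using assms(1,3) by (intro cong_mult euler_theorem) (auto simp: partial_char_def)
  ultimately show ?thesis using assms(1) unfolding partial_char_def by (metis mult_1)
qed

text \<open>Let N be the least positive exponent with \<open>x ^ N\<close> in \<open>H\<close>. Any
  exponent j with \<open>x ^ j\<close> in \<open>H\<close> is a multiple of N, by division with
  remainder, so the one condition on \<open>w\<close> already gives
  \<open>\<chi> (x ^ j) = w ^ j\<close>. Two representations \<open>h * x ^ i\<close> of the same
  class differ by such a power of \<open>x\<close>, hence \<open>\<chi> h * w ^ i\<close> is a
  well-defined value on the subgroup generated by \<open>H\<close> and \<open>x\<close>.\<close>

lemma partial_char_extend:
  fixes x q :: nat
  defines "P \<equiv> \<lambda>H n. n > 0 \<and> x ^ n \<in> H"
  assumes \<chi>: "partial_char q H \<chi>" and q: "q > 0" and x: "coprime x q"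
    and w: "w ^ (LEAST n. P H n) = \<chi> (x ^ (LEAST n. P H n))"
  shows "\<exists>H' \<chi>'. partial_char q H' \<chi>' \<and> H \<subseteq> H' \<and> x \<in> H' \<and> (\<forall>h\<in>H. \<chi>' h = \<chi> h) \<and> \<chi>' x = w"
proof -
  define N where "N = (LEAST n. P H n)"
  have H1: "1 \<in> H" and Hm: "\<And>m n. m \<in> H \<Longrightarrow> n \<in> H \<Longrightarrow> m * n \<in> H"
    and Hc: "\<And>m. m \<in> H \<Longrightarrow> coprime m q"
    and Hcg: "\<And>m n. m \<in> H \<Longrightarrow> [m = n] (mod q) \<Longrightarrow> n \<in> H"
    and X1: "\<chi> 1 = 1" and Xm: "\<And>m n. m \<in> H \<Longrightarrow> n \<in> H \<Longrightarrow> \<chi> (m * n) = \<chi> m * \<chi> n"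
    and Xcg: "\<And>m n. m \<in> H \<Longrightarrow> [m = n] (mod q) \<Longrightarrow> \<chi> m = \<chi> n"
    using \<chi> unfolding partial_char_def by blast+
  have "P H (totient q)"
    unfolding P_def using q Hcg[OF H1] euler_theorem[OF x] cong_sym by auto
  then have PN: "P H N" unfolding N_def by (rule LeastI)
  then have N: "N > 0" "x ^ N \<in> H" by (auto simp: P_def)
  have minN: "r = 0" if "r < N" "x ^ r \<in> H" for r
    using that not_less_Least[of r "P H"] unfolding N_def P_def by auto
  have B: "\<chi> (x ^ j) = w ^ j" if j: "x ^ j \<in> H" for j
  proof -
    have xj: "x ^ j = (x ^ N) ^ (j div N) * x ^ (j mod N)"
      by (simp flip: power_mult power_add)
    have "x ^ (j mod N) \<in> H"
      by (rule partial_char_cancel[OF \<chi> q, of "(x ^ N) ^ (j div N)"])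
        (use partial_char_power[OF \<chi> N(2)] j xj in auto)
    then have z: "j mod N = 0" using N by (intro minN) auto
    have "\<chi> (x ^ j) = \<chi> (x ^ N) ^ (j div N)"
      using partial_char_power[OF \<chi> N(2)] z by (subst xj) simp
    also have "\<dots> = w ^ j"
      using z w unfolding N_def[symmetric] by (metis add.right_neutral mult_div_mod_eq power_mult)
    finally show ?thesis .
  qed
  have D: "\<chi> h * w ^ i = \<chi> h' * w ^ j"
    if h: "h \<in> H" "h' \<in> H" "[h * x ^ i = h' * x ^ j] (mod q)" "i \<le> j" for h h' i j
  proof -
    have "h' * x ^ j = h' * x ^ (j - i) * x ^ i" using \<open>i \<le> j\<close> by (simp flip: power_add)
    with h(3) have "[h * x ^ i = h' * x ^ (j - i) * x ^ i] (mod q)" by (simp only:)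
    then have "[h = h' * x ^ (j - i)] (mod q)"
      using x by (subst (asm) cong_mult_rcancel_nat) auto
    then have hh: "h' * x ^ (j - i) \<in> H" "\<chi> h = \<chi> (h' * x ^ (j - i))"
      using Hcg Xcg h by auto
    have "x ^ (j - i) \<in> H" by (rule partial_char_cancel[OF \<chi> q h(2) hh(1)])
    then have "\<chi> h = \<chi> h' * w ^ (j - i)" using hh Xm h B by simp
    then show ?thesis using \<open>i \<le> j\<close> by (simp flip: power_add)
  qed
  have E: "\<chi> h * w ^ i = \<chi> h' * w ^ j"
    if "h \<in> H" "h' \<in> H" "[h * x ^ i = h' * x ^ j] (mod q)" for h h' i j
    using D[of h h' i j] D[of h' h j i] that cong_sym by (metis linear)
  define R where "R = (\<lambda>m h i. h \<in> H \<and> [m = h * x ^ i] (mod q))"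
  define H' where "H' = {m. \<exists>h i. R m h i}"
  define \<chi>' where "\<chi>' = (\<lambda>m. THE c. \<exists>h i. R m h i \<and> c = \<chi> h * w ^ i)"
  have val: "\<chi>' m = \<chi> h * w ^ i" if "R m h i" for m h i
    unfolding \<chi>'_def
  proof (rule the_equality)
    fix c assume "\<exists>h i. R m h i \<and> c = \<chi> h * w ^ i"
    then obtain h' j where h': "R m h' j" "c = \<chi> h' * w ^ j" by blast
    then have "[h' * x ^ j = h * x ^ i] (mod q)"
      using that unfolding R_def by (metis cong_sym cong_trans)
    then show "c = \<chi> h * w ^ i" using E h' that by (auto simp: R_def)
  qed (use that in blast)
  have R0: "R h h 0" if "h \<in> H" for h using that by (simp add: R_def)
  have Rx: "R x 1 1" using H1 by (simp add: R_def)
  have Rm: "R (m * n) (h * g) (i + j)" if "R m h i" "R n g j" for m n h g i j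
    using that Hm cong_mult[of m "h * x ^ i" q n "g * x ^ j"]
    by (auto simp: R_def power_add mult_ac)
  have Rc: "R n h i" if "R m h i" "[m = n] (mod q)" for m n h i
    using that unfolding R_def by (metis cong_sym cong_trans)
  have "partial_char q H' \<chi>'"
    unfolding partial_char_def
  proof (intro conjI ballI allI impI)
    show "1 \<in> H'" using R0[OF H1] by (auto simp: H'_def)
    show "\<chi>' 1 = 1" using val[OF R0[OF H1]] X1 by simp
    fix m assume "m \<in> H'"
    then obtain h i where hi: "R m h i" by (auto simp: H'_def)
    have "coprime (h * x ^ i) q" using hi x Hc by (auto simp: R_def)
    then show "coprime m q" using hi cong_imp_coprime cong_sym unfolding R_def by blast
    show "n \<in> H'" if "[m = n] (mod q)" for n
      using Rc[OF hi that] by (auto simp: H'_def)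
    show "\<chi>' m = \<chi>' n" if "[m = n] (mod q)" for n
      using val[OF Rc[OF hi that]] val[OF hi] by simp
    fix n assume "n \<in> H'"
    then obtain g j where gj: "R n g j" by (auto simp: H'_def)
    show "m * n \<in> H'" using Rm[OF hi gj] by (auto simp: H'_def)
    show "\<chi>' (m * n) = \<chi>' m * \<chi>' n"
      using val[OF Rm[OF hi gj]] val[OF hi] val[OF gj] Xm hi gj by (simp add: R_def power_add)
  qed
  moreover have "H \<subseteq> H'" using R0 by (auto simp: H'_def)
  moreover have "x \<in> H'" using Rx by (auto simp: H'_def)
  moreover have "\<forall>h\<in>H. \<chi>' h = \<chi> h" using val[OF R0] by simp
  moreover have "\<chi>' x = w" using val[OF Rx] X1 by simp
  ultimately show ?thesis by blast
qed

lemma ex_nth_root_complex: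
  assumes "n > 0"
  shows "\<exists>w::complex. w ^ n = c"
  using exists_complex_root[of n c] assms by (metis bot_nat_0.not_eq_extremum)

text \<open>Start from the trivial character on the class of 1. The order N of \<open>x\<close> is
  at least 2, so some N-th root of unity other than 1 is available as the value at \<open>x\<close>.
  Then the coprime numbers below \<open>q\<close> are adjoined one after the other, which exhausts
  all reduced classes.\<close>

lemma dirichlet_char_separates:
  assumes q: "q > 0" and x: "coprime x q" "\<not> [x = 1] (mod q)"
  shows "\<exists>\<chi>. dirichlet_char q \<chi> \<and> \<chi> x \<noteq> 1"
proof -
  define H0 where "H0 = {m. [m = 1] (mod q)}"
  have p0: "partial_char q H0 (\<lambda>_. 1)"
    unfolding partial_char_def H0_def
  proof (intro conjI ballI allI impI)
    fix m assume m: "m \<in> {m. [m = 1] (mod q)}"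
    then show "coprime m q" using cong_imp_coprime[of 1 m q] cong_sym by auto
    show "m * n \<in> {m. [m = 1] (mod q)}" if "n \<in> {m. [m = 1] (mod q)}" for n
      using cong_mult[of m 1 q n 1] m that by simp
    show "n \<in> {m. [m = 1] (mod q)}" if "[m = n] (mod q)" for n
      using m that by (metis cong_sym cong_trans mem_Collect_eq)
  qed auto
  define N where "N = (LEAST n. n > 0 \<and> x ^ n \<in> H0)"
  have "totient q > 0 \<and> x ^ totient q \<in> H0" using q euler_theorem[OF x(1)] by (simp add: H0_def)
  then have N: "N > 0 \<and> x ^ N \<in> H0" unfolding N_def by (rule LeastI)
  moreover have "N \<noteq> 1" using N x by (auto simp: H0_def)
  ultimately have "N \<ge> 2" by linarith
  then have "card {z::complex. z ^ N = 1} \<ge> 2" by (subst card_roots_unity_eq) auto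
  then have "{z::complex. z ^ N = 1} \<noteq> {1}" by force
  then obtain w :: complex where w: "w ^ N = 1" "w \<noteq> 1" by auto
  have base: "\<exists>H \<chi>. partial_char q H \<chi> \<and> x \<in> H \<and> \<chi> x = w"
    using partial_char_extend[OF p0 q x(1), of w] w unfolding N_def by metis
  have "\<exists>H \<chi>. partial_char q H \<chi> \<and> x \<in> H \<and> \<chi> x = w \<and> (\<forall>y<M. coprime y q \<longrightarrow> y \<in> H)" for M
  proof (induction M)
    case 0
    then show ?case using base by auto
  next
    case (Suc M)
    then obtain H \<chi> where H: "partial_char q H \<chi>" "x \<in> H" "\<chi> x = w"
      "\<forall>y<M. coprime y q \<longrightarrow> y \<in> H" by blast
    show ?case
    proof (cases "coprime M q")
      case True
      let ?n = "LEAST n. n > 0 \<and> M ^ n \<in> H"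
      have "[1 = M ^ totient q] (mod q)" using euler_theorem[OF True] by (rule cong_sym)
      then have "totient q > 0 \<and> M ^ totient q \<in> H"
        using q H(1) unfolding partial_char_def by (metis totient_gt_0_iff)
      then have "?n > 0 \<and> M ^ ?n \<in> H" by (rule LeastI)
      then obtain v where "v ^ ?n = \<chi> (M ^ ?n)" using ex_nth_root_complex by blast
      from partial_char_extend[OF H(1) q True this]
      obtain H' \<chi>' where H': "partial_char q H' \<chi>'" "H \<subseteq> H'" "M \<in> H'" "\<forall>h\<in>H. \<chi>' h = \<chi> h"
        by blast
      have "\<forall>y<Suc M. coprime y q \<longrightarrow> y \<in> H'" using H H' by (auto simp: less_Suc_eq)
      then show ?thesis using H H' by (intro exI[of _ H'] exI[of _ \<chi>']) auto
    qed (use H in \<open>auto simp: less_Suc_eq\<close>)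
  qed
  from this[of q] obtain H \<chi> where H: "partial_char q H \<chi>" "x \<in> H" "\<chi> x = w"
      "\<forall>y<q. coprime y q \<longrightarrow> y \<in> H" by blast
  have all: "n \<in> H" if "coprime n q" for n
  proof -
    have "n mod q \<in> H" using H(4) q that by simp
    then show ?thesis using H(1) unfolding partial_char_def by (meson cong_mod_left cong_refl)
  qed
  have Xm: "\<And>m n. m \<in> H \<Longrightarrow> n \<in> H \<Longrightarrow> \<chi> (m * n) = \<chi> m * \<chi> n"
    and Xc: "\<And>m n. m \<in> H \<Longrightarrow> [m = n] (mod q) \<Longrightarrow> \<chi> m = \<chi> n"
    using H(1) unfolding partial_char_def by blast+
  have "dirichlet_char q (\<lambda>n. if coprime n q then \<chi> n else 0)"
    unfolding dirichlet_char_def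
  proof (intro conjI allI impI)
    fix m n
    show "(if coprime (m * n) q then \<chi> (m * n) else 0) =
       (if coprime m q then \<chi> m else 0) * (if coprime n q then \<chi> n else 0)"
      using Xm[OF all all, of m n] by simp
    show "(if coprime m q then \<chi> m else 0) = (if coprime n q then \<chi> n else 0)" if "[m = n] (mod q)"
      using Xc[OF all that] cong_imp_coprime[OF that] cong_imp_coprime[OF cong_sym[OF that]] by auto
    show "((if coprime n q then \<chi> n else 0) \<noteq> 0) = coprime n q"
    proof (cases "coprime n q")
      case True
      have "[1 = n ^ totient q] (mod q)" using euler_theorem[OF True] by (rule cong_sym)
      then have "\<chi> (n ^ totient q) = 1" using H(1) unfolding partial_char_def by metis
      then have "\<chi> n ^ totient q = 1" using partial_char_power[OF H(1) all[OF True]] by simp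
      then show ?thesis using True q by (auto simp: power_0_left)
    qed auto
  qed
  moreover have "(if coprime x q then \<chi> x else 0) \<noteq> 1" using H(3) w x by simp
  ultimately show ?thesis by blast
qed

section \<open>Orthogonality relations\<close>

text \<open>For non-principal \<chi> choose a unit \<open>n\<close> with
  \<open>\<chi> n \<noteq> 1\<close>; multiplication by \<open>n\<close> permutes the residues, so
  the sum equals \<open>\<chi> n\<close> times itself.\<close>

lemma dirichlet_char_sum_lessThan:
  assumes "dirichlet_char q \<chi>" "q > 0"
  shows "(\<Sum>r<q. \<chi> r) = (if \<chi> = principal_char q then of_nat (totient q) else 0)"
proof (cases "\<chi> = principal_char q")
  case True
  have "(\<Sum>r<q. \<chi> r) = (\<Sum>r\<in>{r\<in>{..<q}. coprime r q}. 1)"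
    by (simp only: True principal_char_def sum.inter_filter finite_lessThan)
  \<comment> \<open>Residues are counted from 0 and totatives from 1. The two sets differ only for
    \<open>q = 1\<close>, where the single class is represented by 0 and by 1.\<close>
  also have "{r\<in>{..<q}. coprime r q} = (\<lambda>r. r mod q) ` totatives q"
  proof (cases "q = 1")
    case False
    then have "totatives q = {r\<in>{..<q}. coprime r q}"
      using assms(2) by (auto simp: totatives_def le_less intro: Suc_leI intro!: gr0I)
    moreover have "(\<lambda>r. r mod q) ` {r\<in>{..<q}. coprime r q} = (\<lambda>r. r) ` {r\<in>{..<q}. coprime r q}"
      by (rule image_cong) auto
    ultimately show ?thesis by simp
  qed auto
  also have "(\<Sum>r\<in>(\<lambda>r. r mod q) ` totatives q. 1) = complex_of_nat (card ((\<lambda>r. r mod q) ` totatives q))"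
    by simp
  also have "card ((\<lambda>r. r mod q) ` totatives q) = totient q"
    unfolding totient_def
  proof (rule card_image, cases "q = 1")
    case False
    then show "inj_on (\<lambda>r. r mod q) (totatives q)"
      using assms(2) by (auto simp: totatives_def le_less inj_on_def)
  qed auto
  finally show ?thesis using True by simp
next
  case False
  then obtain n where n: "coprime n q" "\<chi> n \<noteq> 1"
    using dirichlet_char_eq_0_iff[OF assms(1)] unfolding principal_char_def fun_eq_iff by metis
  have "bij_betw (\<lambda>r. (n * r) mod q) {..<q} {..<q}"
  proof -
    have inj: "inj_on (\<lambda>r. (n * r) mod q) {..<q}"
    proof (rule inj_onI)
      fix x y assume xy: "x \<in> {..<q}" "y \<in> {..<q}" "n * x mod q = n * y mod q"
      then have "[x = y] (mod q)"
        using cong_mult_lcancel_nat[OF n(1)] by (simp add: Cong.cong_def)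
      then show "x = y" using xy by (simp add: Cong.cong_def)
    qed
    moreover have "(\<lambda>r. (n * r) mod q) ` {..<q} = {..<q}"
      using assms(2) by (intro endo_inj_surj inj) auto
    ultimately show ?thesis by (simp only: bij_betw_def)
  qed
  then have "(\<Sum>r<q. \<chi> r) = (\<Sum>r<q. \<chi> ((n * r) mod q))"
    by (rule sum.reindex_bij_betw[symmetric])
  also have "\<dots> = (\<Sum>r<q. \<chi> n * \<chi> r)"
    by (intro sum.cong refl) (metis assms(1) cong_mod_left cong_refl dirichlet_char_cong dirichlet_char_mult)
  also have "\<dots> = \<chi> n * (\<Sum>r<q. \<chi> r)" by (rule sum_distrib_left[symmetric])
  finally have "(\<Sum>r<q. \<chi> r) = \<chi> n * (\<Sum>r<q. \<chi> r)" .
  then show ?thesis using n False by simp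
qed

lemma finite_dirichlet_chars:
  assumes "q > 0"
  shows "finite {\<chi>. dirichlet_char q \<chi>}"
proof -
  let ?V = "insert 0 {z::complex. z ^ totient q = 1}"
  have "finite (PiE {..<q} (\<lambda>_. ?V))"
    using assms by (intro finite_PiE) (auto intro!: finite_roots_unity simp: Suc_le_eq)
  moreover have "(\<lambda>\<chi>. restrict \<chi> {..<q}) ` {\<chi>. dirichlet_char q \<chi>} \<subseteq> PiE {..<q} (\<lambda>_. ?V)"
    using dirichlet_char_power_totient dirichlet_char_eq_0_iff
    by (intro image_subsetI) (auto simp: restrict_PiE_iff)
  moreover have "inj_on (\<lambda>\<chi>. restrict \<chi> {..<q}) {\<chi>. dirichlet_char q \<chi>}"
  proof (rule inj_onI)
    fix \<chi> \<psi> assume *: "\<chi> \<in> {\<chi>. dirichlet_char q \<chi>}" "\<psi> \<in> {\<chi>. dirichlet_char q \<chi>}"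
      "restrict \<chi> {..<q} = restrict \<psi> {..<q}"
    show "\<chi> = \<psi>"
    proof
      fix n
      have "\<chi> (n mod q) = \<psi> (n mod q)"
        using fun_cong[OF *(3), of "n mod q"] assms by simp
      moreover have "[n = n mod q] (mod q)" by (simp add: Cong.cong_def)
      ultimately show "\<chi> n = \<psi> n"
        using *(1,2) dirichlet_char_cong by (metis mem_Collect_eq)
    qed
  qed
  ultimately show ?thesis by (meson finite_imageD finite_subset)
qed

text \<open>The dual argument: multiplication by a character \<open>\<psi>\<close> with
  \<open>\<psi> g \<noteq> 1\<close> permutes the finite set of characters.\<close>

lemma sum_dirichlet_chars_aux:
  assumes q: "q > 0" and g: "coprime g q" "\<not> [g = 1] (mod q)"
  shows "(\<Sum>\<chi> | dirichlet_char q \<chi>. \<chi> g) = 0"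
proof -
  let ?X = "{\<chi>. dirichlet_char q \<chi>}"
  obtain \<psi> where \<psi>: "dirichlet_char q \<psi>" "\<psi> g \<noteq> 1"
    using dirichlet_char_separates[OF q g] by blast
  let ?f = "\<lambda>\<chi> n. \<psi> n * \<chi> n"
  have inj: "inj_on ?f ?X"
  proof (rule inj_onI)
    fix \<chi> \<chi>' assume *: "\<chi> \<in> ?X" "\<chi>' \<in> ?X" "?f \<chi> = ?f \<chi>'"
    show "\<chi> = \<chi>'"
    proof
      fix n
      show "\<chi> n = \<chi>' n"
        using fun_cong[OF *(3), of n] * dirichlet_char_eq_0_iff[OF \<psi>(1), of n]
          dirichlet_char_eq_0_iff[of q \<chi> n] dirichlet_char_eq_0_iff[of q \<chi>' n]
        by (cases "coprime n q") auto
    qed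
  qed
  have im: "?f ` ?X = ?X"
    using finite_dirichlet_chars[OF q] dirichlet_char_times[OF \<psi>(1)] inj
    by (intro endo_inj_surj) auto
  have "(\<Sum>\<chi>\<in>?X. \<chi> g) = (\<Sum>\<chi>\<in>?X. ?f \<chi> g)"
    using sum.reindex[OF inj, of "\<lambda>\<chi>. \<chi> g"] unfolding im o_def .
  also have "\<dots> = \<psi> g * (\<Sum>\<chi>\<in>?X. \<chi> g)" by (rule sum_distrib_left[symmetric])
  finally have "(\<Sum>\<chi>\<in>?X. \<chi> g) = \<psi> g * (\<Sum>\<chi>\<in>?X. \<chi> g)" .
  then show ?thesis using \<psi> by simp
qed

text \<open>Double counting of the values at all pairs of a character and a residue: summing over
  characters first, only the class of 1 survives; summing over residues first, only the principal
  character does. The residue of 1 is written \<open>1 mod q\<close> because it is 0 for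
  \<open>q = 1\<close>.\<close>

lemma card_dirichlet_chars:
  assumes q: "q > 0"
  shows "card {\<chi>. dirichlet_char q \<chi>} = totient q"
proof -
  let ?X = "{\<chi>. dirichlet_char q \<chi>}"
  have cong1: "[g = 1] (mod q) \<longleftrightarrow> g = 1 mod q" if "g < q" for g
    using that by (simp add: Cong.cong_def)
  have sg: "(\<Sum>\<chi>\<in>?X. \<chi> g) = (if g = 1 mod q then of_nat (card ?X) else 0)" if "g < q" for g
  proof (cases "g = 1 mod q")
    case True
    then have "\<chi> g = 1" if "\<chi> \<in> ?X" for \<chi>
      using that cong1[OF \<open>g < q\<close>] dirichlet_char_cong dirichlet_char_1 by (metis mem_Collect_eq)
    then have "(\<Sum>\<chi>\<in>?X. \<chi> g) = (\<Sum>\<chi>\<in>?X. 1)" by (intro sum.cong) auto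
    then show ?thesis using True by simp
  next
    case False
    show ?thesis
    proof (cases "coprime g q")
      case True
      then show ?thesis using sum_dirichlet_chars_aux[OF q True] cong1[OF that] False by simp
    next
      case ncop: False
      have "(\<Sum>\<chi>\<in>?X. \<chi> g) = 0"
        by (rule sum.neutral) (use dirichlet_char_eq_0_iff ncop in auto)
      then show ?thesis using False by simp
    qed
  qed
  have "of_nat (card ?X) = (\<Sum>g<q. \<Sum>\<chi>\<in>?X. \<chi> g)"
    using q by (simp add: sg sum.delta)
  also have "\<dots> = (\<Sum>\<chi>\<in>?X. \<Sum>g<q. \<chi> g)" by (rule sum.swap)
  also have "\<dots> = (\<Sum>\<chi>\<in>?X. if \<chi> = principal_char q then of_nat (totient q) else 0)"
    by (intro sum.cong refl dirichlet_char_sum_lessThan q) auto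
  also have "\<dots> = of_nat (totient q)"
    using finite_dirichlet_chars[OF q] dirichlet_char_principal by (simp add: sum.delta)
  finally show ?thesis using of_nat_eq_iff by blast
qed

text \<open>Values at units have modulus 1, so \<open>cnj (\<chi> a)\<close> is the value at an
  inverse \<open>b\<close> of \<open>a\<close>, and the sum becomes one over
  \<open>\<chi> (b * n)\<close>.\<close>

lemma dirichlet_char_orthogonality:
  assumes q: "q > 0" and a: "coprime a q"
  shows "(\<Sum>\<chi> | dirichlet_char q \<chi>. cnj (\<chi> a) * \<chi> n) =
     (if [n = a] (mod q) then of_nat (totient q) else 0)"
proof (cases "coprime n q")
  case True
  let ?X = "{\<chi>. dirichlet_char q \<chi>}"
  define b where "b = a ^ (totient q - 1)"
  have ab: "[a * b = 1] (mod q)"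
    using euler_theorem[OF a] q unfolding b_def
    by (metis Suc_pred' power_Suc totient_gt_0_iff)
  have "cnj (\<chi> a) = \<chi> b" if "\<chi> \<in> ?X" for \<chi>
  proof -
    have \<chi>: "dirichlet_char q \<chi>" using that by simp
    have "\<chi> a * \<chi> b = 1"
      using dirichlet_char_cong[OF \<chi> ab] dirichlet_char_mult[OF \<chi>] dirichlet_char_1[OF \<chi>] by simp
    moreover have "\<chi> a * cnj (\<chi> a) = 1"
      using norm_dirichlet_char[OF \<chi> q, of a] a complex_norm_square[of "\<chi> a"] by simp
    ultimately show ?thesis by (metis mult.commute mult.left_commute mult.right_neutral)
  qed
  then have "(\<Sum>\<chi>\<in>?X. cnj (\<chi> a) * \<chi> n) = (\<Sum>\<chi>\<in>?X. \<chi> (b * n))"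
    by (intro sum.cong refl) (auto simp: dirichlet_char_mult)
  moreover have "[b * n = 1] (mod q) \<longleftrightarrow> [n = a] (mod q)"
  proof
    assume "[b * n = 1] (mod q)"
    then have "[a * (b * n) = a * 1] (mod q)" by (intro cong_mult cong_refl)
    moreover have "[a * b * n = 1 * n] (mod q)" by (intro cong_mult cong_refl ab)
    ultimately show "[n = a] (mod q)"
      by (metis cong_sym cong_trans mult.assoc mult_1 mult.right_neutral)
  next
    assume "[n = a] (mod q)"
    then have "[b * n = b * a] (mod q)" by (intro cong_mult cong_refl)
    then show "[b * n = 1] (mod q)" using ab by (metis cong_trans mult.commute)
  qed
  moreover have "coprime (b * n) q" using a True by (simp add: b_def)
  moreover have "(\<Sum>\<chi>\<in>?X. \<chi> (b * n)) = of_nat (totient q)" if "[b * n = 1] (mod q)"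
  proof -
    have 1: "\<chi> (b * n) = 1" if "\<chi> \<in> ?X" for \<chi>
      using that \<open>[b * n = 1] (mod q)\<close> dirichlet_char_cong dirichlet_char_1 by (metis mem_Collect_eq)
    have "(\<Sum>\<chi>\<in>?X. \<chi> (b * n)) = (\<Sum>\<chi>\<in>?X. 1)" by (intro sum.cong 1 refl)
    then show ?thesis using card_dirichlet_chars[OF q] by simp
  qed
  ultimately show ?thesis using sum_dirichlet_chars_aux[OF q, of "b * n"] by auto
next
  case False
  then have "\<not> [n = a] (mod q)" using a cong_imp_coprime cong_sym by blast
  moreover have "(\<Sum>\<chi> | dirichlet_char q \<chi>. cnj (\<chi> a) * \<chi> n) = 0"
    by (rule sum.neutral) (use dirichlet_char_eq_0_iff False in auto)
  ultimately show ?thesis by simp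
qed

section \<open>Dirichlet L-series and their continuation\<close>

lemma norm_of_nat_powr: "norm (of_nat n powr z :: complex) = real n powr Re z"
  by (simp add: norm_powr_real_powr)

lemma holomorphic_series:
  fixes f :: "nat \<Rightarrow> complex \<Rightarrow> complex"
  assumes S: "open S" and hol: "\<And>n. f n holomorphic_on S"
    and bd: "\<And>x. x \<in> S \<Longrightarrow> \<exists>d h. 0 < d \<and> summable h \<and> (\<forall>n. \<forall>y\<in>ball x d \<inter> S. norm (f n y) \<le> h n)"
  shows "(\<lambda>s. \<Sum>n. f n s) holomorphic_on S"
    and "\<And>s. s \<in> S \<Longrightarrow> (\<lambda>n. deriv (f n) s) sums deriv (\<lambda>s. \<Sum>n. f n s) s"
    and "\<And>s. s \<in> S \<Longrightarrow> summable (\<lambda>n. norm (f n s))"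
proof -
  show "summable (\<lambda>n. norm (f n s))" if s: "s \<in> S" for s
  proof -
    obtain d h where dh: "0 < d" "summable h" "\<forall>n. \<forall>y\<in>ball s d \<inter> S. norm (f n y) \<le> h n"
      using bd[OF s] by blast
    show ?thesis
    proof (rule summable_comparison_test'[OF dh(2)])
      show "norm (norm (f n s)) \<le> h n" if "n \<ge> 0" for n
        using dh(1,3) s by simp
    qed
  qed
  have "\<exists>g g'. \<forall>x \<in> S. ((\<lambda>n. f n x) sums g x) \<and> ((\<lambda>n. deriv (f n) x) sums g' x) \<and>
      (g has_field_derivative g' x) (at x)"
  proof (rule series_and_derivative_comparison_local[OF S])
    show "(f n has_field_derivative deriv (f n) x) (at x)" if "x \<in> S" for n x
      by (rule holomorphic_derivI[OF hol S that])
    show "\<exists>d h. 0 < d \<and> summable h \<and>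
        (\<forall>\<^sub>F n in sequentially. \<forall>y\<in>ball x d \<inter> S. norm (f n y) \<le> h n)" if x: "x \<in> S" for x
    proof -
      obtain d h where "0 < d" "summable h" "\<forall>n. \<forall>y\<in>ball x d \<inter> S. norm (f n y) \<le> h n"
        using bd[OF x] by blast
      then show ?thesis by (intro exI[of _ d] exI[of _ h]) auto
    qed
  qed
  then obtain g g' where gg: "\<forall>x \<in> S. ((\<lambda>n. f n x) sums g x) \<and> ((\<lambda>n. deriv (f n) x) sums g' x) \<and>
      (g has_field_derivative g' x) (at x)" by (elim exE)
  have g: "\<And>x. x \<in> S \<Longrightarrow> (\<lambda>n. f n x) sums g x"
      "\<And>x. x \<in> S \<Longrightarrow> (\<lambda>n. deriv (f n) x) sums g' x"
      "\<And>x. x \<in> S \<Longrightarrow> (g has_field_derivative g' x) (at x)"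
    using gg by simp_all
  have d: "((\<lambda>s. \<Sum>n. f n s) has_field_derivative g' x) (at x)" if "x \<in> S" for x
    by (rule has_field_derivative_transform_within_open[OF g(3)[OF that] S that])
      (rule sums_unique[OF g(1)])
  then show "(\<lambda>s. \<Sum>n. f n s) holomorphic_on S"
    unfolding holomorphic_on_open[OF S] by blast
  show "(\<lambda>n. deriv (f n) s) sums deriv (\<lambda>s. \<Sum>n. f n s) s" if "s \<in> S" for s
    unfolding DERIV_imp_deriv[OF d[OF that]] by (rule g(2)[OF that])
qed

text \<open>Two applications of the mean value inequality on the segment: one to
  \<open>z powr (- s)\<close>, and with its result one to \<open>z powr (1 - s)\<close> minus its
  linear part at \<open>n\<close>. The gain from \<open>n powr (- Re s)\<close> to
  \<open>n powr (- Re s - 1)\<close> is what makes \<open>Lreg\<close> converge to the left of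
  1.\<close>

lemma powr_linear_approx:
  fixes s :: complex and n h :: real
  assumes n: "n > 0" and h: "h \<ge> 0" and s: "Re s > 0"
  shows "norm (of_real (n + h) powr (1 - s) - of_real n powr (1 - s) - (1 - s) * of_real n powr (- s) * of_real h)
     \<le> norm s * norm (s - 1) * h\<^sup>2 * n powr (- Re s - 1)"
proof -
  define I where "I = closed_segment (complex_of_real n) (of_real (n + h))"
  have I: "\<exists>u. z = of_real u \<and> n \<le> u \<and> u \<le> n + h" if "z \<in> I" for z
    using that h unfolding I_def closed_segment_of_real by (auto simp: closed_segment_eq_real_ivl)
  have ends: "of_real n \<in> I" "of_real (n + h) \<in> I" by (auto simp: I_def)
  have conv: "convex I" unfolding I_def by (rule convex_closed_segment)
  have nonneg: "z \<notin> \<real>\<^sub>\<le>\<^sub>0" if "z \<in> I" for z using I[OF that] n by auto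
  have d1: "norm (z powr (- s) - of_real n powr (- s)) \<le> norm s * n powr (- Re s - 1) * h" if z: "z \<in> I" for z
  proof -
    have "norm (z powr (- s) - of_real n powr (- s)) \<le> norm s * n powr (- Re s - 1) * norm (z - of_real n)"
    proof (rule field_differentiable_bound[OF conv])
      show "((\<lambda>z. z powr (- s)) has_field_derivative - s * y powr (- s - 1)) (at y within I)"
        if "y \<in> I" for y
        using has_field_derivative_powr[OF nonneg[OF that], of "- s"] has_field_derivative_at_within by blast
      show "norm (- s * y powr (- s - 1)) \<le> norm s * n powr (- Re s - 1)" if y: "y \<in> I" for y
      proof -
        obtain u where u: "y = of_real u" "n \<le> u" using I[OF y] by blast
        have "norm (y powr (- s - 1)) = u powr (- Re s - 1)"
          using u n by (simp add: norm_powr_real_powr)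
        also have "\<dots> \<le> n powr (- Re s - 1)"
          using u n s by (intro powr_mono2') auto
        finally show ?thesis by (simp add: norm_mult mult_left_mono)
      qed
    qed (use z ends in auto)
    also have "norm (z - of_real n) \<le> h"
    proof -
      obtain u where "z = of_real u" "n \<le> u" "u \<le> n + h" using I[OF z] by blast
      then show ?thesis by (metis abs_of_nonneg add.commute diff_ge_0_iff_ge diff_le_eq norm_of_real of_real_diff)
    qed
    finally show ?thesis by (simp add: mult_left_mono)
  qed
  let ?F = "\<lambda>z. z powr (1 - s) - (1 - s) * of_real n powr (- s) * z"
  have "norm (?F (of_real (n + h)) - ?F (of_real n)) \<le>
      norm (1 - s) * (norm s * n powr (- Re s - 1) * h) * norm (complex_of_real (n + h) - of_real n)"
  proof (rule field_differentiable_bound[OF conv])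
    fix y assume y: "y \<in> I"
    show "(?F has_field_derivative (1 - s) * (y powr (- s) - of_real n powr (- s))) (at y within I)"
      using nonneg[OF y]
      by (auto intro!: derivative_eq_intros has_field_derivative_powr[THEN has_field_derivative_at_within] simp: algebra_simps)
    show "norm ((1 - s) * (y powr (- s) - of_real n powr (- s))) \<le> norm (1 - s) * (norm s * n powr (- Re s - 1) * h)"
      unfolding norm_mult by (intro mult_left_mono d1 y) auto
  qed (use ends in auto)
  also have "norm (complex_of_real (n + h) - of_real n) = h" using h by simp
  also have "?F (of_real (n + h)) - ?F (of_real n) =
     of_real (n + h) powr (1 - s) - of_real n powr (1 - s) - (1 - s) * of_real n powr (- s) * of_real h"
    by (simp add: algebra_simps)
  finally show ?thesis by (simp add: power2_eq_square mult_ac norm_minus_commute)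
qed

lemma summable_Suc_powr: "c > 1 \<Longrightarrow> summable (\<lambda>n. real (Suc n) powr (- c))"
  using summable_real_powr_iff[of "- c"] by (subst summable_Suc_iff) auto

definition Lseries :: "(nat \<Rightarrow> complex) \<Rightarrow> complex \<Rightarrow> complex" where
  "Lseries \<chi> s = (\<Sum>n. \<chi> (Suc n) * of_nat (Suc n) powr (- s))"

text \<open>
  The term \<open>(s - 1) n\<^sup>-\<^sup>s\<close> minus the difference quotient of \<open>u\<^sup>1\<^sup>-\<^sup>s\<close> over \<open>[n, n + q]\<close> is
  \<open>O(n\<^sup>-\<^sup>1\<^sup>-\<^sup>\<sigma>)\<close>, and by periodicity of \<open>\<chi>\<close> the difference quotients telescope to a sum over one
  period. So this is \<open>(s - 1) L(s, \<chi>)\<close> for \<open>\<sigma> > 1\<close>, but converges for \<open>\<sigma> > 0\<close>.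
\<close>

definition Lreg :: "nat \<Rightarrow> (nat \<Rightarrow> complex) \<Rightarrow> complex \<Rightarrow> complex" where
  "Lreg q \<chi> s =
     (\<Sum>n. \<chi> (Suc n) * ((s - 1) * of_nat (Suc n) powr (- s) -
        (of_nat (Suc n) powr (1 - s) - of_nat (Suc n + q) powr (1 - s)) / of_nat q)) +
     (\<Sum>r<q. \<chi> (Suc r) * of_nat (Suc r) powr (1 - s)) / of_nat q"

lemma open_Re_gt: "open {s. Re s > c}"
  by (rule open_halfspace_Re_gt)

lemma Re_ball_gt:
  assumes "y \<in> ball x ((Re x - c) / 2)"
  shows "Re y > (Re x + c) / 2"
proof -
  have "\<bar>Re x - Re y\<bar> < (Re x - c) / 2"
    using assms abs_Re_le_cmod[of "x - y"] by (simp add: dist_norm)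
  then show ?thesis by (simp add: field_simps abs_if split: if_splits)
qed

context
  fixes \<chi> :: "nat \<Rightarrow> complex"
  assumes \<chi>: "\<And>n. norm (\<chi> n) \<le> 1"
begin

lemma Lseries_bound:
  "Re x > 1 \<Longrightarrow> \<exists>d h. 0 < d \<and> summable h \<and>
    (\<forall>n. \<forall>y\<in>ball x d \<inter> {s. Re s > 1}. norm (\<chi> (Suc n) * of_nat (Suc n) powr (- y)) \<le> h n)"
proof (intro exI[of _ "(Re x - 1) / 2"] exI[of _ "\<lambda>n. real (Suc n) powr - ((Re x + 1) / 2)"] conjI ballI allI)
  fix n y assume x: "Re x > 1" and y: "y \<in> ball x ((Re x - 1) / 2) \<inter> {s. Re s > 1}"
  have "norm (\<chi> (Suc n) * of_nat (Suc n) powr (- y)) \<le> 1 * real (Suc n) powr (- Re y)"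
    unfolding norm_mult norm_of_nat_powr by (intro mult_mono \<chi>) auto
  also have "\<dots> \<le> real (Suc n) powr - ((Re x + 1) / 2)"
    using y Re_ball_gt[of y x 1] by (auto intro!: powr_mono)
  finally show "norm (\<chi> (Suc n) * of_nat (Suc n) powr (- y)) \<le> real (Suc n) powr - ((Re x + 1) / 2)" .
next
  assume "Re x > 1"
  then show "summable (\<lambda>n. real (Suc n) powr - ((Re x + 1) / 2))"
    by (intro summable_Suc_powr) simp
qed auto

lemma holomorphic_Lseries: "Lseries \<chi> holomorphic_on {s. Re s > 1}"
  unfolding Lseries_def
  by (rule holomorphic_series[OF open_Re_gt]) (use Lseries_bound in \<open>auto intro!: holomorphic_intros\<close>)

lemma summable_Lseries:
  "Re s > 1 \<Longrightarrow> summable (\<lambda>n. norm (\<chi> (Suc n) * of_nat (Suc n) powr (- s)))"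
  by (rule holomorphic_series(3)[OF open_Re_gt[of 1], of "\<lambda>n s. \<chi> (Suc n) * of_nat (Suc n) powr (- s)"])
    (use Lseries_bound in \<open>auto intro!: holomorphic_intros\<close>)

lemma Lseries_sums:
  "Re s > 1 \<Longrightarrow> (\<lambda>n. \<chi> (Suc n) * of_nat (Suc n) powr (- s)) sums Lseries \<chi> s"
  unfolding Lseries_def using summable_norm_cancel[OF summable_Lseries] by (rule summable_sums)

lemma deriv_Lseries_sums:
  assumes s: "Re s > 1"
  shows "(\<lambda>n. - of_real (ln (Suc n)) * \<chi> (Suc n) * of_nat (Suc n) powr (- s)) sums deriv (Lseries \<chi>) s"
proof -
  have "(\<lambda>n. deriv (\<lambda>s. \<chi> (Suc n) * of_nat (Suc n) powr (- s)) s) sums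
     deriv (\<lambda>s. \<Sum>n. \<chi> (Suc n) * of_nat (Suc n) powr (- s)) s"
    by (rule holomorphic_series(2)[OF open_Re_gt[of 1]])
      (use Lseries_bound s in \<open>auto intro!: holomorphic_intros\<close>)
  moreover have "deriv (\<lambda>s. \<chi> (Suc n) * of_nat (Suc n) powr (- s)) s =
      - of_real (ln (Suc n)) * \<chi> (Suc n) * of_nat (Suc n) powr (- s)" for n
    unfolding powr_def
    by (intro DERIV_imp_deriv)
      (auto intro!: derivative_eq_intros simp del: of_nat_Suc simp: Ln_of_nat)
  ultimately show ?thesis unfolding Lseries_def by simp
qed

lemma Lreg_bound:
  assumes q: "q > 0" and x: "Re x > 0"
  shows "\<exists>d h. 0 < d \<and> summable h \<and> (\<forall>n. \<forall>y\<in>ball x d \<inter> {s. Re s > 0}.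
    norm (\<chi> (Suc n) * ((y - 1) * of_nat (Suc n) powr (- y) -
        (of_nat (Suc n) powr (1 - y) - of_nat (Suc n + q) powr (1 - y)) / of_nat q)) \<le> h n)"
proof -
  \<comment> \<open>Bounds \<open>norm y * norm (y - 1) * q\<close> on the ball of radius
    \<open>Re x / 2\<close> around \<open>x\<close>.\<close>
  define K where "K = (norm x + Re x) * (norm x + Re x + 1) * real q"
  let ?h = "\<lambda>n. K * real (Suc n) powr - (Re x / 2 + 1)"
  show ?thesis
  proof (intro exI[of _ "Re x / 2"] exI[of _ ?h] conjI ballI allI)
    show "summable ?h" using x by (intro summable_mult summable_Suc_powr) auto
    fix n y assume y: "y \<in> ball x (Re x / 2) \<inter> {s. Re s > 0}"
    have re: "Re y > Re x / 2" using y Re_ball_gt[of y x 0] by simp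
    have "norm y \<le> norm x + Re x"
      using y x norm_triangle_ineq4[of x "x - y"] by (simp add: dist_norm)
    moreover have "norm (y - 1) \<le> norm y + 1" using norm_triangle_ineq4[of y 1] by simp
    ultimately have ny: "norm y \<le> norm x + Re x" "norm (y - 1) \<le> norm x + Re x + 1" by auto
    let ?A = "of_real (real (Suc n) + real q) powr (1 - y) - of_real (real (Suc n)) powr (1 - y) -
        (1 - y) * of_real (real (Suc n)) powr (- y) * of_real (real q) :: complex"
    have "(y - 1) * of_nat (Suc n) powr (- y) -
        (of_nat (Suc n) powr (1 - y) - of_nat (Suc n + q) powr (1 - y)) / of_nat q = ?A / of_nat q"
      using q by (simp add: field_simps)
    then have "norm (\<chi> (Suc n) * ((y - 1) * of_nat (Suc n) powr (- y) -
        (of_nat (Suc n) powr (1 - y) - of_nat (Suc n + q) powr (1 - y)) / of_nat q))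
      = norm (\<chi> (Suc n)) * (norm ?A / real q)"
      by (simp add: norm_mult norm_divide del: of_nat_Suc)
    also have "\<dots> \<le> 1 * (norm y * norm (y - 1) * (real q)\<^sup>2 * real (Suc n) powr (- Re y - 1) / real q)"
      using y q by (intro mult_mono \<chi> divide_right_mono powr_linear_approx) auto
    also have "\<dots> = (norm y * norm (y - 1) * real q) * real (Suc n) powr (- Re y - 1)"
      using q by (simp add: power2_eq_square)
    also have "\<dots> \<le> K * real (Suc n) powr - (Re x / 2 + 1)"
      unfolding K_def using re ny x by (intro mult_mono powr_mono) auto
    finally show "norm (\<chi> (Suc n) * ((y - 1) * of_nat (Suc n) powr (- y) -
        (of_nat (Suc n) powr (1 - y) - of_nat (Suc n + q) powr (1 - y)) / of_nat q)) \<le> ?h n" .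
  qed (use x in auto)
qed

lemma holomorphic_Lreg: "q > 0 \<Longrightarrow> Lreg q \<chi> holomorphic_on {s. Re s > 0}"
  unfolding Lreg_def
  by (intro holomorphic_on_add holomorphic_series(1)[OF open_Re_gt])
    (use Lreg_bound in \<open>auto intro!: holomorphic_intros\<close>)

end

lemma sum_telescope_shift:
  fixes b :: "nat \<Rightarrow> 'a::comm_ring_1"
  shows "(\<Sum>n<N. b n - b (n + q)) = (\<Sum>n<q. b n) - (\<Sum>n<q. b (N + n))"
proof (induction N)
  case (Suc N)
  have "(\<Sum>n<q. b (Suc N + n)) + b N = (\<Sum>n<Suc q. b (N + n))"
    by (subst sum.lessThan_Suc_shift) simp
  then have "(\<Sum>n<q. b (Suc N + n)) = (\<Sum>n<q. b (N + n)) + b (N + q) - b N"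
    by (simp add: algebra_simps)
  then show ?case by (simp only: sum.lessThan_Suc Suc.IH) simp
qed simp

lemma telescope_shift_sums:
  fixes b :: "nat \<Rightarrow> complex"
  assumes "b \<longlonglongrightarrow> 0"
  shows "(\<lambda>n. b n - b (n + q)) sums (\<Sum>n<q. b n)"
proof -
  have "(\<lambda>N. \<Sum>n<q. b (N + n)) \<longlonglongrightarrow> (\<Sum>n<q. 0)"
    by (intro tendsto_sum) (use LIMSEQ_ignore_initial_segment[OF assms] in auto)
  then have "(\<lambda>N. (\<Sum>n<q. b n) - (\<Sum>n<q. b (N + n))) \<longlonglongrightarrow> (\<Sum>n<q. b n) - 0"
    by (intro tendsto_intros) simp
  then show ?thesis unfolding sums_def sum_telescope_shift by simp
qed

lemma Lreg_eq:
  assumes \<chi>: "dirichlet_char q \<chi>" and q: "q > 0" and s: "Re s > 1"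
  shows "Lreg q \<chi> s = (s - 1) * Lseries \<chi> s"
proof -
  note bd = norm_dirichlet_char_le[OF \<chi> q]
  define b where "b = (\<lambda>n. \<chi> (Suc n) * of_nat (Suc n) powr (1 - s))"
  have per: "\<chi> (Suc n + q) = \<chi> (Suc n)" for n
    by (rule dirichlet_char_cong[OF \<chi>]) (unfold Cong.cong_def, rule mod_add_self2)
  have "(\<lambda>n. real (Suc n) powr (1 - Re s)) \<longlonglongrightarrow> 0"
    using s tendsto_neg_powr[of "1 - Re s" "\<lambda>n. real (Suc n)" sequentially]
      filterlim_compose[OF filterlim_real_sequentially filterlim_Suc] by auto
  moreover have "norm (b n) \<le> real (Suc n) powr (1 - Re s)" for n
    using mult_right_mono[OF bd[of "Suc n"], of "real (Suc n) powr (1 - Re s)"]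
    unfolding b_def norm_mult norm_of_nat_powr by simp
  ultimately have "b \<longlonglongrightarrow> 0"
    by (intro Lim_null_comparison[of b "\<lambda>n. real (Suc n) powr (1 - Re s)"]) auto
  from sums_divide[OF telescope_shift_sums[OF this, of q], of "of_nat q"]
  have "(\<lambda>n. (s - 1) * (\<chi> (Suc n) * of_nat (Suc n) powr (- s)) - (b n - b (n + q)) / of_nat q) sums
      ((s - 1) * Lseries \<chi> s - (\<Sum>r<q. b r) / of_nat q)"
    by (intro sums_diff sums_mult Lseries_sums bd s)
  moreover have "(s - 1) * (\<chi> (Suc n) * of_nat (Suc n) powr (- s)) - (b n - b (n + q)) / of_nat q =
      \<chi> (Suc n) * ((s - 1) * of_nat (Suc n) powr (- s) -
        (of_nat (Suc n) powr (1 - s) - of_nat (Suc n + q) powr (1 - s)) / of_nat q)" for n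
  proof -
    have "b (n + q) = \<chi> (Suc n) * of_nat (Suc n + q) powr (1 - s)"
      using per[of n] by (simp add: b_def)
    then show ?thesis using q by (simp add: b_def field_simps del: of_nat_Suc)
  qed
  ultimately show ?thesis
    unfolding Lreg_def by (simp add: sums_unique[symmetric] b_def)
qed

text \<open>At 1 every term of the infinite series vanishes, because powers with exponent 0 of
  positive numbers are 1. What remains is the average of \<chi> over one period, the residue of the
  L-function.\<close>

lemma Lreg_1:
  assumes \<chi>: "dirichlet_char q \<chi>" and q: "q > 0"
  shows "Lreg q \<chi> 1 = (if \<chi> = principal_char q then of_nat (totient q) / of_nat q else 0)"
proof -
  have "\<chi> q = \<chi> 0" by (rule dirichlet_char_cong[OF \<chi>]) (simp add: Cong.cong_def)
  then have "(\<Sum>r<q. \<chi> (Suc r)) = (\<Sum>r<q. \<chi> r)"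
    using sum.lessThan_Suc_shift[of \<chi> q] by simp
  then show ?thesis
    using dirichlet_char_sum_lessThan[OF \<chi> q] by (simp add: Lreg_def del: of_nat_Suc of_nat_add)
qed

text \<open>Provides the point that excludes an identically vanishing L-function when orders of
  zeros are taken. The first term is 1, and the others are dominated for m >= 2 by 1 / (2 (m - 1)
  m), since m^3 >= 2 (m - 1) m; these telescope to 1/2.\<close>

lemma Lseries_nonzero_at_3:
  assumes \<chi>: "dirichlet_char q \<chi>" and q: "q > 0"
  shows "Lseries \<chi> 3 \<noteq> 0"
proof
  assume 0: "Lseries \<chi> 3 = 0"
  note bd = norm_dirichlet_char_le[OF \<chi> q]
  have "(\<lambda>n. \<chi> (Suc n) * of_nat (Suc n) powr (- 3)) sums 0"
    using Lseries_sums[of \<chi> 3, OF bd] 0 by simp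
  then have "(\<lambda>n. \<chi> (Suc (Suc n)) * of_nat (Suc (Suc n)) powr (- 3)) sums (0 - \<chi> 1)"
    using sums_Suc_iff[of "\<lambda>n. \<chi> (Suc n) * of_nat (Suc n) powr (- 3)"] by simp
  then have s1: "(\<lambda>n. \<chi> (Suc (Suc n)) * of_nat (Suc (Suc n)) powr (- 3)) sums (- 1)"
    using dirichlet_char_1[OF \<chi>] by simp
  have tel: "(\<lambda>n. 1 / 2 * (1 / real (Suc n)) - 1 / 2 * (1 / real (Suc (Suc n)))) sums (1 / 2 * (1 / real (Suc 0)) - 0)"
    by (rule telescope_sums'[of "\<lambda>n. 1 / 2 * (1 / real (Suc n))" 0]) real_asymp
  have le: "norm (\<chi> (Suc (Suc n)) * of_nat (Suc (Suc n)) powr (- 3)) \<le> 1 / 2 * (1 / real (Suc n)) - 1 / 2 * (1 / real (Suc (Suc n)))" for n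
  proof -
    have "norm (\<chi> (Suc (Suc n)) * of_nat (Suc (Suc n)) powr (- 3)) \<le> 1 * real (Suc (Suc n)) powr (- 3)"
      unfolding norm_mult norm_of_nat_powr by (intro mult_mono bd) auto
    also have "\<dots> = 1 / real (Suc (Suc n)) ^ 3"
      by (simp add: powr_minus_divide powr_numeral del: of_nat_Suc)
    also have "\<dots> \<le> 1 / (2 * (real (Suc n) * real (Suc (Suc n))))"
    proof (rule divide_left_mono)
      have "real (Suc n) * 2 \<le> real (Suc (Suc n)) * real (Suc (Suc n))" 
        by (intro mult_mono) auto
      then have "(real (Suc n) * 2) * real (Suc (Suc n)) \<le> real (Suc (Suc n)) * real (Suc (Suc n)) * real (Suc (Suc n))"
        by (intro mult_right_mono) auto
      then show "2 * (real (Suc n) * real (Suc (Suc n))) \<le> real (Suc (Suc n)) ^ 3"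
        by (simp add: power3_eq_cube algebra_simps)
    qed auto
    also have "\<dots> = 1 / 2 * (1 / real (Suc n)) - 1 / 2 * (1 / real (Suc (Suc n)))"
      by (simp add: divide_simps) (simp add: algebra_simps)
    finally show ?thesis .
  qed
  have "norm (\<Sum>n. \<chi> (Suc (Suc n)) * of_nat (Suc (Suc n)) powr (- 3)) \<le>
      (\<Sum>n. 1 / 2 * (1 / real (Suc n)) - 1 / 2 * (1 / real (Suc (Suc n))))"
    by (rule norm_suminf_le[OF le sums_summable[OF tel]])
  also have "\<dots> = 1 / 2" using sums_unique[OF tel] by simp
  finally show False unfolding sums_unique[OF s1, symmetric] by simp
qed

text \<open>Rearranges an absolutely convergent double series along the hyperbolas d e = n. It
  serves both for a product of Dirichlet series and for the Lambert series of a real character;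
  \<open>h\<close> collects the row sums of absolute values.\<close>

lemma sums_divisors_regroup:
  fixes F :: "nat \<Rightarrow> nat \<Rightarrow> complex" and g h :: "nat \<Rightarrow> _"
  assumes F: "\<And>d. d > 0 \<Longrightarrow> (\<lambda>e. F d (Suc e)) sums g d"
    and nF: "\<And>d. d > 0 \<Longrightarrow> (\<lambda>e. norm (F d (Suc e))) sums h d"
    and h: "summable (\<lambda>d. h (Suc d))"
  shows "(\<lambda>n. \<Sum>d | d dvd Suc n. F d (Suc n div d)) sums (\<Sum>d. g (Suc d))"
proof -
  have pos: "(f has_sum S) {0<..} \<longleftrightarrow> ((\<lambda>n. f (Suc n)) has_sum S) UNIV" for f :: "nat \<Rightarrow> 'b::{comm_monoid_add,topological_space}" and S
    unfolding greaterThan_0 by (subst has_sum_reindex) (auto simp: o_def)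
  have hF: "((\<lambda>e. F d e) has_sum g d) {0<..}" if "d > 0" for d
    unfolding pos by (rule norm_summable_imp_has_sum[OF sums_summable[OF nF[OF that]] F[OF that]])
  have hn: "((\<lambda>e. norm (F d e)) has_sum h d) {0<..}" if "d > 0" for d
    unfolding pos using sums_summable[OF nF[OF that]]
    by (intro norm_summable_imp_has_sum nF[OF that]) simp
  have h0: "h d \<ge> 0" if "d > 0" for d
    by (rule sums_le[OF _ sums_zero nF[OF that]]) simp
  have "((\<lambda>d. h d) has_sum (\<Sum>d. h (Suc d))) {0<..}"
    unfolding pos
  proof (rule norm_summable_imp_has_sum[OF _ summable_sums[OF h]])
    show "summable (\<lambda>d. norm (h (Suc d)))" using h h0 by simp
  qed
  then have hs: "h summable_on {0<..}" by (rule has_sum_imp_summable)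
  have absn: "(\<lambda>(d, e). norm (F d e)) summable_on ({0<..} \<times> {0<..})"
  proof (rule summable_on_SigmaI[OF _ hs])
    show "((\<lambda>e. case (d, e) of (d, e) \<Rightarrow> norm (F d e)) has_sum h d) {0<..}" if "d \<in> {0<..}" for d
      using hn[of d] that by simp
  qed simp
  have absF: "(\<lambda>(d, e). F d e) summable_on ({0<..} \<times> {0<..})"
    by (rule abs_summable_summable) (use absn in \<open>simp add: case_prod_unfold\<close>)
  have gle: "norm (g d) \<le> h d" if "d > 0" for d
    using summable_norm[OF sums_summable[OF nF[OF that]]]
    by (simp only: sums_unique[OF F[OF that], symmetric] sums_unique[OF nF[OF that], symmetric])
  have sg: "summable (\<lambda>d. norm (g (Suc d)))"
    by (rule summable_comparison_test'[OF h, of 0]) (simp add: gle)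
  have hg: "(g has_sum (\<Sum>d. g (Suc d))) {0<..}"
    unfolding pos by (rule norm_summable_imp_has_sum[OF sg summable_sums[OF summable_norm_cancel[OF sg]]])
  have "((\<lambda>(d, e). F d e) has_sum (\<Sum>d. g (Suc d))) ({0<..} \<times> {0<..})"
  proof (rule has_sum_SigmaI[OF _ hg absF])
    show "((\<lambda>e. case (d, e) of (d, e) \<Rightarrow> F d e) has_sum g d) {0<..}" if "d \<in> {0<..}" for d
      using hF[of d] that by simp
  qed
  also have "?this \<longleftrightarrow> ((\<lambda>(n, d). F d (n div d)) has_sum (\<Sum>d. g (Suc d))) (Sigma {0<..} (\<lambda>n. {d. d dvd n}))"
    by (rule has_sum_reindex_bij_witness[where i = "\<lambda>(n, d). (d, n div d)" and j = "\<lambda>(d, e). (d * e, d)"])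
      (clarsimp, auto intro: Nat.gr0I)
  finally have "((\<lambda>n. \<Sum>d | d dvd n. F d (n div d)) has_sum (\<Sum>d. g (Suc d))) {0<..}"
    by (rule has_sum_SigmaD) (auto intro!: has_sum_finiteI)
  then show ?thesis unfolding pos by (rule has_sum_imp_sums)
qed

section \<open>Logarithmic derivatives and non-vanishing\<close>

lemma summable_mangoldt_powr:
  assumes "\<sigma> > 1"
  shows "summable (\<lambda>n. mangoldt (Suc n) * real (Suc n) powr (- \<sigma>))"
proof (rule summable_comparison_test'[of _ 0])
  \<comment> \<open>Half of the excess over 1 is spent on
    \<open>ln n \<le> n powr \<epsilon> / \<epsilon>\<close>, so the remaining exponent
    \<open>(\<sigma> + 1) / 2\<close> still exceeds 1.\<close>
  define \<epsilon> where "\<epsilon> = (\<sigma> - 1) / 2"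
  have e: "\<epsilon> > 0" using assms by (simp add: \<epsilon>_def)
  show "summable (\<lambda>n. 1 / \<epsilon> * real (Suc n) powr (- ((\<sigma> + 1) / 2)))"
    using assms by (intro summable_mult summable_Suc_powr) auto
  show "norm (mangoldt (Suc n) * real (Suc n) powr (- \<sigma>)) \<le> 1 / \<epsilon> * real (Suc n) powr (- ((\<sigma> + 1) / 2))" for n
  proof -
    have "norm (mangoldt (Suc n) * real (Suc n) powr (- \<sigma>)) = mangoldt (Suc n) * real (Suc n) powr (- \<sigma>)"
      by (simp add: mangoldt_nonneg)
    also have "\<dots> \<le> real (Suc n) powr \<epsilon> / \<epsilon> * real (Suc n) powr (- \<sigma>)"
      using mangoldt_le[of "Suc n"] ln_powr_bound[of "real (Suc n)" \<epsilon>] e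
      by (intro mult_right_mono) auto
    also have "\<dots> = 1 / \<epsilon> * real (Suc n) powr (\<epsilon> - \<sigma>)"
      by (simp add: powr_diff powr_minus divide_simps)
    also have "\<epsilon> - \<sigma> = - ((\<sigma> + 1) / 2)" by (simp add: \<epsilon>_def field_simps)
    finally show ?thesis .
  qed
qed

definition vonMangoldt_series :: "(nat \<Rightarrow> complex) \<Rightarrow> complex \<Rightarrow> complex" where
  "vonMangoldt_series \<chi> s = (\<Sum>n. mangoldt (Suc n) * \<chi> (Suc n) * of_nat (Suc n) powr (- s))"

context
  fixes q :: nat and \<chi> :: "nat \<Rightarrow> complex"
  assumes \<chi>: "dirichlet_char q \<chi>" and q: "q > 0"
begin

lemma norm_vonMangoldt_term_le:
  "norm (mangoldt (Suc n) * \<chi> (Suc n) * of_nat (Suc n) powr (- s)) \<le> mangoldt (Suc n) * real (Suc n) powr (- Re s)"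
proof -
  have "norm (mangoldt (Suc n) * \<chi> (Suc n) * of_nat (Suc n) powr (- s)) \<le>
      mangoldt (Suc n) * 1 * real (Suc n) powr (- Re s)"
    unfolding norm_mult norm_of_nat_powr norm_mangoldt
    by (intro mult_mono norm_dirichlet_char_le[OF \<chi> q] mult_nonneg_nonneg mangoldt_nonneg) auto
  then show ?thesis by simp
qed

lemma summable_norm_vonMangoldt:
  "Re s > 1 \<Longrightarrow> summable (\<lambda>n. norm (mangoldt (Suc n) * \<chi> (Suc n) * of_nat (Suc n) powr (- s)))"
  by (rule summable_comparison_test'[OF summable_mangoldt_powr[of "Re s"], of 0])
    (use norm_vonMangoldt_term_le in auto)

lemma vonMangoldt_series_sums:
  "Re s > 1 \<Longrightarrow> (\<lambda>n. mangoldt (Suc n) * \<chi> (Suc n) * of_nat (Suc n) powr (- s)) sums vonMangoldt_series \<chi> s"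
  unfolding vonMangoldt_series_def
  using summable_norm_cancel[OF summable_norm_vonMangoldt] by (rule summable_sums)

lemma norm_vonMangoldt_series_le:
  assumes "\<sigma> > 1" "Re s \<ge> \<sigma>"
  shows "norm (vonMangoldt_series \<chi> s) \<le> (\<Sum>n. mangoldt (Suc n) * real (Suc n) powr (- \<sigma>))"
  unfolding vonMangoldt_series_def
proof (rule norm_suminf_le[OF _ summable_mangoldt_powr[OF assms(1)]])
  fix n
  have "norm (mangoldt (Suc n) * \<chi> (Suc n) * of_nat (Suc n) powr (- s)) \<le> mangoldt (Suc n) * real (Suc n) powr (- Re s)"
    by (rule norm_vonMangoldt_term_le)
  also have "\<dots> \<le> mangoldt (Suc n) * real (Suc n) powr (- \<sigma>)"
    using assms by (intro mult_left_mono powr_mono mangoldt_nonneg) auto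
  finally show "norm (mangoldt (Suc n) * \<chi> (Suc n) * of_nat (Suc n) powr (- s)) \<le>
      mangoldt (Suc n) * real (Suc n) powr (- \<sigma>)" .
qed

text \<open>The identity that the sum of \<open>mangoldt d\<close> over the divisors of n is ln n
  survives multiplication by the completely multiplicative factor
  \<open>\<chi> n * n powr (- s)\<close>. The relation is kept as a product because non-vanishing of
  \<open>Lseries\<close> is going to be deduced from it.\<close>

lemma Lseries_vonMangoldt:
  assumes s: "Re s > 1"
  shows "Lseries \<chi> s * vonMangoldt_series \<chi> s = - deriv (Lseries \<chi>) s"
proof -
  note bd = norm_dirichlet_char_le[OF \<chi> q]
  let ?a = "\<lambda>n. mangoldt n * \<chi> n * of_nat n powr (- s)"
  let ?b = "\<lambda>n. \<chi> n * of_nat n powr (- s)"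
  define B where "B = (\<Sum>n. norm (?b (Suc n)))"
  have b: "(\<lambda>n. norm (?b (Suc n))) sums B"
    unfolding B_def by (rule summable_sums[OF summable_Lseries[OF bd s]])
  have conv: "(\<lambda>n. \<Sum>d | d dvd Suc n. ?a d * ?b (Suc n div d)) sums (\<Sum>d. ?a (Suc d) * Lseries \<chi> s)"
  proof (rule sums_divisors_regroup[where h = "\<lambda>d. norm (?a d) * B"])
    show "(\<lambda>e. ?a d * ?b (Suc e)) sums (?a d * Lseries \<chi> s)" for d
      by (intro sums_mult Lseries_sums bd s)
    show "(\<lambda>e. norm (?a d * ?b (Suc e))) sums (norm (?a d) * B)" for d
      unfolding norm_mult[of "?a d"] by (intro sums_mult b)
    show "summable (\<lambda>d. norm (?a (Suc d)) * B)"
      by (intro summable_mult2 summable_norm_vonMangoldt s)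
  qed
  have tm: "(\<Sum>d | d dvd Suc n. ?a d * ?b (Suc n div d)) =
      of_real (ln (Suc n)) * \<chi> (Suc n) * of_nat (Suc n) powr (- s)" for n
  proof -
    have "?a d * ?b (Suc n div d) = mangoldt d * (\<chi> (Suc n) * of_nat (Suc n) powr (- s))"
      if "d dvd Suc n" for d
    proof -
      define e where "e = Suc n div d"
      have e: "Suc n = d * e" using that by (simp add: e_def)
      have "\<chi> (Suc n) = \<chi> d * \<chi> e" unfolding e by (rule dirichlet_char_mult[OF \<chi>])
      moreover have "of_nat (Suc n) powr (- s) = of_nat d powr (- s) * of_nat e powr (- s)"
        unfolding e of_nat_mult by (intro powr_times_real) auto
      ultimately show ?thesis unfolding e_def[symmetric] by (simp only: mult_ac)
    qed
    then have "(\<Sum>d | d dvd Suc n. ?a d * ?b (Suc n div d)) =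
        (\<Sum>d | d dvd Suc n. mangoldt d * (\<chi> (Suc n) * of_nat (Suc n) powr (- s)))"
      by (intro sum.cong refl) blast
    also have "\<dots> = (\<Sum>d | d dvd Suc n. mangoldt d) * (\<chi> (Suc n) * of_nat (Suc n) powr (- s))"
      by (rule sum_distrib_right[symmetric])
    also have "(\<Sum>d | d dvd Suc n. mangoldt d) = complex_of_real (ln (real (Suc n)))"
      by (rule mangoldt_sum) simp
    finally show ?thesis by (simp only: mult.assoc)
  qed
  have "(\<Sum>d. ?a (Suc d) * Lseries \<chi> s) = vonMangoldt_series \<chi> s * Lseries \<chi> s"
    using sums_mult2[OF vonMangoldt_series_sums[OF s], of "Lseries \<chi> s"]
    by (rule sums_unique[symmetric])
  moreover have c: "(\<lambda>n. of_real (ln (Suc n)) * \<chi> (Suc n) * of_nat (Suc n) powr (- s)) sums - deriv (Lseries \<chi>) s"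
    using sums_minus[OF deriv_Lseries_sums[OF bd s]] by (simp add: mult.assoc)
  ultimately show ?thesis
    using sums_unique2[OF conv[unfolded tm] c] by (simp only: mult.commute)
qed

end

section \<open>Orders of zeros read off from the logarithmic derivative\<close>

text \<open>The residue of \<open>f' / f\<close> at \<open>z0\<close> is the order of vanishing;
  phrased as a limit it can be compared with real estimates along a ray. The point \<open>w\<close>
  ensures that the order is finite.\<close>

lemma logderiv_tendsto_order:
  fixes f :: "complex \<Rightarrow> complex"
  assumes hol: "f holomorphic_on S" and S: "open S" "connected S" and z0: "z0 \<in> S"
    and nz: "w \<in> S" "f w \<noteq> 0"
  shows "\<exists>m::nat. (f z0 = 0 \<longleftrightarrow> m > 0) \<and> ((\<lambda>z. (z - z0) * (deriv f z / f z)) \<longlongrightarrow> of_nat m) (at z0)"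
proof -
  have reg: "((\<lambda>z. (z - z0) * (deriv g z / g z)) \<longlongrightarrow> 0) (at z0)"
    if g: "g holomorphic_on T" "open T" "z0 \<in> T" "g z0 \<noteq> 0" for g T
  proof -
    have "isCont g z0" "isCont (deriv g) z0"
      using g holomorphic_deriv[OF g(1,2)] holomorphic_on_imp_continuous_on continuous_on_eq_continuous_at by blast+
    then have "((\<lambda>z. (z - z0) * (deriv g z / g z)) \<longlongrightarrow> (z0 - z0) * (deriv g z0 / g z0)) (at z0)"
      using g(4) by (intro tendsto_intros) (auto simp: isCont_def)
    then show ?thesis by simp
  qed
  show ?thesis
  proof (cases "f z0 = 0")
    case False
    then show ?thesis using reg[OF hol S(1) z0] by (intro exI[of _ 0]) simp
  next
    case True
    then have "\<not> f constant_on S" using z0 nz unfolding constant_on_def by metis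
    from holomorphic_factor_zero_nonconstant[OF hol S z0 True this]
    obtain g r n where g: "0 < n" "0 < r" "ball z0 r \<subseteq> S" "g holomorphic_on ball z0 r"
      "\<And>w. w \<in> ball z0 r \<Longrightarrow> f w = (w - z0) ^ n * g w" "\<And>w. w \<in> ball z0 r \<Longrightarrow> g w \<noteq> 0"
      by metis
    have eq: "of_nat n + (z - z0) * (deriv g z / g z) = (z - z0) * (deriv f z / f z)"
      if z: "z \<in> ball z0 r" "z \<noteq> z0" for z
    proof -
      have dg: "(g has_field_derivative deriv g z) (at z)"
        by (rule holomorphic_derivI[OF g(4) open_ball z(1)])
      have "((\<lambda>w. (w - z0) ^ n * g w) has_field_derivative
          (of_nat n * (z - z0) ^ (n - 1) * g z + (z - z0) ^ n * deriv g z)) (at z)"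
        by (auto intro!: derivative_eq_intros dg)
      then have "(f has_field_derivative
          (of_nat n * (z - z0) ^ (n - 1) * g z + (z - z0) ^ n * deriv g z)) (at z)"
        by (rule has_field_derivative_transform_within_open[OF _ open_ball z(1)]) (simp add: g(5))
      then have "deriv f z = of_nat n * (z - z0) ^ (n - 1) * g z + (z - z0) ^ n * deriv g z"
        by (rule DERIV_imp_deriv)
      moreover have "(z - z0) ^ n = (z - z0) * (z - z0) ^ (n - 1)"
        using g(1) by (cases n) auto
      moreover define P where "P = (z - z0) ^ (n - 1)"
      moreover define k where "k = z - z0"
      ultimately have f: "f z = k * P * g z" "deriv f z = of_nat n * P * g z + k * P * deriv g z"
        by (simp_all only: g(5)[OF z(1)])
      have "k \<noteq> 0" "P \<noteq> 0" using z(2) by (auto simp: k_def P_def)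
      then show ?thesis
        unfolding f k_def[symmetric] using g(6)[OF z(1)] by (simp add: field_simps)
    qed
    have "((\<lambda>z. of_nat n + (z - z0) * (deriv g z / g z)) \<longlongrightarrow> of_nat n + 0) (at z0)"
      by (intro tendsto_add tendsto_const reg[OF g(4)]) (use g in auto)
    then have "((\<lambda>z. of_nat n + (z - z0) * (deriv g z / g z)) \<longlongrightarrow> of_nat n) (at z0)" by simp
    then have "((\<lambda>z. (z - z0) * (deriv f z / f z)) \<longlongrightarrow> of_nat n) (at z0)"
      by (rule Lim_transform_within_open[OF _ open_ball[of z0 r]]) (use g(2) eq in auto)
    then show ?thesis using True g(1) by blast
  qed
qed

lemma connected_Re_gt: "connected {s. Re s > c}"
  by (intro convex_connected convex_halfspace_Re_gt)

text \<open>No Euler product: the logarithmic derivative is minus the von Mangoldt series, which is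
  bounded near \<open>s\<close>, so \<open>(z - s)\<close> times it tends to 0 and the order of
  vanishing at \<open>s\<close> is 0.\<close>

lemma Lseries_nonzero:
  assumes \<chi>: "dirichlet_char q \<chi>" and q: "q > 0" and s: "Re s > 1"
  shows "Lseries \<chi> s \<noteq> 0"
proof -
  note bd = norm_dirichlet_char_le[OF \<chi> q]
  obtain m :: nat where m: "Lseries \<chi> s = 0 \<longleftrightarrow> m > 0"
    "((\<lambda>z. (z - s) * (deriv (Lseries \<chi>) z / Lseries \<chi> z)) \<longlongrightarrow> of_nat m) (at s)"
  proof -
    have "s \<in> {s. Re s > 1}" "3 \<in> {s. Re s > 1}" using s by auto
    note logderiv_tendsto_order[OF holomorphic_Lseries[OF bd] open_Re_gt connected_Re_gt this
        Lseries_nonzero_at_3[OF \<chi> q]]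
    then show ?thesis by (elim exE conjE) (rule that)
  qed
  define \<sigma> where "\<sigma> = (Re s + 1) / 2"
  have \<sigma>: "\<sigma> > 1" "Re s > \<sigma>" using s by (auto simp: \<sigma>_def)
  define B where "B = (\<Sum>n. mangoldt (Suc n) * real (Suc n) powr (- \<sigma>))"
  have B: "B \<ge> 0" unfolding B_def
    by (rule suminf_nonneg[OF summable_mangoldt_powr[OF \<sigma>(1)]]) (simp add: mangoldt_nonneg)
  have bound: "norm ((z - s) * (deriv (Lseries \<chi>) z / Lseries \<chi> z)) \<le> norm (z - s) * B"
    if z: "Re z > \<sigma>" for z
  proof -
    have z1: "Re z > 1" using z \<sigma> by simp
    have "norm (deriv (Lseries \<chi>) z / Lseries \<chi> z) \<le> B"
    \<comment> \<open>At a zero of \<open>Lseries\<close> division by zero yields 0, so the bound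
      holds there too and no punctured neighbourhood free of zeros has to be found.\<close>
    proof (cases "Lseries \<chi> z = 0")
      case False
      then have "deriv (Lseries \<chi>) z / Lseries \<chi> z = - vonMangoldt_series \<chi> z"
        using Lseries_vonMangoldt[OF \<chi> q z1] by (simp add: field_simps minus_equation_iff)
      then show ?thesis
        using norm_vonMangoldt_series_le[OF \<chi> q \<sigma>(1), of z] z by (simp add: B_def)
    qed (use B in auto)
    then show ?thesis unfolding norm_mult[of "z - s"] by (intro mult_left_mono) auto
  qed
  have "((\<lambda>z. (z - s) * (deriv (Lseries \<chi>) z / Lseries \<chi> z)) \<longlongrightarrow> 0) (at s)"
  proof (rule Lim_null_comparison)
    have "eventually (\<lambda>z. z \<in> {z. Re z > \<sigma>}) (at s)"
      by (rule eventually_at_in_open'[OF open_Re_gt]) (use \<sigma> in auto)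
    then show "eventually (\<lambda>z. norm ((z - s) * (deriv (Lseries \<chi>) z / Lseries \<chi> z)) \<le> norm (z - s) * B) (at s)"
      by eventually_elim (use bound in auto)
    have "((\<lambda>z. norm (z - s) * B) \<longlongrightarrow> norm (s - s) * B) (at s)"
      by (intro tendsto_intros)
    then show "((\<lambda>z. norm (z - s) * B) \<longlongrightarrow> 0) (at s)" by simp
  qed
  from tendsto_unique[OF at_neq_bot m(2) this] have "of_nat m = (0::complex)" .
  then show ?thesis using m(1) by simp
qed

text \<open>
  The \<open>L\<close>-function made holomorphic on the right half-plane: the pole at \<open>1\<close> of a principal
  character is cancelled, any other character has a removable singularity there.
\<close>

definition Lhol :: "nat \<Rightarrow> (nat \<Rightarrow> complex) \<Rightarrow> complex \<Rightarrow> complex" where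
  "Lhol q \<chi> s = (if \<chi> = principal_char q then Lreg q \<chi> s
     else if s = 1 then deriv (Lreg q \<chi>) 1 else Lreg q \<chi> s / (s - 1))"

context
  fixes q :: nat and \<chi> :: "nat \<Rightarrow> complex"
  assumes \<chi>: "dirichlet_char q \<chi>" and q: "q > 0"
begin

lemma holomorphic_Lhol: "Lhol q \<chi> holomorphic_on {s. Re s > 0}"
proof (cases "\<chi> = principal_char q")
  case True
  then have "Lhol q \<chi> = Lreg q \<chi>" by (auto simp: Lhol_def fun_eq_iff)
  then show ?thesis using holomorphic_Lreg[OF norm_dirichlet_char_le[OF \<chi> q] q] by simp
next
  case False
  then have "Lhol q \<chi> = (\<lambda>s. if s = 1 then deriv (Lreg q \<chi>) 1 else (Lreg q \<chi> s - Lreg q \<chi> 1) / (s - 1))"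
    using Lreg_1[OF \<chi> q] by (auto simp: Lhol_def fun_eq_iff)
  then show ?thesis
    using pole_lemma_open[OF holomorphic_Lreg[OF norm_dirichlet_char_le[OF \<chi> q] q] open_Re_gt]
    by simp
qed

lemma Lhol_eq:
  assumes "Re s > 1"
  shows "Lhol q \<chi> s = (if \<chi> = principal_char q then s - 1 else 1) * Lseries \<chi> s"
  using assms Lreg_eq[OF \<chi> q assms] by (auto simp: Lhol_def)

lemma Lhol_nonzero: "Re s > 1 \<Longrightarrow> Lhol q \<chi> s \<noteq> 0"
  using Lseries_nonzero[OF \<chi> q] by (auto simp: Lhol_eq)

lemma vonMangoldt_series_eq:
  assumes s: "Re s > 1"
  shows "vonMangoldt_series \<chi> s =
    (if \<chi> = principal_char q then 1 / (s - 1) else 0) - deriv (Lhol q \<chi>) s / Lhol q \<chi> s"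
proof -
  let ?L = "Lseries \<chi>" and ?c = "\<lambda>s. if \<chi> = principal_char q then s - 1 else (1::complex)"
  have s1: "s \<noteq> 1" using s by auto
  have dL: "(?L has_field_derivative deriv ?L s) (at s)"
    using holomorphic_derivI[OF holomorphic_Lseries[OF norm_dirichlet_char_le[OF \<chi> q]] open_Re_gt] s by simp
  have dc: "(?c has_field_derivative (if \<chi> = principal_char q then 1 else 0)) (at s)"
    by (cases "\<chi> = principal_char q") (auto intro!: derivative_eq_intros)
  have "((\<lambda>s. ?c s * ?L s) has_field_derivative
      (if \<chi> = principal_char q then 1 else 0) * ?L s + ?c s * deriv ?L s) (at s)"
    by (rule DERIV_cong[OF DERIV_mult[OF dc dL]]) (simp only: mult.commute)
  then have "(Lhol q \<chi> has_field_derivative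
      (if \<chi> = principal_char q then 1 else 0) * ?L s + ?c s * deriv ?L s) (at s)"
  proof (rule has_field_derivative_transform_within_open[OF _ open_Re_gt[of 1]])
    show "?c z * ?L z = Lhol q \<chi> z" if "z \<in> {z. Re z > 1}" for z
      using Lhol_eq[of z] that by simp
  qed (use s in simp)
  then have d: "deriv (Lhol q \<chi>) s = (if \<chi> = principal_char q then 1 else 0) * ?L s + ?c s * deriv ?L s"
    by (rule DERIV_imp_deriv)
  have "deriv ?L s = - (?L s * vonMangoldt_series \<chi> s)"
    using Lseries_vonMangoldt[OF \<chi> q s] by simp
  then show ?thesis
    unfolding d Lhol_eq[OF s] using Lseries_nonzero[OF \<chi> q s] s1 by (auto simp: field_simps)
qed

text \<open>The limit is the order of the pole of the L-function at 1 + iu minus the order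
  \<open>m\<close> of its zero. It is taken from the right because the trigonometric inequality is
  available only in the half-plane of convergence.\<close>

lemma vonMangoldt_series_limit:
  "\<exists>m::nat. (Lhol q \<chi> (1 + \<i> * of_real u) = 0 \<longleftrightarrow> m > 0) \<and>
    ((\<lambda>\<epsilon>. \<epsilon> * Re (vonMangoldt_series \<chi> (1 + of_real \<epsilon> + \<i> * of_real u))) \<longlongrightarrow>
      (if \<chi> = principal_char q \<and> u = 0 then 1 else 0) - real m) (at_right 0)"
proof -
  let ?z0 = "1 + \<i> * of_real u"
  obtain m :: nat where m: "Lhol q \<chi> ?z0 = 0 \<longleftrightarrow> m > 0"
    "((\<lambda>z. (z - ?z0) * (deriv (Lhol q \<chi>) z / Lhol q \<chi> z)) \<longlongrightarrow> of_nat m) (at ?z0)"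
  proof -
    have "?z0 \<in> {s. Re s > 0}" "3 \<in> {s. Re s > 0}" "Lhol q \<chi> 3 \<noteq> 0" using Lhol_nonzero[of 3] by auto
    note logderiv_tendsto_order[OF holomorphic_Lhol open_Re_gt connected_Re_gt this]
    then show ?thesis by (elim exE conjE) (rule that)
  qed
  have "filterlim (\<lambda>\<epsilon>. ?z0 + of_real \<epsilon>) (at ?z0) (at_right 0)"
    unfolding filterlim_at
  proof
    have "((\<lambda>\<epsilon>. ?z0 + of_real \<epsilon>) \<longlongrightarrow> ?z0 + of_real 0) (at_right 0)" by (intro tendsto_intros)
    then show "((\<lambda>\<epsilon>. ?z0 + of_real \<epsilon>) \<longlongrightarrow> ?z0) (at_right 0)" by simp
    show "\<forall>\<^sub>F \<epsilon> in at_right 0. ?z0 + of_real \<epsilon> \<in> UNIV \<and> ?z0 + of_real \<epsilon> \<noteq> ?z0"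
      using eventually_at_right_less[of 0] by eventually_elim auto
  qed
  from filterlim_compose[OF m(2) this]
  have lim1: "((\<lambda>\<epsilon>. of_real \<epsilon> * (deriv (Lhol q \<chi>) (?z0 + of_real \<epsilon>) / Lhol q \<chi> (?z0 + of_real \<epsilon>))) \<longlongrightarrow> of_nat m) (at_right 0)"
    by simp
  have lim2: "((\<lambda>\<epsilon>. of_real \<epsilon> * (if \<chi> = principal_char q then 1 / (?z0 + of_real \<epsilon> - 1) else 0)) \<longlongrightarrow>
      (if \<chi> = principal_char q \<and> u = 0 then 1 else 0 :: complex)) (at_right 0)"
  proof (cases "\<chi> = principal_char q \<and> u = 0")
    case True
    have "eventually (\<lambda>\<epsilon>. of_real \<epsilon> * (if \<chi> = principal_char q then 1 / (?z0 + of_real \<epsilon> - 1) else 0) = 1) (at_right 0)"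
      using eventually_at_right_less[of 0] by eventually_elim (use True in auto)
    then show ?thesis using True by (simp add: tendsto_eventually)
  next
    case False
    show ?thesis
    proof (cases "\<chi> = principal_char q")
      case True
      then have u: "u \<noteq> 0" using False by simp
      have "((\<lambda>\<epsilon>. of_real \<epsilon> * (1 / (\<i> * of_real u + of_real \<epsilon>))) \<longlongrightarrow> of_real 0 * (1 / (\<i> * of_real u + of_real 0))) (at_right 0)"
        using u by (intro tendsto_intros) auto
      then show ?thesis using True u by (simp add: algebra_simps)
    qed auto
  qed
  have "((\<lambda>\<epsilon>. of_real \<epsilon> * vonMangoldt_series \<chi> (1 + of_real \<epsilon> + \<i> * of_real u)) \<longlongrightarrow>
      (if \<chi> = principal_char q \<and> u = 0 then 1 else 0) - of_nat m) (at_right 0)"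
  proof (rule Lim_transform_eventually[OF tendsto_diff[OF lim2 lim1]])
    show "\<forall>\<^sub>F \<epsilon> in at_right 0. of_real \<epsilon> * (if \<chi> = principal_char q then 1 / (?z0 + of_real \<epsilon> - 1) else 0) -
        of_real \<epsilon> * (deriv (Lhol q \<chi>) (?z0 + of_real \<epsilon>) / Lhol q \<chi> (?z0 + of_real \<epsilon>)) =
        of_real \<epsilon> * vonMangoldt_series \<chi> (1 + of_real \<epsilon> + \<i> * of_real u)"
      using eventually_at_right_less[of 0]
    proof eventually_elim
      case (elim \<epsilon>)
      have "1 + of_real \<epsilon> + \<i> * of_real u = ?z0 + of_real \<epsilon>" by simp
      moreover have "Re (?z0 + of_real \<epsilon>) > 1" using elim by simp
      note vonMangoldt_series_eq[OF this]
      ultimately show ?case by (simp only: right_diff_distrib)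
    qed
  qed
  then have "((\<lambda>\<epsilon>. Re (of_real \<epsilon> * vonMangoldt_series \<chi> (1 + of_real \<epsilon> + \<i> * of_real u))) \<longlongrightarrow>
      Re ((if \<chi> = principal_char q \<and> u = 0 then 1 else 0) - of_nat m)) (at_right 0)"
    by (rule tendsto_Re)
  moreover have "Re ((if \<chi> = principal_char q \<and> u = 0 then 1 else 0) - of_nat m) =
      (if \<chi> = principal_char q \<and> u = 0 then 1 else 0) - real m" by simp
  ultimately show ?thesis using m(1) by (intro exI[of _ m]) simp
qed

text \<open>Holds term by term. With w = \<chi>(n) n^(-iu) of modulus 1,
  \<open>3 + 4 * Re w + Re (w\<^sup>2)\<close> is \<open>2 * (1 + Re w)\<^sup>2\<close>; when n is
  not coprime to \<open>q\<close> all three terms are zero.\<close>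

lemma mangoldt_3_4_1:
  assumes \<sigma>: "\<sigma> > 1"
  shows "3 * Re (vonMangoldt_series (principal_char q) (of_real \<sigma>)) +
     4 * Re (vonMangoldt_series \<chi> (of_real \<sigma> + \<i> * of_real u)) +
     Re (vonMangoldt_series (\<lambda>n. \<chi> n * \<chi> n) (of_real \<sigma> + \<i> * of_real (2 * u))) \<ge> 0"
proof -
  let ?z1 = "of_real \<sigma> + \<i> * of_real u" and ?z2 = "of_real \<sigma> + \<i> * of_real (2 * u)"
  let ?t0 = "\<lambda>n. mangoldt (Suc n) * principal_char q (Suc n) * of_nat (Suc n) powr (- of_real \<sigma>) :: complex"
  let ?t1 = "\<lambda>n. mangoldt (Suc n) * \<chi> (Suc n) * of_nat (Suc n) powr (- ?z1)"
  let ?t2 = "\<lambda>n. mangoldt (Suc n) * (\<chi> (Suc n) * \<chi> (Suc n)) * of_nat (Suc n) powr (- ?z2)"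
  have s0: "?t0 sums vonMangoldt_series (principal_char q) (of_real \<sigma>)"
    by (rule vonMangoldt_series_sums[OF dirichlet_char_principal q]) (use \<sigma> in simp)
  have s1: "?t1 sums vonMangoldt_series \<chi> ?z1"
    by (rule vonMangoldt_series_sums[OF \<chi> q]) (use \<sigma> in simp)
  have s2: "?t2 sums vonMangoldt_series (\<lambda>n. \<chi> n * \<chi> n) ?z2"
    by (rule vonMangoldt_series_sums[OF dirichlet_char_times[OF \<chi> \<chi>] q]) (use \<sigma> in simp)
  have "(\<lambda>n. 3 * Re (?t0 n) + 4 * Re (?t1 n) + Re (?t2 n)) sums
     (3 * Re (vonMangoldt_series (principal_char q) (of_real \<sigma>)) + 4 * Re (vonMangoldt_series \<chi> ?z1) +
      Re (vonMangoldt_series (\<lambda>n. \<chi> n * \<chi> n) ?z2))"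
    by (intro sums_add sums_mult sums_Re s0 s1 s2)
  moreover have "3 * Re (?t0 n) + 4 * Re (?t1 n) + Re (?t2 n) \<ge> 0" for n
  proof -
    define x where "x = complex_of_real (real (Suc n) powr (- \<sigma>))"
    define w where "w = \<chi> (Suc n) * of_nat (Suc n) powr (- (\<i> * of_real u))"
    define L where "L = complex_of_real (mangoldt (Suc n))"
    have x: "of_nat (Suc n) powr (- of_real \<sigma>) = x"
      unfolding x_def using powr_of_real[of "real (Suc n)" "- \<sigma>"] by simp
    have t1: "?t1 n = L * (x * w)"
      unfolding w_def x[symmetric] L_def by (simp add: powr_diff powr_minus divide_simps del: of_nat_Suc)
    have "of_nat (Suc n) powr (- ?z2) = x * (of_nat (Suc n) powr (- (\<i> * of_real u)))\<^sup>2"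
      unfolding x[symmetric] by (simp add: power2_eq_square flip: powr_add) (simp add: algebra_simps)
    then have t2: "?t2 n = L * (x * w\<^sup>2)"
      unfolding w_def L_def by (simp add: power2_eq_square mult_ac)
    have t0: "?t0 n = L * (x * principal_char q (Suc n))"
      unfolding x L_def by simp
    have re: "3 * Re (?t0 n) + 4 * Re (?t1 n) + Re (?t2 n) =
       mangoldt (Suc n) * (real (Suc n) powr (- \<sigma>) * (3 * Re (principal_char q (Suc n)) + 4 * Re w + Re (w\<^sup>2)))"
      unfolding t0 t1 t2 L_def x_def by (simp add: algebra_simps del: of_real_mangoldt)
    have "3 * Re (principal_char q (Suc n)) + 4 * Re w + Re (w\<^sup>2) \<ge> 0"
    proof (cases "coprime (Suc n) q")
      case True
      have "norm w = 1"
        unfolding w_def using norm_dirichlet_char[OF \<chi> q, of "Suc n"] True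
        by (simp add: norm_mult norm_of_nat_powr del: of_nat_Suc)
      then have "(Re w)\<^sup>2 + (Im w)\<^sup>2 = 1" using cmod_power2[of w] by simp
      then have "3 * Re (principal_char q (Suc n)) + 4 * Re w + Re (w\<^sup>2) = 2 * (1 + Re w)\<^sup>2"
        using True by (simp add: principal_char_def power2_eq_square algebra_simps)
      then show ?thesis by simp
    next
      case False
      then show ?thesis
        using dirichlet_char_eq_0_iff[OF \<chi>, of "Suc n"] by (simp add: w_def principal_char_def)
    qed
    then show ?thesis unfolding re
      by (intro mult_nonneg_nonneg mangoldt_nonneg) auto
  qed
  ultimately show ?thesis by (rule sums_le[OF _ sums_zero, rotated])
qed

end

lemma Lhol_principal_nonzero:
  assumes "q > 0"
  shows "Lhol q (principal_char q) 1 \<noteq> 0"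
  using Lreg_1[OF dirichlet_char_principal assms] assms by (simp add: Lhol_def)

text \<open>The hypothesis \<open>nr\<close> says that neither \<chi> at 1 + iu nor \<chi>^2 at 1 +
  2iu brings a pole. Multiplying the trigonometric inequality by \<open>\<epsilon>\<close> and
  letting it tend to 0 gives 3 - 4 m1 - m2 >= 0 for the orders of the zeros, hence m1 = 0.\<close>

lemma Lhol_nonzero_line:
  assumes \<chi>: "dirichlet_char q \<chi>" and q: "q > 0"
    and nr: "u \<noteq> 0 \<or> (\<lambda>n. \<chi> n * \<chi> n) \<noteq> principal_char q"
  shows "Lhol q \<chi> (1 + \<i> * of_real u) \<noteq> 0"
proof -
  let ?\<chi>2 = "\<lambda>n. \<chi> n * \<chi> n"
  obtain m0 :: nat where m0: "Lhol q (principal_char q) (1 + \<i> * of_real 0) = 0 \<longleftrightarrow> m0 > 0"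
    "((\<lambda>\<epsilon>. \<epsilon> * Re (vonMangoldt_series (principal_char q) (1 + of_real \<epsilon> + \<i> * of_real 0))) \<longlongrightarrow> 1 - real m0) (at_right 0)"
    using vonMangoldt_series_limit[OF dirichlet_char_principal q, of 0]
    unfolding simp_thms if_True by (elim exE conjE) (rule that)
  have "m0 = 0" using m0(1) Lhol_principal_nonzero[OF q] by simp
  obtain m1 :: nat where m1: "Lhol q \<chi> (1 + \<i> * of_real u) = 0 \<longleftrightarrow> m1 > 0"
    "((\<lambda>\<epsilon>. \<epsilon> * Re (vonMangoldt_series \<chi> (1 + of_real \<epsilon> + \<i> * of_real u))) \<longlongrightarrow>
      (if \<chi> = principal_char q \<and> u = 0 then 1 else 0) - real m1) (at_right 0)"
    using vonMangoldt_series_limit[OF \<chi> q, of u] by (elim exE conjE) (rule that)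
  obtain m2 :: nat where m2:
    "((\<lambda>\<epsilon>. \<epsilon> * Re (vonMangoldt_series ?\<chi>2 (1 + of_real \<epsilon> + \<i> * of_real (2 * u)))) \<longlongrightarrow>
      (if ?\<chi>2 = principal_char q \<and> 2 * u = 0 then 1 else 0) - real m2) (at_right 0)"
    using vonMangoldt_series_limit[OF dirichlet_char_times[OF \<chi> \<chi>] q, of "2 * u"]
    by (elim exE conjE) (rule that)
  have "(\<lambda>n. principal_char q n * principal_char q n) = principal_char q"
    by (auto simp: principal_char_def)
  then have np: "\<not> (\<chi> = principal_char q \<and> u = 0)" using nr by metis
  have np2: "\<not> (?\<chi>2 = principal_char q \<and> 2 * u = 0)"
    using nr by (metis mult_eq_0_iff zero_neq_numeral)
  let ?f = "\<lambda>\<epsilon>. 3 * (\<epsilon> * Re (vonMangoldt_series (principal_char q) (1 + of_real \<epsilon> + \<i> * of_real 0))) +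
     4 * (\<epsilon> * Re (vonMangoldt_series \<chi> (1 + of_real \<epsilon> + \<i> * of_real u))) +
     \<epsilon> * Re (vonMangoldt_series ?\<chi>2 (1 + of_real \<epsilon> + \<i> * of_real (2 * u)))"
  have "(?f \<longlongrightarrow> 3 * (1 - real m0) + 4 * (0 - real m1) + (0 - real m2)) (at_right 0)"
    using m1(2) m2 unfolding if_not_P[OF np] if_not_P[OF np2]
    by (intro tendsto_add tendsto_mult tendsto_const m0(2))
  moreover have "eventually (\<lambda>\<epsilon>. ?f \<epsilon> \<ge> 0) (at_right 0)"
    using eventually_at_right_less[of 0]
  proof eventually_elim
    case (elim \<epsilon>)
    have "0 \<le> \<epsilon> * (3 * Re (vonMangoldt_series (principal_char q) (of_real (1 + \<epsilon>))) +
       4 * Re (vonMangoldt_series \<chi> (of_real (1 + \<epsilon>) + \<i> * of_real u)) +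
       Re (vonMangoldt_series ?\<chi>2 (of_real (1 + \<epsilon>) + \<i> * of_real (2 * u))))"
      using mangoldt_3_4_1[OF \<chi> q, of "1 + \<epsilon>" u] elim by (intro mult_nonneg_nonneg) auto
    then show ?case by (simp add: algebra_simps)
  qed
  ultimately have "3 * (1 - real m0) + 4 * (0 - real m1) + (0 - real m2) \<ge> 0"
    by (rule tendsto_lowerbound) simp
  then have "real m1 < 1" using \<open>m0 = 0\<close> of_nat_0_le_iff[of m2, where 'a = real] by simp
  then have "m1 = 0" by simp
  then show ?thesis using m1(1) by simp
qed

section \<open>Non-vanishing at 1 for real characters\<close>

lemma bij_betw_divisors_prime_power:
  fixes p m k :: nat
  assumes p: "prime p" "\<not> p dvd m"
  shows "bij_betw (\<lambda>(i, d). d * p ^ i) ({..k} \<times> {d. d dvd m}) {d. d dvd m * p ^ k}"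
proof (rule bij_betwI')
  fix x y assume x: "x \<in> {..k} \<times> {d. d dvd m}" and y: "y \<in> {..k} \<times> {d. d dvd m}"
  obtain i d where xe: "x = (i, d)" by (cases x)
  obtain j e where ye: "y = (j, e)" by (cases y)
  have nd: "\<not> p dvd d" "\<not> p dvd e" using x y p dvd_trans by (auto simp: xe ye)
  show "((case x of (i, d) \<Rightarrow> d * p ^ i) = (case y of (i, d) \<Rightarrow> d * p ^ i)) = (x = y)"
  proof
    assume "(case x of (i, d) \<Rightarrow> d * p ^ i) = (case y of (i, d) \<Rightarrow> d * p ^ i)"
    then have eq: "d * p ^ i = e * p ^ j" by (simp add: xe ye)
    have "d = e" "i = j" using prime_power_cancel2[OF p(1) eq nd] by auto
    then show "x = y" by (simp add: xe ye)
  qed simp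
next
  fix x assume "x \<in> {..k} \<times> {d. d dvd m}"
  then show "(case x of (i, d) \<Rightarrow> d * p ^ i) \<in> {d. d dvd m * p ^ k}"
    by (auto intro: mult_dvd_mono le_imp_power_dvd)
next
  fix y assume "y \<in> {d. d dvd m * p ^ k}"
  then have y: "y dvd m * p ^ k" by simp
  have "m * p ^ k > 0" using p by (auto intro!: Nat.gr0I simp: prime_gt_0_nat)
  then have "y > 0" using y by (metis dvd_pos_nat)
  then obtain j d where d: "\<not> p dvd d" "y = d * p ^ j"
    using prime_power_canonical[OF p(1)] by blast
  have "d dvd m * p ^ k" using y d(2) by (metis dvd_mult_left)
  moreover have "coprime d (p ^ k)"
    using prime_imp_coprime[OF p(1) d(1)] by (simp add: coprime_commute)
  ultimately have dm: "d dvd m" by (simp add: coprime_dvd_mult_left_iff)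
  have "p ^ j dvd m * p ^ k" using y d(2) by (metis dvd_mult_right)
  moreover have "coprime (p ^ j) m"
    using prime_imp_coprime[OF p] by simp
  ultimately have "p ^ j dvd p ^ k" by (simp add: coprime_dvd_mult_right_iff)
  then have "j \<le> k" using prime_gt_1_nat[OF p(1)] by (simp add: dvd_power_iff_le)
  then show "\<exists>x\<in>{..k} \<times> {d. d dvd m}. y = (case x of (i, d) \<Rightarrow> d * p ^ i)"
    using dm d(2) by (intro bexI[of _ "(j, d)"]) auto
qed

text \<open>The divisor sum of a multiplicative function factors over prime powers, and each factor
  is a geometric sum with ratio -1, 0 or 1, which is never negative.\<close>

lemma sum_divisors_nonneg:
  fixes c :: "nat \<Rightarrow> real"
  assumes mult: "\<And>m n. c (m * n) = c m * c n" and val: "\<And>n. c n \<in> {-1, 0, 1}" and "n > 0"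
  shows "(\<Sum>d | d dvd n. c d) \<ge> 0"
  using \<open>n > 0\<close>
proof (induction n rule: less_induct)
  case (less n)
  have c1: "c 1 \<ge> 0" using mult[of 1 1] by (metis mult_1 zero_le_square)
  show ?case
  proof (cases "n = 1")
    case True
    then show ?thesis using c1 by simp
  next
    case False
    then obtain p where p: "prime p" "p dvd n" by (metis prime_factor_nat)
    obtain k m where km: "\<not> p dvd m" "n = m * p ^ k"
      using prime_power_canonical[OF p(1) less.prems] by blast
    have k: "k > 0" using km p(2) by (cases k) auto
    have m: "m > 0" using km less.prems by (cases m) auto
    have "1 < p ^ k" by (rule one_less_power[OF prime_gt_1_nat[OF p(1)] k])
    then have "m < n" using m km(2) by simp
    \<comment> \<open>The hypotheses admit \<open>c\<close> identically zero, so \<open>c 1\<close>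
      is carried along instead of being replaced by 1.\<close>
    have pow: "c (p ^ i) = c p ^ i * c 1" for i
      by (induction i) (auto simp: mult)
    have "(\<Sum>d | d dvd n. c d) = (\<Sum>(i, d)\<in>{..k} \<times> {d. d dvd m}. c (d * p ^ i))"
      using sum.reindex_bij_betw[OF bij_betw_divisors_prime_power[OF p(1) km(1), of k], of c]
      by (simp add: km(2) case_prod_unfold)
    also have "\<dots> = (\<Sum>i\<le>k. \<Sum>d | d dvd m. c p ^ i * (c 1 * c d))"
      by (subst sum.cartesian_product[symmetric]) (simp add: mult pow mult_ac)
    also have "\<dots> = (\<Sum>i\<le>k. c p ^ i) * (c 1 * (\<Sum>d | d dvd m. c d))"
      by (subst sum_distrib_left, subst sum_product) (rule refl)
    also have "\<dots> \<ge> 0"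
    proof (intro mult_nonneg_nonneg c1)
      have alt: "(\<Sum>i\<le>k. (- 1 :: real) ^ i) \<ge> 0" for k
        by (induction k rule: nat_induct2) auto
      show "(\<Sum>i\<le>k. c p ^ i) \<ge> 0"
      proof -
        have "c p = -1 \<or> c p = 0 \<or> c p = 1" using val[of p] by auto
        then show ?thesis by (elim disjE) (simp_all add: alt sum_nonneg)
      qed
      show "(\<Sum>d | d dvd m. c d) \<ge> 0" using less.IH[OF \<open>m < n\<close> m] .
    qed
    finally show ?thesis .
  qed
qed

section \<open>Estimates for Monsky's Lambert series\<close>

lemma sum_abel_bound:
  fixes x :: "nat \<Rightarrow> complex" and b :: "nat \<Rightarrow> real"
  assumes B: "\<And>k. norm (\<Sum>n<k. x n) \<le> B" and dec: "\<And>n. b (Suc n) \<le> b n" and nonneg: "\<And>n. b n \<ge> 0"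
  shows "norm (\<Sum>n<N. x n * of_real (b n)) \<le> B * b 0"
proof -
  define S where "S = (\<lambda>k. \<Sum>n<k. x n)"
  have "(\<Sum>n<N. x n * of_real (b n)) = S N * of_real (b N) + (\<Sum>n<N. S (Suc n) * of_real (b n - b (Suc n)))"
    by (induction N) (auto simp: S_def algebra_simps)
  also have "norm \<dots> \<le> B * b N + (\<Sum>n<N. B * (b n - b (Suc n)))"
  proof (intro norm_triangle_mono sum_norm_le)
    show "norm (S N * of_real (b N)) \<le> B * b N"
      using B[of N] nonneg[of N] by (simp add: norm_mult S_def mult_right_mono)
    show "norm (S (Suc n) * of_real (b n - b (Suc n))) \<le> B * (b n - b (Suc n))" for n
      using B[of "Suc n"] dec[of n] unfolding norm_mult norm_of_real S_def
      by (simp add: mult_right_mono del: sum.lessThan_Suc)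
  qed
  also have "(\<Sum>n<N. B * (b n - b (Suc n))) = B * (b 0 - b N)"
    by (simp only: sum_distrib_left[symmetric] sum_lessThan_telescope')
  also have "B * b N + B * (b 0 - b N) = B * b 0" by (simp add: algebra_simps)
  finally show ?thesis .
qed

lemma sum_lessThan_add: "(\<Sum>n<a + k. f n) = (\<Sum>n<a. f n) + (\<Sum>n<k. f (a + n))"
  for f :: "nat \<Rightarrow> 'a::comm_monoid_add"
  by (induction k) (auto simp: add.assoc)

text \<open>With t = s^2 this is the inequality of arithmetic and geometric means for 1, t, ...,
  t^n, whose geometric mean is s^n.\<close>

lemma power_sum_lower_bound:
  fixes s :: real
  assumes "0 \<le> s" "s \<le> 1"
  shows "real (Suc n) * s ^ n \<le> (\<Sum>k\<le>n. (s\<^sup>2) ^ k)"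
proof (induction n)
  case (Suc n)
  have "1 - s ^ Suc n = (1 - s) * (\<Sum>i<Suc n. s ^ i)" by (rule one_diff_power_eq)
  also have "\<dots> \<le> (1 - s) * (\<Sum>i<Suc n. 1)"
    using assms by (intro mult_left_mono sum_mono power_le_one) auto
  finally have "1 - s ^ Suc n \<le> real (Suc n) * (1 - s)" by (simp add: mult.commute)
  then have "s ^ Suc n * (1 - s ^ Suc n) \<le> s ^ n * (real (Suc n) * (1 - s))"
    using assms by (intro mult_mono) (auto intro!: power_decreasing power_le_one mult_le_one simp del: power_Suc)
  moreover have "(s\<^sup>2) ^ Suc n = s ^ Suc n * s ^ Suc n"
    by (simp add: power2_eq_square power_mult_distrib)
  ultimately have "real (Suc (Suc n)) * s ^ Suc n \<le> real (Suc n) * s ^ n + (s\<^sup>2) ^ Suc n"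
    by (simp add: algebra_simps)
  also have "\<dots> \<le> (\<Sum>k\<le>Suc n. (s\<^sup>2) ^ k)" using Suc.IH by simp
  finally show ?case .
qed simp

text \<open>Says that 1 / (n (1 - t)) - t^n / (1 - t^n) decreases in n, as summation by parts
  requires. Factoring \<open>1 - t\<close> out of the denominators leaves a claim on the products
  \<open>A * A'\<close> of geometric sums, for which the previous lemma is just strong
  enough.\<close>

lemma lambert_term_diff:
  fixes t :: real
  assumes t: "0 < t" "t < 1"
  shows "t ^ Suc m / (1 - t ^ Suc m) - t ^ Suc (Suc m) / (1 - t ^ Suc (Suc m))
     \<le> (1 / real (Suc m) - 1 / real (Suc (Suc m))) / (1 - t)"
proof -
  define s where "s = sqrt t"
  have s: "0 \<le> s" "s \<le> 1" "s\<^sup>2 = t" using t by (auto simp: s_def)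
  define A A' where "A = (\<Sum>k\<le>m. t ^ k)" and "A' = (\<Sum>k\<le>Suc m. t ^ k)"
  have A: "A \<ge> real (Suc m) * s ^ m" "A' \<ge> real (Suc (Suc m)) * s ^ Suc m"
    unfolding A_def A'_def using power_sum_lower_bound[OF s(1,2), unfolded s(3)] by blast+
  have pos: "A > 0" "A' > 0"
    using t by (auto simp: A_def A'_def intro!: sum_pos simp del: sum.atMost_Suc)
  have e: "1 - t ^ Suc m = (1 - t) * A" "1 - t ^ Suc (Suc m) = (1 - t) * A'"
    unfolding A_def A'_def lessThan_Suc_atMost[symmetric] by (rule one_diff_power_eq)+
  have "t ^ Suc m * (real (Suc m) * real (Suc (Suc m))) =
      (real (Suc m) * s ^ m) * (real (Suc (Suc m)) * s ^ Suc m) * s"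
    unfolding s(3)[symmetric] by (simp add: power2_eq_square power_mult_distrib)
  also have "\<dots> \<le> (real (Suc m) * s ^ m) * (real (Suc (Suc m)) * s ^ Suc m) * 1"
    using s by (intro mult_left_mono) auto
  also have "\<dots> \<le> A * A'"
    using A s pos by (simp del: power_Suc of_nat_Suc) (intro mult_mono; auto)
  finally have key: "t ^ Suc m * (real (Suc m) * real (Suc (Suc m))) \<le> A * A'" .
  have "t ^ Suc m / (1 - t ^ Suc m) - t ^ Suc (Suc m) / (1 - t ^ Suc (Suc m)) =
      (t ^ Suc m * (1 - t ^ Suc (Suc m)) - t ^ Suc (Suc m) * (1 - t ^ Suc m)) /
        ((1 - t ^ Suc m) * (1 - t ^ Suc (Suc m)))"
  proof -
    have "1 - t ^ Suc m \<noteq> 0" "1 - t ^ Suc (Suc m) \<noteq> 0" using e pos t by auto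
    then show ?thesis by (simp add: diff_frac_eq)
  qed
  also have "t ^ Suc m * (1 - t ^ Suc (Suc m)) - t ^ Suc (Suc m) * (1 - t ^ Suc m) = t ^ Suc m * (1 - t)"
    by (simp add: algebra_simps)
  also have "t ^ Suc m * (1 - t) / ((1 - t ^ Suc m) * (1 - t ^ Suc (Suc m))) = t ^ Suc m / (A * A') / (1 - t)"
    unfolding e using t pos by (simp add: divide_simps)
  also have "\<dots> \<le> (1 / real (Suc m) - 1 / real (Suc (Suc m))) / (1 - t)"
  proof (rule divide_right_mono)
    have "t ^ Suc m / (A * A') \<le> 1 / (real (Suc m) * real (Suc (Suc m)))"
      using key pos by (subst frac_le_eq) (auto simp: divide_simps)
    also have "\<dots> = 1 / real (Suc m) - 1 / real (Suc (Suc m))" by (simp add: divide_simps)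
    finally show "t ^ Suc m / (A * A') \<le> 1 / real (Suc m) - 1 / real (Suc (Suc m))" .
  qed (use t in auto)
  finally show ?thesis .
qed

context
  fixes q :: nat and \<chi> :: "nat \<Rightarrow> complex"
  assumes \<chi>: "dirichlet_char q \<chi>" and q: "q > 0" and np: "\<chi> \<noteq> principal_char q"
begin

text \<open>Whole periods sum to 0, so only a remainder of fewer than \<open>q\<close> terms of
  modulus at most 1 counts.\<close>

lemma dirichlet_char_partial_sums: "norm (\<Sum>n<N. \<chi> n) \<le> real q"
proof (induction N rule: less_induct)
  case (less N)
  show ?case
  proof (cases "N < q")
    case True
    have "norm (\<Sum>n<N. \<chi> n) \<le> (\<Sum>n<N. 1)"
      by (rule sum_norm_le) (rule norm_dirichlet_char_le[OF \<chi> q])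
    then show ?thesis using True by simp
  next
    case False
    then obtain M where M: "N = q + M" by (metis add_diff_inverse_nat)
    have "\<chi> (q + n) = \<chi> n" for n
      by (rule dirichlet_char_cong[OF \<chi>]) (simp add: Cong.cong_def)
    then have "(\<Sum>n<N. \<chi> n) = (\<Sum>n<M. \<chi> n)"
      unfolding M sum_lessThan_add using dirichlet_char_sum_lessThan[OF \<chi> q] np by simp
    then show ?thesis using less.IH[of M] M q by simp
  qed
qed

lemma dirichlet_char_partial_sums_shift: "norm (\<Sum>n<k. \<chi> (Suc (M + n))) \<le> 2 * real q"
proof -
  have "(\<Sum>n<k. \<chi> (Suc (M + n))) = (\<Sum>n<Suc M + k. \<chi> n) - (\<Sum>n<Suc M. \<chi> n)"
    unfolding sum_lessThan_add by simp
  also have "norm \<dots> \<le> real q + real q"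
    using norm_triangle_ineq4 dirichlet_char_partial_sums add_mono order_trans by metis
  finally show ?thesis by simp
qed

text \<open>The bound does not involve \<open>\<sigma>\<close>; it therefore survives the passage to
  \<open>\<sigma> = 1\<close>, where absolute convergence is lost.\<close>

lemma Lseries_tail_bound:
  assumes \<sigma>: "\<sigma> > 1"
  shows "norm (Lseries \<chi> (of_real \<sigma>) - (\<Sum>n<M. \<chi> (Suc n) * of_real (real (Suc n) powr (- \<sigma>))))
     \<le> 2 * real q / real (Suc M)"
proof -
  have pw: "of_nat (Suc n) powr (- of_real \<sigma>) = complex_of_real (real (Suc n) powr (- \<sigma>))" for n
    using powr_of_real[of "real (Suc n)" "- \<sigma>"] by simp
  have "(\<lambda>n. \<chi> (Suc n) * of_real (real (Suc n) powr (- \<sigma>))) sums Lseries \<chi> (of_real \<sigma>)"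
    using Lseries_sums[of \<chi> "of_real \<sigma>", OF norm_dirichlet_char_le[OF \<chi> q]] \<sigma> unfolding pw by simp
  then have "(\<lambda>N. \<Sum>n<N. \<chi> (Suc n) * of_real (real (Suc n) powr (- \<sigma>))) \<longlonglongrightarrow> Lseries \<chi> (of_real \<sigma>)"
    by (simp add: sums_def)
  then have "(\<lambda>N. \<Sum>n<M + N. \<chi> (Suc n) * of_real (real (Suc n) powr (- \<sigma>))) \<longlonglongrightarrow> Lseries \<chi> (of_real \<sigma>)"
    using LIMSEQ_ignore_initial_segment[of _ _ M] by (simp add: add.commute)
  then have lim: "(\<lambda>N. norm ((\<Sum>n<M + N. \<chi> (Suc n) * of_real (real (Suc n) powr (- \<sigma>))) -
      (\<Sum>n<M. \<chi> (Suc n) * of_real (real (Suc n) powr (- \<sigma>))))) \<longlonglongrightarrow>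
     norm (Lseries \<chi> (of_real \<sigma>) - (\<Sum>n<M. \<chi> (Suc n) * of_real (real (Suc n) powr (- \<sigma>))))"
    by (intro tendsto_intros)
  have "norm ((\<Sum>n<M + N. \<chi> (Suc n) * of_real (real (Suc n) powr (- \<sigma>))) -
      (\<Sum>n<M. \<chi> (Suc n) * of_real (real (Suc n) powr (- \<sigma>)))) \<le> 2 * real q / real (Suc M)" for N
  proof -
    have "norm (\<Sum>n<N. \<chi> (Suc (M + n)) * of_real (real (Suc (M + n)) powr (- \<sigma>))) \<le>
        2 * real q * real (Suc (M + 0)) powr (- \<sigma>)"
      by (rule sum_abel_bound[OF dirichlet_char_partial_sums_shift])
        (use \<sigma> in \<open>auto intro!: powr_mono2'\<close>)
    also have "\<dots> \<le> 2 * real q * real (Suc (M + 0)) powr (- 1)"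
      using \<sigma> by (intro mult_left_mono powr_mono) auto
    also have "\<dots> = 2 * real q / real (Suc M)" by (simp add: powr_minus_divide)
    finally show ?thesis unfolding sum_lessThan_add by simp
  qed
  then show ?thesis by (intro tendsto_upperbound[OF lim]) auto
qed

lemma Lhol_1_partial_sums:
  "norm (Lhol q \<chi> 1 - (\<Sum>n<M. \<chi> (Suc n) / of_nat (Suc n))) \<le> 2 * real q / real (Suc M)"
proof -
  let ?S = "\<lambda>\<sigma>. \<Sum>n<M. \<chi> (Suc n) * of_real (real (Suc n) powr (- \<sigma>))"
  have "isCont (Lhol q \<chi>) 1"
    by (rule continuous_on_interior[OF holomorphic_on_imp_continuous_on[OF holomorphic_Lhol[OF \<chi> q]]])
      (simp add: interior_open[OF open_Re_gt])
  moreover have "((\<lambda>\<sigma>. complex_of_real \<sigma>) \<longlongrightarrow> of_real 1) (at_right 1)" by (intro tendsto_intros)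
  ultimately have "((\<lambda>\<sigma>. Lhol q \<chi> (of_real \<sigma>)) \<longlongrightarrow> Lhol q \<chi> 1) (at_right 1)"
    by (intro isCont_tendsto_compose[of 1 "Lhol q \<chi>"]) simp_all
  moreover have "(?S \<longlongrightarrow> ?S 1) (at_right 1)"
    by (intro tendsto_intros) auto
  ultimately have lim: "((\<lambda>\<sigma>. norm (Lhol q \<chi> (of_real \<sigma>) - ?S \<sigma>)) \<longlongrightarrow> norm (Lhol q \<chi> 1 - ?S 1)) (at_right 1)"
    by (intro tendsto_norm tendsto_diff)
  have "eventually (\<lambda>\<sigma>. norm (Lhol q \<chi> (of_real \<sigma>) - ?S \<sigma>) \<le> 2 * real q / real (Suc M)) (at_right 1)"
    using eventually_at_right_less[of 1]
  proof eventually_elim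
    case (elim \<sigma>)
    then have "Lhol q \<chi> (of_real \<sigma>) = Lseries \<chi> (of_real \<sigma>)"
      using Lhol_eq[OF \<chi> q, of "of_real \<sigma>"] np by simp
    then show ?case using Lseries_tail_bound[OF elim, of M] by simp
  qed
  then have "norm (Lhol q \<chi> 1 - ?S 1) \<le> 2 * real q / real (Suc M)"
    by (intro tendsto_upperbound[OF lim]) auto
  moreover have "?S 1 = (\<Sum>n<M. \<chi> (Suc n) / of_nat (Suc n))"
    by (intro sum.cong refl) (simp add: powr_minus_divide del: of_nat_Suc)
  ultimately show ?thesis by simp
qed

text \<open>If L(1, \<chi>) = 0, then subtracting L(1, \<chi>) / (1 - t) from the Lambert series
  changes nothing but replaces its coefficients by \<open>- b n\<close>. These are monotone with
  \<open>b 0 = 1\<close> and limit 0, so summation by parts against the bounded character sums gives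
  a bound independent of \<open>t\<close>. For finite sums the subtraction leaves an error that
  vanishes as \<open>N\<close> grows.\<close>

lemma lambert_series_bound:
  fixes t :: real
  assumes t: "0 < t" "t < 1" and z: "Lhol q \<chi> 1 = 0"
    and f: "(\<lambda>n. \<chi> (Suc n) * of_real (t ^ Suc n / (1 - t ^ Suc n))) sums f"
  shows "norm f \<le> 2 * real q"
proof -
  define b where "b = (\<lambda>n. 1 / real (Suc n) / (1 - t) - t ^ Suc n / (1 - t ^ Suc n))"
  have dec: "b (Suc n) \<le> b n" for n
    using lambert_term_diff[OF t, of n] by (simp add: b_def diff_divide_distrib)
  have "(\<lambda>n. t ^ Suc n / (1 - t ^ Suc n)) \<longlonglongrightarrow> 0 / (1 - 0)"
    using LIMSEQ_Suc[OF LIMSEQ_power_zero[of t]] t by (intro tendsto_divide tendsto_diff tendsto_const) auto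
  moreover have "(\<lambda>n. 1 / real (Suc n) / (1 - t)) \<longlonglongrightarrow> 0 / (1 - t)"
    using t by (intro tendsto_divide LIMSEQ_Suc[OF lim_1_over_n] tendsto_const) auto
  ultimately have "b \<longlonglongrightarrow> 0 / (1 - t) - 0 / (1 - 0)"
    unfolding b_def by (rule tendsto_diff[rotated])
  then have nonneg: "b n \<ge> 0" for n
    using decseq_ge[of b 0 n] dec by (simp add: decseq_Suc_iff)
  have b0: "b 0 = 1" using t by (simp add: b_def field_simps)
  have bound: "norm (\<Sum>n<N. \<chi> (Suc n) * of_real (t ^ Suc n / (1 - t ^ Suc n))) \<le>
      2 * real q + 2 * real q / (1 - t) * (1 / real (Suc N))" for N
  proof -
    have "norm (\<Sum>n<N. \<chi> (Suc n) * of_real (b n)) \<le> 2 * real q * b 0"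
      by (rule sum_abel_bound) (use dirichlet_char_partial_sums_shift[of 0] dec nonneg in auto)
    moreover have "(\<Sum>n<N. \<chi> (Suc n) * of_real (t ^ Suc n / (1 - t ^ Suc n))) =
      (\<Sum>n<N. \<chi> (Suc n) / of_nat (Suc n)) / of_real (1 - t) - (\<Sum>n<N. \<chi> (Suc n) * of_real (b n))"
      unfolding b_def by (simp add: sum_subtractf sum_divide_distrib algebra_simps del: of_nat_Suc power_Suc)
    moreover have "norm ((\<Sum>n<N. \<chi> (Suc n) / of_nat (Suc n)) / complex_of_real (1 - t)) \<le>
        2 * real q / real (Suc N) / (1 - t)"
    proof -
      have "norm ((\<Sum>n<N. \<chi> (Suc n) / of_nat (Suc n)) / complex_of_real (1 - t)) =
          norm (\<Sum>n<N. \<chi> (Suc n) / of_nat (Suc n)) / (1 - t)"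
        unfolding norm_divide norm_of_real using t by simp
      also have "\<dots> \<le> 2 * real q / real (Suc N) / (1 - t)"
        using Lhol_1_partial_sums[of N] z t by (intro divide_right_mono) auto
      finally show ?thesis .
    qed
    ultimately show ?thesis
      using norm_triangle_ineq4[of "(\<Sum>n<N. \<chi> (Suc n) / of_nat (Suc n)) / complex_of_real (1 - t)"
          "\<Sum>n<N. \<chi> (Suc n) * of_real (b n)"] b0 by (simp add: mult.commute)
  qed
  have lim: "(\<lambda>N. norm (\<Sum>n<N. \<chi> (Suc n) * of_real (t ^ Suc n / (1 - t ^ Suc n)))) \<longlonglongrightarrow> norm f"
    using f unfolding sums_def by (rule tendsto_norm)
  have lim2: "(\<lambda>N. 2 * real q + 2 * real q / (1 - t) * (1 / real (Suc N))) \<longlonglongrightarrow> 2 * real q + 2 * real q / (1 - t) * 0"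
    by (intro tendsto_intros LIMSEQ_Suc[OF lim_1_over_n])
  show ?thesis
    using LIMSEQ_le[OF lim lim2] bound by auto
qed

text \<open>Regrouped as a power series, the Lambert series has the coefficients \<open>r n\<close>,
  which are nonnegative. They equal 1 at every power of \<open>q\<close>, because 1 is the only
  divisor of such a power that is coprime to \<open>q\<close>. So the series is unbounded as
  \<open>t\<close> tends to 1, against the bound \<open>2 * q\<close> that a zero at 1 would
  imply.\<close>

lemma Lhol_1_nonzero_real:
  assumes re: "(\<lambda>n. \<chi> n * \<chi> n) = principal_char q"
  shows "Lhol q \<chi> 1 \<noteq> 0"
proof
  assume z: "Lhol q \<chi> 1 = 0"
  have val: "\<chi> n = 1 \<or> \<chi> n = -1 \<or> \<chi> n = 0" for n
  proof -
    have "(\<chi> n - 1) * (\<chi> n + 1) * \<chi> n = 0"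
      using fun_cong[OF re, of n] dirichlet_char_eq_0_iff[OF \<chi>, of n]
      by (cases "coprime n q") (auto simp: principal_char_def algebra_simps)
    then show ?thesis by (auto simp: add_eq_0_iff2)
  qed
  define c where "c = (\<lambda>n. Re (\<chi> n))"
  have \<chi>c: "\<chi> n = of_real (c n)" for n
    using val[of n] by (auto simp: c_def)
  have cval: "c n \<in> {-1, 0, 1}" for n using val[of n] by (auto simp: c_def)
  have cmult: "c (m * n) = c m * c n" for m n
    using dirichlet_char_mult[OF \<chi>, of m n] unfolding \<chi>c by (metis of_real_eq_iff of_real_mult)
  define r where "r = (\<lambda>n. \<Sum>d | d dvd n. c d)"
  have r0: "r n \<ge> 0" if "n > 0" for n
    unfolding r_def by (rule sum_divisors_nonneg[OF cmult cval that])
  \<comment> \<open>Makes the exponents \<open>q ^ k\<close> distinct.\<close>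
  have q1: "q > 1"
  proof (rule ccontr)
    assume "\<not> q > 1"
    then have "q = 1" using q by simp
    then have "\<chi> n = principal_char q n" for n
      using dirichlet_char_cong[OF \<chi>, of n 1] dirichlet_char_1[OF \<chi>] by (simp add: principal_char_def)
    then show False using np by auto
  qed
  have rq: "r (q ^ k) = 1" for k
  proof -
    have "r (q ^ k) = (\<Sum>d\<in>{1}. c d)"
      unfolding r_def
    proof (rule sum.mono_neutral_right)
      show "\<forall>d\<in>{d. d dvd q ^ k} - {1}. c d = 0"
      proof
        fix d assume d: "d \<in> {d. d dvd q ^ k} - {1}"
        have "\<not> coprime d q"
        proof
          assume "coprime d q"
          then have "coprime d (q ^ k)" by simp
          then have "d = 1" using d coprime_absorb_left[of d "q ^ k"] by (simp only: mem_Collect_eq Diff_iff nat_dvd_1_iff_1)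
          then show False using d by simp
        qed
        then show "c d = 0" using dirichlet_char_eq_0_iff[OF \<chi>, of d] by (simp add: c_def)
      qed
    qed (use q in auto)
    then show ?thesis using dirichlet_char_1[OF \<chi>] by (simp add: c_def)
  qed
  \<comment> \<open>One more term than the bound \<open>2 * q\<close> allows in the limit.\<close>
  define K where "K = 2 * q + 1"
  have bound: "(\<Sum>k<K. t ^ (q ^ k)) \<le> 2 * real q" if t: "0 < t" "t < 1" for t :: real
  proof -
    let ?g = "\<lambda>d. \<chi> d * of_real (t ^ d / (1 - t ^ d))"
    let ?h = "\<lambda>d. norm (\<chi> d) * (t ^ d / (1 - t ^ d))"
    have td: "0 < t ^ d" "t ^ d < 1" if "d > 0" for d
      using t that by (auto simp: power_less_one_iff)
    have geo: "(\<lambda>e. t ^ (d * Suc e)) sums (t ^ d / (1 - t ^ d))" if "d > 0" for d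
    proof -
      have "(\<lambda>e. t ^ d * (t ^ d) ^ e) sums (t ^ d * (1 / (1 - t ^ d)))"
        using td[OF that] by (intro sums_mult geometric_sums) auto
      then show ?thesis by (simp add: power_add power_mult)
    qed
    have "summable (\<lambda>d. ?h (Suc d))"
    proof (rule summable_comparison_test'[of "\<lambda>d. t ^ Suc d * (1 / (1 - t))" 0])
      show "summable (\<lambda>d. t ^ Suc d * (1 / (1 - t)))"
        using t by (intro summable_mult2) (simp add: summable_Suc_iff summable_geometric)
      fix d
      have le: "t ^ Suc d \<le> t" using t power_decreasing[of 1 "Suc d" t] by simp
      have "norm (?h (Suc d)) = norm (\<chi> (Suc d)) * (t ^ Suc d / (1 - t ^ Suc d))"
        using td[of "Suc d"] by (simp del: power_Suc)
      also have "\<dots> \<le> 1 * (t ^ Suc d / (1 - t))"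
        using t le td[of "Suc d"]
        by (intro mult_mono norm_dirichlet_char_le[OF \<chi> q] divide_left_mono) (auto simp del: power_Suc)
      finally show "norm (?h (Suc d)) \<le> t ^ Suc d * (1 / (1 - t))" by simp
    qed
    then have sums: "(\<lambda>n. \<Sum>d | d dvd Suc n. \<chi> d * of_real (t ^ (d * (Suc n div d)))) sums (\<Sum>d. ?g (Suc d))"
    proof (rule sums_divisors_regroup[where h = ?h and g = ?g and F = "\<lambda>d e. \<chi> d * of_real (t ^ (d * e))", rotated 2])
      fix d :: nat assume d: "d > 0"
      show "(\<lambda>e. \<chi> d * of_real (t ^ (d * Suc e))) sums ?g d"
        by (intro sums_mult sums_of_real geo d)
      have "norm (\<chi> d * of_real (t ^ (d * Suc e))) = norm (\<chi> d) * t ^ (d * Suc e)" for e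
        using t by (simp add: norm_mult norm_power del: of_real_power)
      then show "(\<lambda>e. norm (\<chi> d * of_real (t ^ (d * Suc e)))) sums ?h d"
        using sums_mult[OF geo[OF d]] by simp
    qed
    have "(\<Sum>d | d dvd Suc n. \<chi> d * of_real (t ^ (d * (Suc n div d)))) = of_real (r (Suc n) * t ^ Suc n)" for n
    proof -
      have "(\<Sum>d | d dvd Suc n. \<chi> d * of_real (t ^ (d * (Suc n div d)))) =
          (\<Sum>d | d dvd Suc n. of_real (c d) * of_real (t ^ Suc n))"
        by (intro sum.cong refl) (simp add: \<chi>c del: power_Suc)
      then show ?thesis by (simp add: r_def sum_distrib_right del: power_Suc)
    qed
    with sums have s1: "(\<lambda>n. complex_of_real (r (Suc n) * t ^ Suc n)) sums (\<Sum>d. ?g (Suc d))" by simp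
    have "summable (\<lambda>d. norm (?g (Suc d)))"
    proof -
      have "norm (?g (Suc d)) = ?h (Suc d)" for d
        using td[of "Suc d"] by (simp only: norm_mult norm_of_real) (simp del: power_Suc)
      then show ?thesis using \<open>summable (\<lambda>d. ?h (Suc d))\<close> by simp
    qed
    then have "(\<lambda>d. ?g (Suc d)) sums (\<Sum>d. ?g (Suc d))"
      by (rule summable_sums[OF summable_norm_cancel])
    then have nf: "norm (\<Sum>d. ?g (Suc d)) \<le> 2 * real q"
      by (rule lambert_series_bound[OF t z])
    have s2: "(\<lambda>n. r (Suc n) * t ^ Suc n) sums Re (\<Sum>d. ?g (Suc d))"
      using sums_Re[OF s1] by (simp del: power_Suc of_real_mult of_real_power)
    have inj: "inj_on (\<lambda>k. q ^ k - 1) {..<K}"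
    proof (rule inj_onI)
      fix x y assume "q ^ x - 1 = q ^ y - 1"
      moreover have "q ^ x > 0" "q ^ y > 0" using q by auto
      ultimately have "q ^ x = q ^ y" by linarith
      then show "x = y" using q1 power_inject_exp by blast
    qed
    have "(\<Sum>k<K. t ^ (q ^ k)) = (\<Sum>k<K. r (Suc (q ^ k - 1)) * t ^ Suc (q ^ k - 1))"
      using rq q by (intro sum.cong refl) (simp del: power_Suc)
    also have "\<dots> = (\<Sum>n\<in>(\<lambda>k. q ^ k - 1) ` {..<K}. r (Suc n) * t ^ Suc n)"
      by (rule sum.reindex_cong[OF inj refl, symmetric]) simp
    also have "\<dots> \<le> (\<Sum>n. r (Suc n) * t ^ Suc n)"
      using r0 t by (intro sum_le_suminf sums_summable[OF s2]) auto
    also have "\<dots> = Re (\<Sum>d. ?g (Suc d))" using sums_unique[OF s2] by simp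
    also have "\<dots> \<le> 2 * real q" using nf complex_Re_le_cmod order_trans by blast
    finally show ?thesis .
  qed
  have lim: "((\<lambda>t::real. \<Sum>k<K. t ^ (q ^ k)) \<longlongrightarrow> (\<Sum>k<K. 1 ^ (q ^ k))) (at_left 1)"
    by (intro tendsto_intros)
  have "eventually (\<lambda>t::real. (\<Sum>k<K. t ^ (q ^ k)) \<le> 2 * real q) (at_left 1)"
    using eventually_at_left_real[OF zero_less_one] by eventually_elim (auto intro: bound)
  from tendsto_upperbound[OF lim this] show False by (simp add: K_def)
qed

end

theorem Lhol_nonzero_closed:
  assumes \<chi>: "dirichlet_char q \<chi>" and q: "q > 0" and s: "Re s \<ge> 1"
  shows "Lhol q \<chi> s \<noteq> 0"
proof (cases "Re s > 1")
  case True
  then show ?thesis by (rule Lhol_nonzero[OF \<chi> q])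
next
  case False
  then have se: "s = 1 + \<i> * of_real (Im s)" using s by (simp add: complex_eq_iff)
  show ?thesis
  proof (cases "Im s \<noteq> 0 \<or> (\<lambda>n. \<chi> n * \<chi> n) \<noteq> principal_char q")
    case True
    then show ?thesis using Lhol_nonzero_line[OF \<chi> q True] se by simp
  next
    case False
    then have "s = 1" using se by simp
    then show ?thesis
      using False Lhol_principal_nonzero[OF q] Lhol_1_nonzero_real[OF \<chi> q] by auto
  qed
qed

section \<open>Chebyshev functions in residue classes\<close>

text \<open>Legendre's formula for the factorial in logarithmic form. In the induction
  \<open>N div d\<close> grows by 1 exactly when \<open>d\<close> divides
  \<open>Suc N\<close>.\<close>

lemma sum_mangoldt_div: "(\<Sum>d\<in>{1..N}. mangoldt d * real (N div d)) = ln (fact N)"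
proof (induction N)
  case (Suc N)
  have "(\<Sum>d\<in>{1..Suc N}. mangoldt d * real (Suc N div d)) =
      (\<Sum>d\<in>{1..Suc N}. mangoldt d * real (N div d) + (if d dvd Suc N then mangoldt d else 0))"
    by (intro sum.cong refl) (auto simp: div_Suc dvd_eq_mod_eq_0 algebra_simps)
  also have "\<dots> = (\<Sum>d\<in>{1..N}. mangoldt d * real (N div d)) + (\<Sum>d\<in>{1..Suc N}. if d dvd Suc N then mangoldt d else 0)"
    by (simp add: sum.distrib)
  also have "(\<Sum>d\<in>{1..Suc N}. if d dvd Suc N then mangoldt d else 0) = (\<Sum>d | d dvd Suc N. mangoldt d)"
  proof -
    have "{d \<in> {1..Suc N}. d dvd Suc N} = {d. d dvd Suc N}"
      by (auto intro: dvd_imp_le Nat.gr0I simp: Suc_le_eq)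
    then show ?thesis by (simp only: sum.inter_filter[symmetric] finite_atLeastAtMost)
  qed
  also have "\<dots> = ln (real (Suc N))"
    using mangoldt_sum[of "Suc N", where 'a = real] by simp
  finally show ?case using Suc.IH by (simp add: ln_mult add.commute)
qed simp

text \<open>Chebyshev's argument: \<open>2 * n div d - 2 * (n div d)\<close> is never negative and
  is 1 for n < d <= 2n, while weighting \<open>mangoldt\<close> with it gives the logarithm of the
  central binomial coefficient, which is at most 4^n.\<close>

lemma sum_mangoldt_doubling: "(\<Sum>d\<in>{n<..2*n}. mangoldt d) \<le> real n * ln 4"
proof -
  have ext: "(\<Sum>d\<in>{1..2*n}. mangoldt d * real (n div d)) = ln (fact n)"
    unfolding sum_mangoldt_div[symmetric] by (rule sum.mono_neutral_right) auto
  have "(\<Sum>d\<in>{n<..2*n}. mangoldt d) \<le> (\<Sum>d\<in>{1..2*n}. mangoldt d * (real (2 * n div d) - 2 * real (n div d)))"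
  proof (rule sum_le_included[where i = "\<lambda>d. d"])
    show "\<forall>d\<in>{1..2*n}. 0 \<le> (mangoldt d * (real (2 * n div d) - 2 * real (n div d)) :: real)"
    proof
      fix d assume "d \<in> {1..2*n}"
      have "d * (2 * (n div d)) \<le> 2 * n" using mult_div_mod_eq[of d n] by linarith
      then have "2 * (n div d) \<le> 2 * n div d" using \<open>d \<in> _\<close> by (simp add: less_eq_div_iff_mult_less_eq mult.commute)
      then have "2 * real (n div d) \<le> real (2 * n div d)" by linarith
      then show "0 \<le> (mangoldt d * (real (2 * n div d) - 2 * real (n div d)) :: real)"
        by (intro mult_nonneg_nonneg mangoldt_nonneg) auto
    qed
    show "\<forall>x\<in>{n<..2*n}. \<exists>y\<in>{1..2*n}. y = x \<and> mangoldt x \<le> (mangoldt y * (real (2 * n div y) - 2 * real (n div y)) :: real)"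
    proof
      fix x assume x: "x \<in> {n<..2*n}"
      then have "2 * n div x = 1" by (intro div_nat_eqI) auto
      moreover have "n div x = 0" using x by simp
      ultimately show "\<exists>y\<in>{1..2*n}. y = x \<and> mangoldt x \<le> (mangoldt y * (real (2 * n div y) - 2 * real (n div y)) :: real)"
        using x by (intro bexI[of _ x]) auto
    qed
  qed auto
  also have "\<dots> = (\<Sum>d\<in>{1..2*n}. mangoldt d * real (2 * n div d)) - 2 * (\<Sum>d\<in>{1..2*n}. mangoldt d * real (n div d))"
    by (simp add: sum_subtractf sum_distrib_left algebra_simps)
  also have "\<dots> = ln (fact (2 * n)) - 2 * ln (fact n)"
    unfolding ext by (simp only: sum_mangoldt_div)
  also have "\<dots> = ln (real ((2 * n) choose n))"
  proof -
    have "real ((2 * n) choose n) = fact (2 * n) / (fact n * fact n)"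
      using binomial_fact[of n "2 * n", where 'a = real] by simp
    moreover have "ln (fact (2 * n) / (fact n * fact n) :: real) = ln (fact (2 * n)) - (ln (fact n) + ln (fact n))"
      by (simp add: ln_div ln_mult)
    ultimately show ?thesis by simp
  qed
  also have "\<dots> \<le> ln (4 ^ n)"
  proof -
    have "(2 * n) choose n \<le> (\<Sum>k\<le>2 * n. (2 * n) choose k)"
      by (rule member_le_sum) auto
    also have "\<dots> = 2 ^ (2 * n)" by (rule choose_row_sum)
    finally have "(2 * n) choose n \<le> 4 ^ n" by (simp add: power_mult)
    then have "real ((2 * n) choose n) \<le> real (4 ^ n)" by (rule of_nat_mono)
    then show ?thesis by (subst ln_le_cancel_iff) auto
  qed
  also have "\<dots> = real n * ln 4" by (simp add: ln_realpow)
  finally show ?thesis .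
qed

text \<open>Halving with rounding up: the bound at \<open>h\<close> and the doubling estimate give 4
  h ln 4, and 4 h <= 2 (n + 1) <= 3 n for n >= 2. This rounding is the source of the factor
  3.\<close>

lemma sum_mangoldt_le: "(\<Sum>d\<in>{1..n}. mangoldt d) \<le> 3 * ln 4 * real n"
proof (induction n rule: less_induct)
  case (less n)
  show ?case
  proof (cases "n \<le> 1")
    case True
    then have "n = 0 \<or> n = 1" by auto
    then show ?thesis by auto
  next
    case False
    define h where "h = (n + 1) div 2"
    have h: "h < n" "n \<le> 2 * h" "2 * h \<le> n + 1" using False by (auto simp: h_def)
    have "(\<Sum>d\<in>{1..n}. mangoldt d :: real) \<le> (\<Sum>d\<in>{1..2*h}. mangoldt d)"
      using h by (intro sum_mono2) (auto simp: mangoldt_nonneg)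
    also have "{1..2*h} = {1..h} \<union> {h<..2*h}" using h by auto
    also have "(\<Sum>d\<in>{1..h} \<union> {h<..2*h}. mangoldt d :: real) = (\<Sum>d\<in>{1..h}. mangoldt d) + (\<Sum>d\<in>{h<..2*h}. mangoldt d)"
      by (rule sum.union_disjoint) auto
    also have "\<dots> \<le> 3 * ln 4 * real h + real h * ln 4"
      using less.IH[OF h(1)] sum_mangoldt_doubling[of h] by linarith
    also have "\<dots> = ln 4 * (4 * real h)" by simp
    also have "\<dots> \<le> ln 4 * (3 * real n)"
    proof (rule mult_left_mono)
      have "real (2 * h) \<le> real (n + 1)" using h(3) by (rule of_nat_mono)
      then have "4 * real h \<le> 2 * (real n + 1)" by simp
      also have "\<dots> \<le> 3 * real n" using False by simp
      finally show "4 * real h \<le> 3 * real n" .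
    qed simp
    finally show ?thesis by simp
  qed
qed

definition psi_ap :: "nat \<Rightarrow> nat \<Rightarrow> nat \<Rightarrow> real" where
  "psi_ap q a n = (\<Sum>m\<in>{1..n}. if [m = a] (mod q) then mangoldt m else 0)"

definition theta_ap :: "nat \<Rightarrow> nat \<Rightarrow> nat \<Rightarrow> real" where
  "theta_ap q a n = (\<Sum>p | prime p \<and> p \<le> n \<and> [p = a] (mod q). ln (real p))"

lemma psi_ap_bounds: "0 \<le> psi_ap q a n" "psi_ap q a n \<le> 3 * ln 4 * real n"
proof -
  show "0 \<le> psi_ap q a n" unfolding psi_ap_def by (intro sum_nonneg) (auto simp: mangoldt_nonneg)
  have "psi_ap q a n \<le> (\<Sum>m\<in>{1..n}. mangoldt m)"
    unfolding psi_ap_def by (intro sum_mono) (auto simp: mangoldt_nonneg)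
  then show "psi_ap q a n \<le> 3 * ln 4 * real n" using sum_mangoldt_le[of n] by linarith
qed

lemma card_nonprime_prime_powers:
  "real (card {m \<in> {1..n}. primepow m \<and> \<not> prime m}) \<le> sqrt (real n) * log 2 (real n)"
proof (cases "n = 0")
  case False
  let ?P = "{m \<in> {1..n}. primepow m \<and> \<not> prime m}"
  let ?A = "{1..nat \<lfloor>sqrt (real n)\<rfloor>} \<times> {1..nat \<lfloor>log 2 (real n)\<rfloor>}"
  have "?P \<subseteq> (\<lambda>(p, k). p ^ k) ` ?A"
  proof
    fix m assume "m \<in> ?P"
    then have m: "1 \<le> m" "m \<le> n" "primepow m" "\<not> prime m" by auto
    then obtain p k where pk: "prime p" "k > 0" "m = p ^ k" by (auto simp: primepow_def)
    have "k \<noteq> 1" using pk m by auto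
    then have k: "k \<ge> 2" using pk by simp
    have p: "p \<ge> 2" using prime_ge_2_nat[OF pk(1)] .
    have "p ^ 2 \<le> p ^ k" using k p by (intro power_increasing) auto
    then have "p ^ 2 \<le> n" using pk m by simp
    then have "real p ^ 2 \<le> real n" by (metis of_nat_le_iff of_nat_power)
    then have "real p \<le> sqrt (real n)" by (rule real_le_rsqrt)
    then have p1: "p \<le> nat \<lfloor>sqrt (real n)\<rfloor>" by (simp add: le_nat_floor)
    have "2 ^ k \<le> p ^ k" using p by (intro power_mono) auto
    then have "2 ^ k \<le> n" using pk(3) m(2) by linarith
    then have "2 ^ k \<le> real n" by (metis of_nat_le_iff of_nat_numeral of_nat_power)
    then have "real k \<le> log 2 (real n)" using False by (simp add: le_log_iff powr_realpow)
    then have k1: "k \<le> nat \<lfloor>log 2 (real n)\<rfloor>" by (simp add: le_nat_floor)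
    show "m \<in> (\<lambda>(p, k). p ^ k) ` ?A"
      by (rule image_eqI[of _ _ "(p, k)"]) (use pk p p1 k k1 in auto)
  qed
  then have "card ?P \<le> card ?A"
    using surj_card_le[of ?A ?P "\<lambda>(p, k). p ^ k"] by auto
  also have "\<dots> = nat \<lfloor>sqrt (real n)\<rfloor> * nat \<lfloor>log 2 (real n)\<rfloor>" by simp
  finally have "real (card ?P) \<le> real (nat \<lfloor>sqrt (real n)\<rfloor>) * real (nat \<lfloor>log 2 (real n)\<rfloor>)"
    by (metis of_nat_le_iff of_nat_mult)
  also have "\<dots> \<le> sqrt (real n) * log 2 (real n)"
  proof -
    have "log 2 (real n) \<ge> 0" using False by simp
    then show ?thesis by (intro mult_mono of_nat_floor) auto
  qed
  finally show ?thesis .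
qed simp

lemma psi_ap_theta_ap:
  assumes "n > 0"
  shows "theta_ap q a n \<le> psi_ap q a n"
    "psi_ap q a n \<le> theta_ap q a n + sqrt (real n) * log 2 (real n) * ln (real n)"
proof -
  let ?Q = "{m \<in> {1..n}. [m = a] (mod q)}"
  have Q: "psi_ap q a n = (\<Sum>m\<in>?Q. mangoldt m)"
    unfolding psi_ap_def by (simp only: sum.inter_filter finite_atLeastAtMost)
  let ?P = "{p. prime p \<and> p \<le> n \<and> [p = a] (mod q)}"
  let ?R = "{m \<in> ?Q. \<not> prime m}"
  have un: "?Q = ?P \<union> ?R" using prime_ge_1_nat by auto
  have "psi_ap q a n = (\<Sum>m\<in>?P. mangoldt m) + (\<Sum>m\<in>?R. mangoldt m)"
    unfolding Q by (subst un, rule sum.union_disjoint) auto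
  also have "(\<Sum>m\<in>?P. mangoldt m) = theta_ap q a n"
    unfolding theta_ap_def by (intro sum.cong refl) auto
  finally have eq: "psi_ap q a n = theta_ap q a n + (\<Sum>m\<in>?R. mangoldt m)" .
  show "theta_ap q a n \<le> psi_ap q a n"
    unfolding eq by (simp add: sum_nonneg mangoldt_nonneg)
  let ?T = "{m \<in> {1..n}. primepow m \<and> \<not> prime m}"
  have "(\<Sum>m\<in>?R. mangoldt m :: real) \<le> (\<Sum>m\<in>?T. ln (real n))"
  proof -
    have "(\<Sum>m\<in>?R. mangoldt m :: real) = (\<Sum>m\<in>{m\<in>?R. primepow m}. mangoldt m)"
      by (rule sum.mono_neutral_right) (auto simp: mangoldt_def)
    also have "\<dots> \<le> (\<Sum>m\<in>{m\<in>?R. primepow m}. ln (real n))"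
    proof (rule sum_mono)
      fix m assume "m \<in> {m\<in>?R. primepow m}"
      then have m: "m > 0" "m \<le> n" by auto
      have "mangoldt m \<le> ln (real m)" using m by (intro mangoldt_le) auto
      also have "\<dots> \<le> ln (real n)" using m by simp
      finally show "mangoldt m \<le> ln (real n)" .
    qed
    also have "\<dots> \<le> (\<Sum>m\<in>?T. ln (real n))"
      using assms by (intro sum_mono2) auto
    finally show ?thesis .
  qed
  also have "\<dots> = real (card ?T) * ln (real n)" by simp
  also have "\<dots> \<le> (sqrt (real n) * log 2 (real n)) * ln (real n)"
    using assms by (intro mult_right_mono card_nonprime_prime_powers) auto
  finally show "psi_ap q a n \<le> theta_ap q a n + sqrt (real n) * log 2 (real n) * ln (real n)"
    unfolding eq by simp
qed

section \<open>From convergence of a sum to an asymptotic formula\<close>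

lemma sum_inverse_telescope:
  assumes "1 \<le> N" "N \<le> M"
  shows "(\<Sum>k\<in>{N..<M}. 1 / (real k * (real k + 1))) = 1 / real N - 1 / real M"
proof -
  have "(\<Sum>k\<in>{N..<M}. 1 / (real k * (real k + 1))) = (\<Sum>k\<in>{N..<M}. (- 1 / real (Suc k)) - (- 1 / real k))"
    using assms by (intro sum.cong refl) (auto simp: field_simps)
  also have "\<dots> = - 1 / real M - (- 1 / real N)" by (rule sum_Suc_diff'[OF assms(2)])
  finally show ?thesis by simp
qed

text \<open>If \<open>A N\<close> is too large, monotonicity keeps \<open>A n\<close> too large for
  all n up to a fixed multiple of N; if it is too small, then it was already too small from a fixed
  fraction of N on. Either way a block of the sum exceeds a constant \<open>\<eta>\<close>
  independent of N, against the Cauchy criterion.\<close>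

lemma monotone_average_tendsto:
  fixes A :: "nat \<Rightarrow> real"
  assumes mono: "mono A"
    and conv: "convergent (\<lambda>N. \<Sum>n\<in>{1..<N}. (A n - real n) / (real n * (real n + 1)))"
  shows "(\<lambda>n. A n / real n) \<longlonglongrightarrow> 1"
proof -
  define T where "T = (\<lambda>n. (A n - real n) / (real n * (real n + 1)))"
  have cauchy: "\<exists>M0. \<forall>N M. M0 \<le> N \<longrightarrow> N \<le> M \<longrightarrow> \<bar>\<Sum>n\<in>{N..<M}. T n\<bar> < \<eta>" if \<eta>: "\<eta> > 0" for \<eta>
  proof -
    have "Cauchy (\<lambda>N. \<Sum>n\<in>{1..<N}. T n)"
      using conv unfolding T_def by (rule convergent_Cauchy)
    then obtain M1 where M1: "\<forall>m\<ge>M1. \<forall>n\<ge>M1. norm ((\<Sum>n\<in>{1..<m}. T n) - (\<Sum>n\<in>{1..<n}. T n)) < \<eta>"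
      using \<eta> by (meson CauchyD)
    have "\<bar>\<Sum>n\<in>{N..<M}. T n\<bar> < \<eta>" if "M1 + 1 \<le> N" "N \<le> M" for N M
    proof -
      have "(\<Sum>n\<in>{1..<M}. T n) = (\<Sum>n\<in>{1..<N}. T n) + (\<Sum>n\<in>{N..<M}. T n)"
        using that by (intro sum.atLeastLessThan_concat[symmetric]) auto
      then show ?thesis using M1[rule_format, of M N] that by simp
    qed
    then show ?thesis by blast
  qed
  have upper: "eventually (\<lambda>N. A N < (1 + \<epsilon>) * real N) sequentially" if \<epsilon>: "\<epsilon> > 0" for \<epsilon>
  proof -
    \<comment> \<open>Halfway to the assumed excess, so that on the whole block
      \<open>A n - n\<close> is still at least \<open>\<epsilon> / 2 * N\<close>.\<close>
    define \<mu> where "\<mu> = 1 + \<epsilon> / 2"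
    define \<eta> where "\<eta> = \<epsilon> / 2 * (1 - 1 / \<mu>)"
    have \<mu>: "\<mu> > 1" using \<epsilon> by (simp add: \<mu>_def)
    have \<eta>: "\<eta> > 0" using \<epsilon> \<mu> by (simp add: \<eta>_def)
    obtain M0 where M0: "\<And>N M. M0 \<le> N \<Longrightarrow> N \<le> M \<Longrightarrow> \<bar>\<Sum>n\<in>{N..<M}. T n\<bar> < \<eta>"
      using cauchy[OF \<eta>] by blast
    have "A N < (1 + \<epsilon>) * real N" if N: "N \<ge> M0 + 1" for N
    proof (rule ccontr)
      assume "\<not> A N < (1 + \<epsilon>) * real N"
      then have AN: "A N \<ge> (1 + \<epsilon>) * real N" by simp
      define M where "M = nat \<lceil>\<mu> * real N\<rceil>"
      have M: "\<mu> * real N \<le> real M" unfolding M_def by (rule real_nat_ceiling_ge)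
      have "real N \<le> \<mu> * real N" using \<mu> mult_right_mono[of 1 \<mu> "real N"] by simp
      then have NM: "N \<le> M" using M by linarith
      have "\<epsilon> / 2 * real N * (1 / (real n * (real n + 1))) \<le> T n" if n: "n \<in> {N..<M}" for n
      proof -
        have "int n < \<lceil>\<mu> * real N\<rceil>" using n by (auto simp: M_def)
        then have nl: "real n < \<mu> * real N" by (simp add: less_ceiling_iff)
        have "A N \<le> A n" using n by (intro monoD[OF mono]) auto
        then have "\<epsilon> / 2 * real N \<le> A n - real n"
          using AN nl by (simp add: \<mu>_def algebra_simps)
        then have "\<epsilon> / 2 * real N / (real n * (real n + 1)) \<le> (A n - real n) / (real n * (real n + 1))"
          by (rule divide_right_mono) simp
        then show ?thesis by (simp add: T_def)
      qed
      then have "(\<Sum>n\<in>{N..<M}. \<epsilon> / 2 * real N * (1 / (real n * (real n + 1)))) \<le> (\<Sum>n\<in>{N..<M}. T n)"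
        by (intro sum_mono)
      moreover have "(\<Sum>n\<in>{N..<M}. \<epsilon> / 2 * real N * (1 / (real n * (real n + 1)))) = \<epsilon> / 2 * real N * (1 / real N - 1 / real M)"
        unfolding sum_distrib_left[symmetric] by (subst sum_inverse_telescope) (use N NM in auto)
      moreover have "\<eta> \<le> \<epsilon> / 2 * real N * (1 / real N - 1 / real M)"
      proof -
        have N0: "real N > 0" using N by simp
        have "\<mu> * real N > 0" using N0 \<mu> by simp
        then have "real N / real M \<le> real N / (\<mu> * real N)"
          using M N0 mult_pos_pos[of "real M" "\<mu> * real N"] by (intro divide_left_mono) linarith+
        also have "\<dots> = 1 / \<mu>" using N0 by simp
        finally have "1 - 1 / \<mu> \<le> real N * (1 / real N - 1 / real M)"
          using N0 by (simp add: algebra_simps)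
        then have "\<epsilon> / 2 * (1 - 1 / \<mu>) \<le> \<epsilon> / 2 * (real N * (1 / real N - 1 / real M))"
          using \<epsilon> by (intro mult_left_mono) auto
        then show ?thesis unfolding \<eta>_def by (simp only: mult.assoc)
      qed
      ultimately have "\<eta> \<le> (\<Sum>n\<in>{N..<M}. T n)" by linarith
      then show False using M0[of N M] N NM by fastforce
    qed
    then show ?thesis by (auto simp: eventually_sequentially)
  qed
  have lower: "eventually (\<lambda>N. A N > (1 - \<epsilon>) * real N) sequentially" if \<epsilon>: "0 < \<epsilon>" "\<epsilon> < 1" for \<epsilon>
  proof -
    define \<mu> where "\<mu> = 1 - \<epsilon> / 2"
    \<comment> \<open>Rounding the start of the block up costs at most 1, which is at most
      \<open>\<epsilon> / 4 * N\<close> for N >= 4 / \<epsilon>; the block therefore starts at or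
      below \<open>(1 - \<epsilon> / 4) * N\<close>, and this leaves the second factor.\<close>
    define \<eta> where "\<eta> = \<epsilon> / 2 * (\<epsilon> / 4)"
    have \<mu>: "1/2 < \<mu>" "\<mu> < 1" using \<epsilon> by (auto simp: \<mu>_def)
    have \<eta>: "\<eta> > 0" using \<epsilon> by (simp add: \<eta>_def)
    obtain M0 where M0: "\<And>N M. M0 \<le> N \<Longrightarrow> N \<le> M \<Longrightarrow> \<bar>\<Sum>n\<in>{N..<M}. T n\<bar> < \<eta>"
      using cauchy[OF \<eta>] by blast
    have main: "A N > (1 - \<epsilon>) * real N" if N: "N \<ge> 2 * M0 + 1" "real N \<ge> 4 / \<epsilon>" for N
    proof (rule ccontr)
      assume "\<not> A N > (1 - \<epsilon>) * real N"
      then have AN: "A N \<le> (1 - \<epsilon>) * real N" by simp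
      define M where "M = nat \<lceil>\<mu> * real N\<rceil>"
      have M: "\<mu> * real N \<le> real M" unfolding M_def by (rule real_nat_ceiling_ge)
      have N0: "real N > 0" using N by simp
      have eN: "1 \<le> \<epsilon> / 4 * real N" using N(2) \<epsilon> by (simp add: field_simps)
      have "real M \<le> \<mu> * real N + 1"
        unfolding M_def using \<mu> N0 by (simp add: of_nat_nat)
      then have M2: "real M \<le> (1 - \<epsilon> / 4) * real N" using eN by (simp add: \<mu>_def algebra_simps)
      also have "\<dots> \<le> real N" using \<epsilon> by (simp add: mult_left_le_one_le)
      finally have NM: "M \<le> N" by simp
      have "1/2 * real N \<le> \<mu> * real N" using \<mu> by (intro mult_right_mono) auto
      then have "real N \<le> 2 * real M" using M by simp
      then have MM: "M0 \<le> M" "1 \<le> M" using N by linarith+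
      have "\<epsilon> / 2 * real N * (1 / (real n * (real n + 1))) \<le> - T n" if n: "n \<in> {M..<N}" for n
      proof -
        have nl: "\<mu> * real N \<le> real n" using n M by auto
        have "A n \<le> A N" using n by (intro monoD[OF mono]) auto
        then have "\<epsilon> / 2 * real N \<le> real n - A n"
          using AN nl by (simp add: \<mu>_def algebra_simps)
        then have "\<epsilon> / 2 * real N / (real n * (real n + 1)) \<le> (real n - A n) / (real n * (real n + 1))"
          by (rule divide_right_mono) simp
        then show ?thesis by (simp add: T_def minus_divide_left)
      qed
      then have "(\<Sum>n\<in>{M..<N}. \<epsilon> / 2 * real N * (1 / (real n * (real n + 1)))) \<le> (\<Sum>n\<in>{M..<N}. - T n)"
        by (intro sum_mono)
      moreover have "(\<Sum>n\<in>{M..<N}. \<epsilon> / 2 * real N * (1 / (real n * (real n + 1)))) = \<epsilon> / 2 * real N * (1 / real M - 1 / real N)"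
        unfolding sum_distrib_left[symmetric] by (subst sum_inverse_telescope) (use MM NM in auto)
      moreover have "\<eta> \<le> \<epsilon> / 2 * real N * (1 / real M - 1 / real N)"
      proof -
        have "real N * (1 + \<epsilon> / 4) * (1 - \<epsilon> / 4) \<le> real N * 1"
          unfolding mult.assoc by (intro mult_left_mono) (auto simp: algebra_simps)
        moreover have "(1 + \<epsilon> / 4) * real M \<le> (1 + \<epsilon> / 4) * ((1 - \<epsilon> / 4) * real N)"
          using M2 \<epsilon> by (intro mult_left_mono) auto
        moreover have "(1 + \<epsilon> / 4) * ((1 - \<epsilon> / 4) * real N) = real N * (1 + \<epsilon> / 4) * (1 - \<epsilon> / 4)"
          by (simp only: mult_ac)
        ultimately have "(1 + \<epsilon> / 4) * real M \<le> real N" by linarith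
        then have "1 + \<epsilon> / 4 \<le> real N / real M" using MM by (simp add: field_simps)
        then have "\<epsilon> / 4 \<le> real N * (1 / real M - 1 / real N)"
          using N0 by (simp add: algebra_simps)
        then have "\<epsilon> / 2 * (\<epsilon> / 4) \<le> \<epsilon> / 2 * (real N * (1 / real M - 1 / real N))"
          using \<epsilon> by (intro mult_left_mono) auto
        then show ?thesis unfolding \<eta>_def by (simp only: mult.assoc)
      qed
      ultimately have "\<eta> \<le> - (\<Sum>n\<in>{M..<N}. T n)" by (simp add: sum_negf)
      then show False using M0[OF MM(1) NM] by linarith
    qed
    show ?thesis
      using eventually_ge_at_top[of "2 * M0 + 1"]
        eventually_ge_at_top[of "nat \<lceil>4 / \<epsilon>\<rceil>"]
      by eventually_elim (rule main, simp_all add: nat_ceiling_le_eq)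
  qed
  show ?thesis
  proof (rule tendstoI)
    fix e :: real assume "e > 0"
    define \<epsilon> where "\<epsilon> = min e (1/2)"
    have \<epsilon>: "0 < \<epsilon>" "\<epsilon> < 1" "\<epsilon> \<le> e" using \<open>e > 0\<close> by (auto simp: \<epsilon>_def)
    show "eventually (\<lambda>n. dist (A n / real n) 1 < e) sequentially"
      using upper[OF \<epsilon>(1)] lower[OF \<epsilon>(1,2)] eventually_gt_at_top[of 0]
    proof eventually_elim
      case (elim n)
      have "A n / real n < 1 + \<epsilon>" "1 - \<epsilon> < A n / real n"
        using elim by (auto simp: field_simps)
      then show ?case using \<epsilon>(3) by (simp add: dist_real_def abs_less_iff)
    qed
  qed
qed

section \<open>The prime number theorem for arithmetic progressions\<close>

text \<open>
  This is the integral of \<open>u\<^sup>-\<^sup>2\<^sup>-\<^sup>z\<close> over \<open>[n, n + 1]\<close>. Weighting it with \<open>\<phi>(q) \<psi>(n; q, a) - n\<close> gives,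
  by summation by parts, the Dirichlet series with coefficients \<open>\<phi>(q) \<Lambda>(n) - 1\<close> (\<open>n\<close> in the residue
  class of \<open>a\<close>) or \<open>-1\<close> (otherwise) at \<open>1 + z\<close>, divided by \<open>1 + z\<close>.
\<close>

definition power_diff_quot :: "nat \<Rightarrow> complex \<Rightarrow> complex" where
  "power_diff_quot n z = (if z = -1 then of_real (ln (real (Suc n)) - ln (real n))
     else (of_nat n powr (-1 - z) - of_nat (Suc n) powr (-1 - z)) / (z + 1))"

lemma holomorphic_power_diff_quot:
  assumes n: "n > 0"
  shows "power_diff_quot n holomorphic_on UNIV"
proof -
  let ?g = "\<lambda>z. of_nat n powr (-1 - z) - of_nat (Suc n) powr (-1 - z) :: complex"
  have hol: "?g holomorphic_on UNIV"
    by (intro holomorphic_intros)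
  have "(?g has_field_derivative of_real (ln (real (Suc n)) - ln (real n))) (at (-1))"
    using n unfolding powr_def
    by (auto intro!: derivative_eq_intros simp del: of_nat_Suc simp: Ln_of_nat)
  then have d: "deriv ?g (-1) = of_real (ln (real (Suc n)) - ln (real n))"
    by (rule DERIV_imp_deriv)
  have g1: "?g (-1) = 0" using n by (simp del: of_nat_Suc)
  have "power_diff_quot n = (\<lambda>z. if z = -1 then deriv ?g (-1) else (?g z - ?g (-1)) / (z - (-1)))"
    unfolding power_diff_quot_def fun_eq_iff d g1 by simp
  then show ?thesis using pole_lemma_open[OF hol open_UNIV, of "-1"] by simp
qed

text \<open>The derivative of u^(-1-z) has modulus |1 + z| u^(-x-2), with x = Re z, and one factor
  1/u is at most 1/n on the interval. The rest has the explicit primitive on the right, which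
  telescopes over n and is correct for either sign of \<open>Re z\<close>. At \<open>z = -1\<close>
  the right-hand side is 1.\<close>

lemma norm_power_diff_quot:
  assumes n: "n > 0" and x: "Re z \<noteq> 0"
  shows "real n * norm (power_diff_quot n z) \<le> (real n powr (- Re z) - real (Suc n) powr (- Re z)) / Re z"
proof (cases "z = -1")
  case True
  have "ln (real (Suc n)) - ln (real n) = ln (1 + 1 / real n)"
  proof -
    have "1 + 1 / real n = real (Suc n) / real n" using n by (simp add: field_simps)
    then show ?thesis using n by (simp add: ln_div)
  qed
  also have "\<dots> \<le> 1 / real n" by (rule ln_add_one_self_le_self) simp
  finally have "real n * (ln (real (Suc n)) - ln (real n)) \<le> 1"
    using n by (simp add: field_simps)
  moreover have "ln (real n) \<le> ln (real (Suc n))" using n by simp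
  moreover from this have "norm (power_diff_quot n z) = ln (real (Suc n)) - ln (real n)"
    unfolding power_diff_quot_def if_P[OF True] norm_of_real by simp
  ultimately show ?thesis using True n by simp
next
  case False
  define x where "x = Re z"
  have x0: "x \<noteq> 0" using x by (simp add: x_def)
  let ?f = "\<lambda>u. of_real u powr (-1 - z) :: complex"
  let ?\<phi> = "\<lambda>u. - norm (1 + z) / (x * real n) * u powr (- x)"
  have "norm (?f (real (Suc n)) - ?f (real n)) \<le> ?\<phi> (real (Suc n)) - ?\<phi> (real n)"
  proof (rule differentiable_bound_general)
    show "continuous_on {real n..real (Suc n)} ?f"
      using n by (intro continuous_intros) (auto simp: complex_nonpos_Reals_iff)
    show "continuous_on {real n..real (Suc n)} ?\<phi>"
      using n by (intro continuous_intros) auto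
    fix u assume u: "real n < u" "u < real (Suc n)"
    then have u0: "u > 0" by linarith
    have "((\<lambda>z'. z' powr (-1 - z)) has_field_derivative (-1 - z) * of_real u powr (-1 - z - 1)) (at (of_real u))"
      using u0 by (intro has_field_derivative_powr) auto
    then show "(?f has_vector_derivative (-1 - z) * of_real u powr (-1 - z - 1)) (at u)"
      by (rule has_vector_derivative_real_field)
    show "(?\<phi> has_vector_derivative norm (1 + z) / real n * u powr (- x - 1)) (at u)"
      unfolding has_real_derivative_iff_has_vector_derivative[symmetric]
      using u0 x0 n by (auto intro!: derivative_eq_intros simp: field_simps powr_diff)
    have "norm ((-1 - z) * of_real u powr (-1 - z - 1)) = norm (1 + z) * u powr (- x - 1 - 1)"
    proof -
      have "norm (complex_of_real u powr (-1 - z - 1)) = u powr (- x - 1 - 1)"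
        using u0 by (simp add: norm_powr_real_powr x_def algebra_simps)
      moreover have "norm (-1 - z) = norm (1 + z)" by (metis minus_add_distrib norm_minus_cancel uminus_add_conv_diff add_uminus_conv_diff)
      ultimately show ?thesis by (simp only: norm_mult)
    qed
    also have "u powr (- x - 1 - 1) = u powr (- x - 1) / u" using u0 by (subst powr_diff) simp
    also have "norm (1 + z) * (u powr (- x - 1) / u) \<le> norm (1 + z) * (u powr (- x - 1) / real n)"
      using u n by (intro mult_left_mono divide_left_mono) auto
    finally show "norm ((-1 - z) * of_real u powr (-1 - z - 1)) \<le> norm (1 + z) / real n * u powr (- x - 1)"
      by simp
  qed simp
  also have "?\<phi> (real (Suc n)) - ?\<phi> (real n) =
      norm (1 + z) / real n * ((real n powr (- x) - real (Suc n) powr (- x)) / x)"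
    using x0 n by (simp add: field_simps)
  finally have *: "norm (of_nat (Suc n) powr (-1 - z) - of_nat n powr (-1 - z) :: complex) \<le>
      norm (1 + z) / real n * ((real n powr (- x) - real (Suc n) powr (- x)) / x)" by (simp only: of_real_of_nat_eq)
  have z1: "norm (1 + z) > 0" using False by (simp add: add_eq_0_iff)
  have "real n * norm (power_diff_quot n z) =
      real n * norm (of_nat (Suc n) powr (-1 - z) - of_nat n powr (-1 - z) :: complex) / norm (1 + z)"
    using False by (simp add: power_diff_quot_def norm_divide norm_minus_commute add.commute del: of_nat_Suc)
  also have "\<dots> \<le> real n * (norm (1 + z) / real n * ((real n powr (- x) - real (Suc n) powr (- x)) / x)) / norm (1 + z)"
    by (intro divide_right_mono mult_left_mono *) auto
  also have "\<dots> = (real n powr (- x) - real (Suc n) powr (- x)) / x"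
    using n z1 by (simp del: of_nat_Suc)
  finally show ?thesis unfolding x_def .
qed

lemma sum_power_diff_telescope:
  "N \<le> M \<Longrightarrow> (\<Sum>n\<in>{N..<M}. (real n powr x - real (Suc n) powr x) / y) = (real N powr x - real M powr x) / y"
  by (induction M rule: dec_induct) (auto simp: diff_divide_distrib)

lemma sum_by_parts_powr:
  fixes c :: "nat \<Rightarrow> complex" and f :: "nat \<Rightarrow> complex"
  assumes "c 0 = 0"
  shows "(\<Sum>n\<in>{1..<Suc N}. c n * (f n - f (Suc n))) = (\<Sum>n<N. (c (Suc n) - c n) * f (Suc n)) - c N * f (Suc N)"
  by (induction N) (use assms in \<open>auto simp: algebra_simps\<close>)

section \<open>The sum for one residue class and its analytic limit\<close>

context
  fixes q a :: nat
  assumes q: "q > 0" and a: "coprime a q"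
begin

definition ap_error :: "nat \<Rightarrow> real" where
  "ap_error n = real (totient q) * psi_ap q a n - real n"

definition ap_bound :: real where
  "ap_bound = real (totient q) * (3 * ln 4) + 1"

lemma ap_error_bound: "\<bar>ap_error n\<bar> \<le> ap_bound * real n"
proof -
  have "real (totient q) * psi_ap q a n \<le> real (totient q) * (3 * ln 4 * real n)"
    by (intro mult_left_mono psi_ap_bounds) auto
  moreover have "0 \<le> real (totient q) * psi_ap q a n"
    by (intro mult_nonneg_nonneg psi_ap_bounds) auto
  ultimately show ?thesis by (simp add: ap_error_def ap_bound_def algebra_simps abs_le_iff)
qed

definition ap_partial :: "nat \<Rightarrow> complex \<Rightarrow> complex" where
  "ap_partial N z = (\<Sum>n\<in>{1..<N}. of_real (ap_error n) * power_diff_quot n z)"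

text \<open>Zeta enters as the L-function of the character modulo 1. Both the character sum and zeta
  have a simple pole with residue 1 at 1; the poles are removed separately, in the first by using
  \<open>Lhol\<close>, in the second by subtracting 1 from \<open>Lreg\<close>, with the derivative
  as the value at 1.\<close>

definition ap_limit :: "complex \<Rightarrow> complex" where
  "ap_limit s = ((\<Sum>\<chi> | dirichlet_char q \<chi>. cnj (\<chi> a) * (- deriv (Lhol q \<chi>) s / Lhol q \<chi> s)) -
     (if s = 1 then deriv (Lreg 1 (principal_char 1)) 1 else (Lreg 1 (principal_char 1) s - 1) / (s - 1))) / s"

lemma ap_error_diff:
  "of_real (ap_error (Suc n) - ap_error n) =
     (\<Sum>\<chi> | dirichlet_char q \<chi>. cnj (\<chi> a) * (mangoldt (Suc n) * \<chi> (Suc n))) - (1 :: complex)"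
proof -
  have "(\<Sum>\<chi> | dirichlet_char q \<chi>. cnj (\<chi> a) * (mangoldt (Suc n) * \<chi> (Suc n))) =
      mangoldt (Suc n) * (\<Sum>\<chi> | dirichlet_char q \<chi>. cnj (\<chi> a) * \<chi> (Suc n))"
    by (simp add: sum_distrib_left mult_ac)
  also have "\<dots> = of_real (real (totient q) * (if [Suc n = a] (mod q) then mangoldt (Suc n) else 0))"
    unfolding dirichlet_char_orthogonality[OF q a] by simp
  also have "real (totient q) * (if [Suc n = a] (mod q) then mangoldt (Suc n) else 0) =
      ap_error (Suc n) - ap_error n + 1"
    by (simp add: ap_error_def psi_ap_def algebra_simps)
  finally show ?thesis by simp
qed

lemma ap_partial_tendsto:
  assumes z: "Re z > 0"
  shows "(\<lambda>N. ap_partial (Suc N) z) \<longlonglongrightarrow> ap_limit (1 + z)"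
proof -
  define s where "s = 1 + z"
  have s: "Re s > 1" "s \<noteq> 0" "s \<noteq> 1" using z by (auto simp: s_def complex_eq_iff)
  have z1: "z \<noteq> -1" using z by auto
  let ?X = "{\<chi>. dirichlet_char q \<chi>}"
  let ?pw = "\<lambda>n. of_nat n powr (- s) :: complex"
  have p1: "dirichlet_char 1 (principal_char 1)" by (rule dirichlet_char_principal)
  have zeta: "(\<lambda>n. ?pw (Suc n)) sums Lseries (principal_char 1) s"
    using Lseries_sums[of "principal_char 1" s, OF norm_dirichlet_char_le[OF p1]] s
    by (simp add: principal_char_def)
  have "(\<lambda>n. \<Sum>\<chi>\<in>?X. cnj (\<chi> a) * (mangoldt (Suc n) * \<chi> (Suc n) * ?pw (Suc n))) sums
      (\<Sum>\<chi>\<in>?X. cnj (\<chi> a) * vonMangoldt_series \<chi> s)"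
    by (intro sums_sum sums_mult vonMangoldt_series_sums) (use q s in auto)
  from sums_diff[OF this zeta]
  have "(\<lambda>n. of_real (ap_error (Suc n) - ap_error n) * ?pw (Suc n)) sums
      ((\<Sum>\<chi>\<in>?X. cnj (\<chi> a) * vonMangoldt_series \<chi> s) - Lseries (principal_char 1) s)"
    unfolding ap_error_diff by (simp add: left_diff_distrib sum_distrib_right mult.assoc)
  also have "(\<Sum>\<chi>\<in>?X. cnj (\<chi> a) * vonMangoldt_series \<chi> s) =
      (\<Sum>\<chi>\<in>?X. cnj (\<chi> a) * (- deriv (Lhol q \<chi>) s / Lhol q \<chi> s)) + 1 / (s - 1)"
  proof -
    have "(\<Sum>\<chi>\<in>?X. cnj (\<chi> a) * vonMangoldt_series \<chi> s) =
      (\<Sum>\<chi>\<in>?X. (if \<chi> = principal_char q then cnj (\<chi> a) / (s - 1) else 0) +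
         cnj (\<chi> a) * (- deriv (Lhol q \<chi>) s / Lhol q \<chi> s))"
      by (intro sum.cong refl) (use q s in \<open>auto simp: vonMangoldt_series_eq algebra_simps\<close>)
    also have "\<dots> = (\<Sum>\<chi>\<in>?X. if \<chi> = principal_char q then cnj (\<chi> a) / (s - 1) else 0) +
        (\<Sum>\<chi>\<in>?X. cnj (\<chi> a) * (- deriv (Lhol q \<chi>) s / Lhol q \<chi> s))"
      by (rule sum.distrib)
    also have "(\<Sum>\<chi>\<in>?X. if \<chi> = principal_char q then cnj (\<chi> a) / (s - 1) else 0) = 1 / (s - 1)"
      using finite_dirichlet_chars[OF q] dirichlet_char_principal[of q] a
      by (simp add: sum.delta principal_char_def)
    finally show ?thesis by simp
  qed
  also have "Lseries (principal_char 1) s = Lreg 1 (principal_char 1) s / (s - 1)"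
    using Lreg_eq[OF p1 _ s(1)] s by simp
  also have "(\<Sum>\<chi>\<in>?X. cnj (\<chi> a) * (- deriv (Lhol q \<chi>) s / Lhol q \<chi> s)) + 1 / (s - 1) -
      Lreg 1 (principal_char 1) s / (s - 1) = s * ap_limit s"
  proof -
    have "s * ap_limit s = (\<Sum>\<chi>\<in>?X. cnj (\<chi> a) * (- deriv (Lhol q \<chi>) s / Lhol q \<chi> s)) -
        (Lreg 1 (principal_char 1) s - 1) / (s - 1)"
      using s by (simp add: ap_limit_def)
    then show ?thesis by (simp add: diff_divide_distrib)
  qed
  finally have sums: "(\<lambda>n. of_real (ap_error (Suc n) - ap_error n) * ?pw (Suc n)) sums (s * ap_limit s)" .
  have "(\<lambda>N. of_real (ap_error N) * ?pw (Suc N)) \<longlonglongrightarrow> 0"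
  proof (rule Lim_null_comparison)
    show "eventually (\<lambda>N. norm (of_real (ap_error N) * ?pw (Suc N)) \<le> ap_bound * real (Suc N) powr (- Re z)) sequentially"
    proof (intro always_eventually allI)
      fix N
      have "norm (of_real (ap_error N) * ?pw (Suc N)) = \<bar>ap_error N\<bar> * real (Suc N) powr (- Re s)"
        by (simp only: norm_mult norm_of_real norm_of_nat_powr) simp
      also have "\<dots> \<le> (ap_bound * real (Suc N)) * real (Suc N) powr (- Re s)"
      proof (rule mult_right_mono)
        have "ap_bound * real N \<le> ap_bound * real (Suc N)"
          by (intro mult_left_mono) (auto simp: ap_bound_def)
        then show "\<bar>ap_error N\<bar> \<le> ap_bound * real (Suc N)" using ap_error_bound[of N] by linarith
      qed simp
      also have "\<dots> = ap_bound * real (Suc N) powr (- Re z)"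
        by (simp add: s_def powr_diff powr_minus divide_simps del: of_nat_Suc)
      finally show "norm (of_real (ap_error N) * ?pw (Suc N)) \<le> ap_bound * real (Suc N) powr (- Re z)" .
    qed
    have "(\<lambda>N. real (Suc N) powr (- Re z)) \<longlonglongrightarrow> 0"
      using z by (intro LIMSEQ_Suc[of "\<lambda>N. real N powr (- Re z)"] tendsto_neg_powr filterlim_real_sequentially) auto
    then show "(\<lambda>N. ap_bound * real (Suc N) powr (- Re z)) \<longlonglongrightarrow> 0"
      by (rule tendsto_mult_right_zero)
  qed
  from tendsto_diff[OF sums[unfolded sums_def] this]
  have "(\<lambda>N. \<Sum>n\<in>{1..<Suc N}. of_real (ap_error n) * (?pw n - ?pw (Suc n))) \<longlonglongrightarrow> s * ap_limit s"
    using sum_by_parts_powr[of "\<lambda>n. of_real (ap_error n)" ?pw]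
    by (simp add: ap_error_def psi_ap_def)
  then have "(\<lambda>N. (\<Sum>n\<in>{1..<Suc N}. of_real (ap_error n) * (?pw n - ?pw (Suc n))) / s) \<longlonglongrightarrow> s * ap_limit s / s"
    using s by (intro tendsto_divide tendsto_const)
  moreover have "(\<Sum>n\<in>{1..<Suc N}. of_real (ap_error n) * (?pw n - ?pw (Suc n))) / s = ap_partial (Suc N) z" for N
  proof -
    have "- s = -1 - z" by (simp add: s_def)
    then show ?thesis
      using z1 by (simp add: ap_partial_def power_diff_quot_def sum_divide_distrib s_def add.commute del: sum.op_ivl_Suc)
  qed
  ultimately show ?thesis using s by (simp add: s_def)
qed

text \<open>One estimate for both half-planes of Newman's theorem: for \<open>Re z > 0\<close> let
  \<open>M\<close> tend to infinity, for \<open>Re z < 0\<close> take the lower end to be 1, where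
  the partial sum is empty.\<close>

lemma ap_partial_diff_bound:
  assumes z: "Re z \<noteq> 0" and NM: "1 \<le> N" "N \<le> M"
  shows "norm (ap_partial M z - ap_partial N z) \<le> ap_bound * ((real N powr (- Re z) - real M powr (- Re z)) / Re z)"
proof -
  have B: "ap_bound \<ge> 0" by (simp add: ap_bound_def)
  have "ap_partial M z - ap_partial N z = (\<Sum>n\<in>{N..<M}. of_real (ap_error n) * power_diff_quot n z)"
    using sum.atLeastLessThan_concat[OF NM, of "\<lambda>n. of_real (ap_error n) * power_diff_quot n z"]
    by (simp add: ap_partial_def algebra_simps)
  also have "norm \<dots> \<le> (\<Sum>n\<in>{N..<M}. ap_bound * ((real n powr (- Re z) - real (Suc n) powr (- Re z)) / Re z))"
  proof (rule sum_norm_le)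
    fix n assume "n \<in> {N..<M}"
    then have n: "n > 0" using NM by simp
    have "norm (of_real (ap_error n) * power_diff_quot n z) \<le> (ap_bound * real n) * norm (power_diff_quot n z)"
      unfolding norm_mult norm_of_real real_norm_def by (intro mult_right_mono ap_error_bound) auto
    also have "\<dots> = ap_bound * (real n * norm (power_diff_quot n z))" by simp
    also have "\<dots> \<le> ap_bound * ((real n powr (- Re z) - real (Suc n) powr (- Re z)) / Re z)"
      by (intro mult_left_mono norm_power_diff_quot n z B)
    finally show "norm (of_real (ap_error n) * power_diff_quot n z) \<le>
        ap_bound * ((real n powr (- Re z) - real (Suc n) powr (- Re z)) / Re z)" .
  qed
  also have "\<dots> = ap_bound * ((real N powr (- Re z) - real M powr (- Re z)) / Re z)"
    unfolding sum_distrib_left[symmetric] sum_power_diff_telescope[OF NM(2)] ..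
  finally show ?thesis .
qed

lemma ap_partial_converges: "(\<lambda>N. ap_partial N 0) \<longlonglongrightarrow> ap_limit (1 + 0)"
proof (rule newman_tauberian[where F = "\<lambda>z. ap_limit (1 + z)" and C = ap_bound])
  let ?X = "{\<chi>. dirichlet_char q \<chi>}"
  let ?H = "{s. Re s > 0}"
  \<comment> \<open>Open because there are only finitely many characters; it contains the closed
    half-plane Re s >= 1 by non-vanishing.\<close>
  define U' where "U' = {s. Re s > 0} \<inter> (\<Inter>\<chi>\<in>?X. {s \<in> ?H. Lhol q \<chi> s \<noteq> 0})"
  define U where "U = (\<lambda>z. 1 + z) -` U'"
  have B: "ap_bound \<ge> 0" by (simp add: ap_bound_def)
  have op: "open U'"
  proof -
    have "open {s \<in> ?H. Lhol q \<chi> s \<noteq> 0}" if "dirichlet_char q \<chi>" for \<chi>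
    proof -
      have "continuous_on ?H (Lhol q \<chi>)"
        by (intro holomorphic_on_imp_continuous_on holomorphic_Lhol that q)
      then have "open (?H \<inter> Lhol q \<chi> -` (- {0}))"
        by (rule continuous_open_preimage) (auto simp: open_Re_gt)
      moreover have "{s \<in> ?H. Lhol q \<chi> s \<noteq> 0} = ?H \<inter> Lhol q \<chi> -` (- {0})" by auto
      ultimately show ?thesis by simp
    qed
    then show ?thesis unfolding U'_def
      using finite_dirichlet_chars[OF q] by (intro open_Int open_Re_gt open_INT) auto
  qed
  show "open U" unfolding U_def
    by (intro open_vimage op continuous_intros)
  show "{z. 0 \<le> Re z} \<subseteq> U"
    using Lhol_nonzero_closed[OF _ q] by (auto simp: U_def U'_def)
  have "(\<lambda>s. ap_limit s) holomorphic_on U'"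
    unfolding ap_limit_def
  proof (intro holomorphic_on_divide holomorphic_on_diff holomorphic_on_sum holomorphic_on_mult holomorphic_on_const
      holomorphic_on_minus holomorphic_on_ident)
    fix \<chi> assume "\<chi> \<in> ?X"
    then have \<chi>: "dirichlet_char q \<chi>" by simp
    have sub: "U' \<subseteq> ?H" by (auto simp: U'_def)
    show "Lhol q \<chi> holomorphic_on U'"
      using holomorphic_Lhol[OF \<chi> q] sub by (rule holomorphic_on_subset)
    show "deriv (Lhol q \<chi>) holomorphic_on U'"
      using holomorphic_deriv[OF holomorphic_Lhol[OF \<chi> q] open_Re_gt] sub by (rule holomorphic_on_subset)
    show "Lhol q \<chi> s \<noteq> 0" if "s \<in> U'" for s using that \<chi> by (auto simp: U'_def)
  next
    have p1: "dirichlet_char 1 (principal_char 1)" by (rule dirichlet_char_principal)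
    have "Lreg 1 (principal_char 1) 1 = 1" using Lreg_1[OF p1] by simp
    moreover have "(\<lambda>s. if s = 1 then deriv (Lreg 1 (principal_char 1)) 1 else
        (Lreg 1 (principal_char 1) s - Lreg 1 (principal_char 1) 1) / (s - 1)) holomorphic_on ?H"
      by (rule pole_lemma_open[OF holomorphic_Lreg[OF norm_dirichlet_char_le[OF p1]] open_Re_gt]) auto
    ultimately have "(\<lambda>s. if s = 1 then deriv (Lreg 1 (principal_char 1)) 1 else
        (Lreg 1 (principal_char 1) s - 1) / (s - 1)) holomorphic_on ?H" by (simp only:)
    then show "(\<lambda>s. if s = 1 then deriv (Lreg 1 (principal_char 1)) 1 else
        (Lreg 1 (principal_char 1) s - 1) / (s - 1)) holomorphic_on U'"
      by (rule holomorphic_on_subset) (auto simp: U'_def)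
  next
    show "s \<noteq> 0" if "s \<in> U'" for s using that by (auto simp: U'_def)
  qed
  then have "(ap_limit \<circ> (\<lambda>z. 1 + z)) holomorphic_on U"
    by (intro holomorphic_on_compose_gen[where t = U'] holomorphic_intros) (auto simp: U_def)
  then show "(\<lambda>z. ap_limit (1 + z)) holomorphic_on U" by (simp add: o_def)
  show "ap_partial N holomorphic_on UNIV" for N
    unfolding ap_partial_def by (intro holomorphic_on_sum holomorphic_on_mult holomorphic_on_const holomorphic_power_diff_quot) auto
  show "norm (ap_limit (1 + z) - ap_partial N z) \<le> ap_bound * real N powr (- Re z) / Re z"
    if N: "1 \<le> N" and z: "0 < Re z" for N z
  proof (rule tendsto_upperbound)
    have "(\<lambda>M. ap_partial M z) \<longlonglongrightarrow> ap_limit (1 + z)"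
      using ap_partial_tendsto[OF z] by (rule LIMSEQ_imp_Suc)
    then show "(\<lambda>M. norm (ap_partial M z - ap_partial N z)) \<longlonglongrightarrow> norm (ap_limit (1 + z) - ap_partial N z)"
      by (intro tendsto_intros)
    show "eventually (\<lambda>M. norm (ap_partial M z - ap_partial N z) \<le> ap_bound * real N powr (- Re z) / Re z) sequentially"
      using eventually_ge_at_top[of N]
    proof eventually_elim
      case (elim M)
      have "norm (ap_partial M z - ap_partial N z) \<le> ap_bound * ((real N powr (- Re z) - real M powr (- Re z)) / Re z)"
        using z by (intro ap_partial_diff_bound N elim) auto
      also have "\<dots> \<le> ap_bound * (real N powr (- Re z) / Re z)"
        using z B by (intro mult_left_mono divide_right_mono) auto
      finally show ?case by simp
    qed
  qed auto
  show "norm (ap_partial N z) \<le> ap_bound * real N powr (- Re z) / - Re z"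
    if N: "1 \<le> N" and z: "Re z < 0" for N z
  proof -
    have "norm (ap_partial N z - ap_partial 1 z) \<le> ap_bound * ((real 1 powr (- Re z) - real N powr (- Re z)) / Re z)"
      using z by (intro ap_partial_diff_bound N) auto
    also have "\<dots> = ap_bound * ((real N powr (- Re z) - 1) / - Re z)" using z by (simp add: field_simps)
    also have "\<dots> \<le> ap_bound * (real N powr (- Re z) / - Re z)"
      using z B by (intro mult_left_mono divide_right_mono) auto
    finally show ?thesis by (simp add: ap_partial_def)
  qed
qed

lemma psi_ap_asymptotic: "(\<lambda>n. psi_ap q a n / real n) \<longlonglongrightarrow> 1 / real (totient q)"
proof -
  let ?A = "\<lambda>n. real (totient q) * psi_ap q a n"
  have phi: "real (totient q) > 0" using q by simp
  have "(\<lambda>n. ?A n / real n) \<longlonglongrightarrow> 1"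
  proof (rule monotone_average_tendsto)
    have "psi_ap q a m \<le> psi_ap q a n" if "m \<le> n" for m n
      unfolding psi_ap_def using that by (intro sum_mono2) (auto simp: mangoldt_nonneg)
    then show "mono ?A" by (intro monoI mult_left_mono) auto
    have "Re (ap_partial N 0) = (\<Sum>n\<in>{1..<N}. (?A n - real n) / (real n * (real n + 1)))" for N
    proof -
      have "of_real (ap_error n) * power_diff_quot n 0 = of_real ((?A n - real n) / (real n * (real n + 1)))"
        if "n \<in> {1..<N}" for n
      proof -
        have "power_diff_quot n 0 = of_real (1 / real n - 1 / real (Suc n))"
          by (simp add: power_diff_quot_def powr_minus_divide del: of_nat_Suc) 
        also have "1 / real n - 1 / real (Suc n) = 1 / (real n * (real n + 1))"
          using that by (simp add: field_simps)
        finally show ?thesis by (simp add: ap_error_def)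
      qed
      then have "ap_partial N 0 = of_real (\<Sum>n\<in>{1..<N}. (?A n - real n) / (real n * (real n + 1)))"
        unfolding ap_partial_def of_real_sum by (intro sum.cong refl)
      then show ?thesis by simp
    qed
    then show "convergent (\<lambda>N. \<Sum>n\<in>{1..<N}. (?A n - real n) / (real n * (real n + 1)))"
      using tendsto_Re[OF ap_partial_converges] unfolding convergent_def by (intro exI) (simp only:)
  qed
  then have "(\<lambda>n. ?A n / real n / real (totient q)) \<longlonglongrightarrow> 1 / real (totient q)"
    using phi by (intro tendsto_divide tendsto_const) auto
  then show ?thesis using phi by simp
qed

theorem theta_ap_asymptotic: "(\<lambda>n. theta_ap q a n / real n) \<longlonglongrightarrow> 1 / real (totient q)"
proof (rule tendsto_sandwich)
  let ?e = "\<lambda>n. sqrt (real n) * log 2 (real n) * ln (real n) / real n"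
  have "?e \<longlonglongrightarrow> 0" by real_asymp
  from tendsto_diff[OF psi_ap_asymptotic this]
  show "(\<lambda>n. psi_ap q a n / real n - ?e n) \<longlonglongrightarrow> 1 / real (totient q)" by simp
  show "eventually (\<lambda>n. psi_ap q a n / real n - ?e n \<le> theta_ap q a n / real n) sequentially"
    using eventually_gt_at_top[of 0]
  proof eventually_elim
    case (elim n)
    have "(psi_ap q a n - sqrt (real n) * log 2 (real n) * ln (real n)) / real n \<le> theta_ap q a n / real n"
      using psi_ap_theta_ap(2)[OF elim, of q a] by (intro divide_right_mono) auto
    then show ?case by (simp add: diff_divide_distrib)
  qed
  show "eventually (\<lambda>n. theta_ap q a n / real n \<le> psi_ap q a n / real n) sequentially"
    using eventually_gt_at_top[of 0]
    by eventually_elim (intro divide_right_mono psi_ap_theta_ap, auto)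
qed (rule psi_ap_asymptotic)

end

section \<open>The least common multiple of a product of linear polynomials\<close>

text \<open>The multiplicity of a prime in an lcm is the maximum of the multiplicities; excluding 0
  keeps the lcm nonzero, so that multiplicities decide divisibility.\<close>

lemma prime_power_dvd_Lcm_iff:
  fixes A :: "nat set"
  assumes "finite A" "0 \<notin> A" "prime p" "e > 0"
  shows "p ^ e dvd Lcm A \<longleftrightarrow> (\<exists>x\<in>A. p ^ e dvd x)"
  using assms(1,2)
proof (induction A rule: finite_induct)
  case empty
  have "p ^ e > 1" using prime_gt_1_nat[OF assms(3)] assms(4) by (rule one_less_power)
  then show ?case using assms(4) prime_gt_1_nat[OF assms(3)] by simp
next
  case (insert x A)
  have L: "Lcm A \<noteq> 0" using insert by (simp add: Lcm_0_iff)
  have nu: "\<not> is_unit p" using assms(3) by auto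
  have "p ^ e dvd lcm x (Lcm A) \<longleftrightarrow> p ^ e dvd x \<or> p ^ e dvd Lcm A"
    using insert.prems L nu assms(3)
    by (simp add: power_dvd_iff_le_multiplicity multiplicity_lcm le_max_iff_disj)
  then show ?case using insert by simp
qed

lemma ln_eq_sum_multiplicity:
  fixes N X :: nat
  assumes N: "N > 0" and X: "\<And>p. prime p \<Longrightarrow> p dvd N \<Longrightarrow> p \<le> X"
  shows "ln (real N) = (\<Sum>p | prime p \<and> p \<le> X. real (multiplicity p N) * ln (real p))"
proof -
  have "real N = (\<Prod>p\<in>prime_factors N. real p ^ multiplicity p N)"
    by (subst prime_factorization_nat[OF N]) simp
  then have "ln (real N) = (\<Sum>p\<in>prime_factors N. ln (real p ^ multiplicity p N))"
    by (simp only:) (rule ln_prod, auto dest: in_prime_factors_imp_prime prime_gt_0_nat)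
  also have "\<dots> = (\<Sum>p\<in>prime_factors N. real (multiplicity p N) * ln (real p))"
    by (intro sum.cong refl) (auto dest!: in_prime_factors_imp_prime prime_gt_0_nat simp: ln_realpow)
  also have "\<dots> = (\<Sum>p | prime p \<and> p \<le> X. real (multiplicity p N) * ln (real p))"
    by (rule sum.mono_neutral_left)
      (use N X in \<open>auto simp: prime_factors_dvd not_dvd_imp_multiplicity_0\<close>)
  finally show ?thesis .
qed

lemma card_prime_square_le:
  "real (card {p. prime p \<and> p * p \<le> Y}) \<le> sqrt (real Y)"
proof -
  have "{p. prime p \<and> p * p \<le> Y} \<subseteq> {1..nat \<lfloor>sqrt (real Y)\<rfloor>}"
  proof
    fix p assume "p \<in> {p. prime p \<and> p * p \<le> Y}"
    then have p: "prime p" "p * p \<le> Y" by auto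
    have "real (p * p) \<le> real Y" using p(2) by (rule of_nat_mono)
    then have "real p \<le> sqrt (real Y)" by (intro real_le_rsqrt) (simp add: power2_eq_square)
    then show "p \<in> {1..nat \<lfloor>sqrt (real Y)\<rfloor>}"
      using prime_ge_1_nat[OF p(1)] by (simp add: le_nat_floor)
  qed
  then have "card {p. prime p \<and> p * p \<le> Y} \<le> nat \<lfloor>sqrt (real Y)\<rfloor>"
    using card_mono[of "{1..nat \<lfloor>sqrt (real Y)\<rfloor>}"] by fastforce
  then have "real (card {p. prime p \<and> p * p \<le> Y}) \<le> real (nat \<lfloor>sqrt (real Y)\<rfloor>)" by (rule of_nat_mono)
  also have "\<dots> \<le> sqrt (real Y)" by (intro of_nat_floor) simp
  finally show ?thesis .
qed

lemma tendsto_Max_image: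
  fixes f :: "'i \<Rightarrow> 'a \<Rightarrow> real"
  assumes "finite A" "A \<noteq> {}" "\<And>j. j \<in> A \<Longrightarrow> (f j \<longlongrightarrow> l j) F"
  shows "((\<lambda>x. Max ((\<lambda>j. f j x) ` A)) \<longlongrightarrow> Max (l ` A)) F"
  using assms
proof (induction A rule: finite_ne_induct)
  case (insert y A)
  then have "((\<lambda>x. max (f y x) (Max ((\<lambda>j. f j x) ` A))) \<longlongrightarrow> max (l y) (Max (l ` A))) F"
    by (intro tendsto_max) auto
  then show ?case using insert by simp
qed simp

lemma least_pos_res_props:
  assumes "a > 0"
  shows "least_pos_res a b > 0" "[least_pos_res a b = b] (mod a)"
    and least_pos_res_le: "c > 0 \<Longrightarrow> [c = b] (mod a) \<Longrightarrow> least_pos_res a b \<le> c"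
proof -
  have "[b + a = b] (mod a)" unfolding Cong.cong_def by (rule mod_add_self2)
  then have "b + a > 0 \<and> [b + a = b] (mod a)" using assms by blast
  then have "least_pos_res a b > 0 \<and> [least_pos_res a b = b] (mod a)"
    unfolding least_pos_res_def by (rule LeastI)
  then show "least_pos_res a b > 0" "[least_pos_res a b = b] (mod a)" by auto
  show "least_pos_res a b \<le> c" if "c > 0" "[c = b] (mod a)"
    unfolding least_pos_res_def using that by (intro Least_le) auto
qed

lemma div_over_tendsto:
  assumes "c > 0"
  shows "(\<lambda>n. real ((a * n + b) div c) / real n) \<longlonglongrightarrow> real a / real c"
proof (rule tendsto_sandwich)
  show "(\<lambda>n. ((real a * real n + real b) / real c - 1) / real n) \<longlonglongrightarrow> real a / real c"
    using assms by (real_asymp simp: divide_inverse)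
  show "(\<lambda>n. (real a * real n + real b) / real c / real n) \<longlonglongrightarrow> real a / real c"
    using assms by (real_asymp simp: divide_inverse)
  show "\<forall>\<^sub>F n in sequentially. ((real a * real n + real b) / real c - 1) / real n \<le> real ((a * n + b) div c) / real n"
  proof (intro always_eventually allI divide_right_mono)
    show "(real a * real n + real b) / real c - 1 \<le> real ((a * n + b) div c)" for n
      using real_of_int_floor_gt_diff_one[of "real (a * n + b) / real c"]
      by (simp add: floor_divide_of_nat_eq del: of_nat_add of_nat_mult) simp
  qed simp
  show "\<forall>\<^sub>F n in sequentially. real ((a * n + b) div c) / real n \<le> (real a * real n + real b) / real c / real n"
  proof (intro always_eventually allI divide_right_mono)
    show "real ((a * n + b) div c) \<le> (real a * real n + real b) / real c" for n
      using of_int_floor_le[of "real (a * n + b) / real c"]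
      by (simp add: floor_divide_of_nat_eq del: of_nat_add of_nat_mult) simp
  qed simp
qed

lemma sqrt_ln_over_tendsto:
  fixes c K :: real
  assumes "c > 0"
  shows "(\<lambda>n::nat. K * (sqrt (c * real n) * ln (c * real n)) / real n) \<longlonglongrightarrow> 0"
  using assms by real_asymp

text \<open>Since \<open>l\<close> is positive, \<open>X n\<close> tends to infinity and the prime
  number theorem can be applied along it.\<close>

lemma theta_ap_compose:
  fixes X :: "nat \<Rightarrow> nat"
  assumes q: "q > 0" "coprime s q" and X: "(\<lambda>n. real (X n) / real n) \<longlonglongrightarrow> l" and l: "l > 0"
  shows "(\<lambda>n. theta_ap q s (X n) / real n) \<longlonglongrightarrow> l / real (totient q)"
proof -
  have "filterlim (\<lambda>n. real (X n) / real n * real n) at_top sequentially"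
    by (rule filterlim_tendsto_pos_mult_at_top[OF X l filterlim_real_sequentially])
  then have "filterlim (\<lambda>n. real (X n)) at_top sequentially"
    by (rule filterlim_mono_eventually[OF _ order_refl order_refl])
      (use eventually_gt_at_top[of 0] in eventually_elim, simp)
  then have top: "filterlim X at_top sequentially" by (simp add: filterlim_sequentially_iff_filterlim_real)
  have "(\<lambda>n. theta_ap q s (X n) / real (X n)) \<longlonglongrightarrow> 1 / real (totient q)"
    by (rule filterlim_compose[OF theta_ap_asymptotic[OF q] top])
  from tendsto_mult[OF this X]
  have "(\<lambda>n. theta_ap q s (X n) / real (X n) * (real (X n) / real n)) \<longlonglongrightarrow> l / real (totient q)" by simp
  moreover have "eventually (\<lambda>n. theta_ap q s (X n) / real (X n) * (real (X n) / real n) = theta_ap q s (X n) / real n) sequentially"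
    using top[unfolded filterlim_at_top, rule_format, of 1] by eventually_elim auto
  ultimately show ?thesis by (rule Lim_transform_eventually)
qed

section \<open>Exponents of primes in the least common multiple\<close>

locale linear_factors =
  fixes k :: nat and t d a b :: "nat \<Rightarrow> nat"
  assumes k: "k \<ge> 1" and t0: "t 0 = 0" and t_less: "\<And>i. i < k \<Longrightarrow> t i < t (Suc i)"
    and d_pos: "\<And>j. 1 \<le> j \<Longrightarrow> j \<le> t k \<Longrightarrow> d j > 0"
    and d_block: "\<And>i j. 1 \<le> i \<Longrightarrow> i \<le> k \<Longrightarrow> t (i - 1) + 1 \<le> j \<Longrightarrow> j \<le> t i \<Longrightarrow> d j = d (t i)"
    and d_dec: "\<And>i. 1 \<le> i \<Longrightarrow> i < k \<Longrightarrow> d (t i) > d (t (Suc i))"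
    and a_pos: "\<And>j. 1 \<le> j \<Longrightarrow> j \<le> t k \<Longrightarrow> a j > 0"
    and b_pos: "\<And>j. 1 \<le> j \<Longrightarrow> j \<le> t k \<Longrightarrow> b j > 0"
    and ab_distinct: "\<And>j1 j2. 1 \<le> j1 \<Longrightarrow> j1 \<le> t k \<Longrightarrow> 1 \<le> j2 \<Longrightarrow> j2 \<le> t k \<Longrightarrow>
        j1 \<noteq> j2 \<Longrightarrow> a j1 * b j2 \<noteq> a j2 * b j1"
begin

definition f :: "nat \<Rightarrow> nat" where
  "f x = (\<Prod>i\<in>{1..k}. \<Prod>j\<in>{t (i - 1) + 1..t i}. (a j * x + b j) ^ d j)"

definition q :: nat where "q = Lcm (a ` {1..t k})"

text \<open>The case split encodes the convention that the exponent after the last block is 0, as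
  \<open>t\<close> is meaningful only up to \<open>k\<close>.\<close>

definition dd :: "nat \<Rightarrow> real" where "dd i = (if i \<le> k then real (d (t i)) else 0)"

text \<open>A common bound for all \<open>a j + b j\<close>: values of the factors up to n are at
  most \<open>C * n\<close>, and cross products \<open>a j * b j'\<close> are at most
  \<open>C * C\<close>.\<close>

definition C :: nat where "C = (\<Sum>j\<in>{1..t k}. a j + b j)"

definition D :: nat where "D = (\<Sum>j\<in>{1..t k}. d j)"

definition hits :: "nat \<Rightarrow> nat \<Rightarrow> nat \<Rightarrow> bool" where
  "hits n p j \<longleftrightarrow> (\<exists>m\<in>{1..n}. p dvd a j * m + b j)"

text \<open>The threshold of layer \<open>i\<close>: a prime \<open>p > C\<close> with
  \<open>p * r\<close> congruent to 1 modulo \<open>q\<close> divides a value, at some m from 1 to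
  n, of one of the first \<open>t i\<close> factors exactly when
  \<open>p \<le> X i r n\<close>.\<close>

definition X :: "nat \<Rightarrow> nat \<Rightarrow> nat \<Rightarrow> nat" where
  "X i r n = Max ((\<lambda>j. (a j * n + b j) div least_pos_res (a j) (b j * r)) ` {1..t i})"

lemma t_mono: "i \<le> i' \<Longrightarrow> i' \<le> k \<Longrightarrow> t i \<le> t i'"
proof (induction i' rule: dec_induct)
  case (step m)
  then show ?case using t_less[of m] by simp
qed simp

lemma t_pos: "1 \<le> i \<Longrightarrow> i \<le> k \<Longrightarrow> 1 \<le> t i"
  using t_mono[of 1 i] t_less[of 0] t0 k by simp

lemma d_t_mono:
  assumes "1 \<le> i" "i \<le> i'" "i' \<le> k"
  shows "d (t i') \<le> d (t i)"
  using assms(2,3)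
proof (induction i' rule: dec_induct)
  case (step m)
  then show ?case using d_dec[of m] assms(1) by simp
qed simp

lemma ex_block:
  assumes "j \<in> {1..t i}" "i \<le> k"
  shows "\<exists>i'\<in>{1..i}. t (i' - 1) + 1 \<le> j \<and> j \<le> t i'"
  using assms
proof (induction i)
  case 0
  then show ?case using t0 by simp
next
  case (Suc i)
  show ?case
  proof (cases "j \<le> t i")
    case True
    then obtain i' where "i' \<in> {1..i}" "t (i' - 1) + 1 \<le> j \<and> j \<le> t i'"
      using Suc.IH Suc.prems by auto
    then show ?thesis by (intro bexI[of _ i']) auto
  next
    case False
    then show ?thesis using Suc.prems by (intro bexI[of _ "Suc i"]) auto
  qed
qed

lemma f_eq: "f x = (\<Prod>j\<in>{1..t k}. (a j * x + b j) ^ d j)"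
proof -
  have "(\<Prod>i\<in>{1..k'}. \<Prod>j\<in>{t (i - 1) + 1..t i}. g j) = (\<Prod>j\<in>{1..t k'}. g j)" if "k' \<le> k" for k' and g :: "nat \<Rightarrow> nat"
    using that
  proof (induction k')
    case (Suc m)
    have "{1..t (Suc m)} = {1..t m} \<union> {t m + 1..t (Suc m)}"
      using t_mono[of m "Suc m"] Suc.prems by auto
    then have "(\<Prod>j\<in>{1..t (Suc m)}. g j) = (\<Prod>j\<in>{1..t m}. g j) * (\<Prod>j\<in>{t m + 1..t (Suc m)}. g j)"
      by (simp add: prod.union_disjoint)
    then show ?case using Suc by simp
  qed (simp add: t0)
  then show ?thesis by (simp add: f_def)
qed

lemma linear_pos: "j \<in> {1..t k} \<Longrightarrow> a j * x + b j > 0"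
  using b_pos[of j] by simp

lemma f_pos: "f x > 0"
  unfolding f_eq by (intro prod_pos) (use linear_pos in auto)

lemma ab_le_C: "j \<in> {1..t k} \<Longrightarrow> a j + b j \<le> C"
  unfolding C_def by (rule member_le_sum) auto

lemma C_ge: "C \<ge> 2"
  using ab_le_C[of 1] a_pos[of 1] b_pos[of 1] t_pos[of k] k by simp

lemma linear_le:
  assumes "j \<in> {1..t k}" "1 \<le> m" "m \<le> n"
  shows "a j * m + b j \<le> C * n"
proof -
  have "a j * m + b j \<le> a j * n + b j * n"
    using assms by (intro add_mono mult_le_mono) auto
  also have "\<dots> = (a j + b j) * n" by (simp add: algebra_simps)
  also have "\<dots> \<le> C * n" using ab_le_C[OF assms(1)] by simp
  finally show ?thesis .
qed

lemma f_le:
  assumes "1 \<le> m" "m \<le> n"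
  shows "f m \<le> (C * n) ^ D"
proof -
  have "f m \<le> (\<Prod>j\<in>{1..t k}. (C * n) ^ d j)"
    unfolding f_eq using linear_le assms by (intro prod_mono) (auto intro: power_mono)
  also have "\<dots> = (C * n) ^ D" unfolding D_def by (simp add: power_sum)
  finally show ?thesis .
qed

lemma q_pos: "q > 0"
proof -
  have "Lcm (a ` {1..t k}) \<noteq> 0" using a_pos by (subst Lcm_0_iff) force+
  then show ?thesis unfolding q_def by (simp only: neq0_conv)
qed

lemma a_dvd_q: "j \<in> {1..t k} \<Longrightarrow> a j dvd q"
  unfolding q_def by (rule dvd_Lcm) simp

lemma coprime_q:
  assumes "prime p" "p > C"
  shows "coprime p q"
proof -
  have "q dvd (\<Prod>j\<in>{1..t k}. a j)" unfolding q_def by (rule Lcm_least) auto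
  moreover have "coprime p (\<Prod>j\<in>{1..t k}. a j)"
  proof (rule prod_coprime_right)
    fix j assume j: "j \<in> {1..t k}"
    then have "a j < p" "a j > 0" using ab_le_C[OF j] assms(2) a_pos[of j] by auto
    then have "\<not> p dvd a j" using nat_dvd_not_less by blast
    then show "coprime p (a j)" using prime_imp_coprime[OF assms(1)] by blast
  qed
  ultimately show ?thesis using coprime_divisors[OF dvd_refl] by blast
qed

text \<open>Eliminating \<open>m\<close> shows that \<open>p\<close> divides the determinant
  \<open>a j * b j' - a j' * b j\<close>, which is nonzero by distinctness and at most
  \<open>C * C\<close> in absolute value.\<close>

lemma hit_unique:
  assumes p: "prime p" "p > C * C" and j: "j \<in> {1..t k}" "j' \<in> {1..t k}"
    and dv: "p dvd a j * m + b j" "p dvd a j' * m + b j'"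
  shows "j = j'"
proof (rule ccontr)
  assume "j \<noteq> j'"
  then have ne: "a j * b j' \<noteq> a j' * b j" using ab_distinct[of j j'] j by auto
  have "int p dvd int (a j) * int (a j' * m + b j') - int (a j') * int (a j * m + b j)"
    using dv by (intro dvd_diff dvd_mult) (simp_all only: int_dvd_int_iff)
  also have "\<dots> = int (a j * b j') - int (a j' * b j)" by (simp add: algebra_simps)
  finally have "int p dvd int (a j * b j') - int (a j' * b j)" .
  moreover have "int (a j * b j') - int (a j' * b j) \<noteq> 0"
    using ne by (simp only: right_minus_eq of_nat_eq_iff not_False_eq_True)
  ultimately have "int p \<le> \<bar>int (a j * b j') - int (a j' * b j)\<bar>"
    using dvd_imp_le_int[of "int (a j * b j') - int (a j' * b j)" "int p"] by simp
  also have "\<dots> \<le> int (C * C)"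
  proof -
    have "a j * b j' \<le> C * C" "a j' * b j \<le> C * C"
      using ab_le_C[OF j(1)] ab_le_C[OF j(2)] by (intro mult_le_mono; simp)+
    then have "int (a j * b j') \<le> int (C * C)" "int (a j' * b j) \<le> int (C * C)" by (simp_all only: of_nat_le_iff)
    then show ?thesis by linarith
  qed
  finally have "p \<le> C * C" by (simp only: of_nat_le_iff)
  then show False using p(2) by simp
qed

lemma dd_diff_nonneg: "1 \<le> i \<Longrightarrow> i \<le> k \<Longrightarrow> dd i - dd (i + 1) > 0"
  using d_dec[of i] d_pos[of "t k"] t_pos[of k] k by (cases "i = k") (auto simp: dd_def)

lemma dd_telescope:
  assumes "1 \<le> i0" "i0 \<le> k"
  shows "(\<Sum>i\<in>{i0..k}. dd i - dd (i + 1)) = dd i0"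
proof -
  have "(\<Sum>i\<in>{i0..<Suc k}. (- dd (Suc i)) - (- dd i)) = - dd (Suc k) - (- dd i0)"
    using assms by (intro sum_Suc_diff') auto
  then show ?thesis by (simp add: dd_def atLeastLessThanSuc_atLeastAtMost)
qed

text \<open>Let \<open>i0\<close> be the first block containing an index with property
  \<open>P\<close>. As \<open>d\<close> decreases from block to block, the largest
  \<open>d j\<close> with \<open>P j\<close> occurs there; all indicators from \<open>i0\<close> on
  are 1, and their weights telescope.\<close>

lemma layer_cake:
  assumes hit: "j1 \<in> {1..t k}" "P j1"
  obtains i0 j where "i0 \<in> {1..k}" "j \<in> {1..t k}" "P j" "d j = d (t i0)"
    "\<And>j'. j' \<in> {1..t k} \<Longrightarrow> P j' \<Longrightarrow> d j' \<le> d (t i0)"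
    "(\<Sum>i\<in>{1..k}. (dd i - dd (i + 1)) * (if \<exists>j\<in>{1..t i}. P j then 1 else 0)) = real (d (t i0))"
proof -
  define i0 where "i0 = (LEAST i. \<exists>j\<in>{1..t i}. P j)"
  have ex: "\<exists>j\<in>{1..t i0}. P j"
    unfolding i0_def by (rule LeastI[of _ k]) (use hit in blast)
  have le: "i0 \<le> i" if "j \<in> {1..t i}" "P j" for i j
    unfolding i0_def using that by (intro Least_le) blast
  have i0k: "i0 \<le> k" using le[OF hit] .
  have i01: "1 \<le> i0" using ex t0 by (cases i0) auto
  obtain j where j: "j \<in> {1..t i0}" "P j" using ex by blast
  have jk: "j \<in> {1..t k}" using j(1) t_mono[OF i0k] by auto
  have bound: "d j' \<le> d (t i0)" if j': "j' \<in> {1..t k}" "P j'" for j'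
  proof -
    obtain i' where i': "i' \<in> {1..k}" "t (i' - 1) + 1 \<le> j' \<and> j' \<le> t i'"
      using ex_block[OF j'(1)] by auto
    have "i0 \<le> i'" by (rule le[of j']) (use i' j' in auto)
    moreover have "d j' = d (t i')" using i' by (intro d_block) auto
    ultimately show ?thesis using d_t_mono[OF i01, of i'] i' by simp
  qed
  have "d j = d (t i0)"
  proof -
    obtain i' where i': "i' \<in> {1..i0}" "t (i' - 1) + 1 \<le> j \<and> j \<le> t i'"
      using ex_block[OF j(1) i0k] by auto
    have "i0 \<le> i'" by (rule le[of j]) (use i' j in auto)
    then have "i' = i0" using i' by simp
    then show ?thesis using i' i0k i01 by (intro d_block) auto
  qed
  moreover have "(\<Sum>i\<in>{1..k}. (dd i - dd (i + 1)) * (if \<exists>j\<in>{1..t i}. P j then 1 else 0)) = real (d (t i0))"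
  proof -
    have iff: "(\<exists>j\<in>{1..t i}. P j) \<longleftrightarrow> i0 \<le> i" if "i \<in> {1..k}" for i
    proof
      assume "i0 \<le> i"
      then have "t i0 \<le> t i" using that by (intro t_mono) auto
      then show "\<exists>j\<in>{1..t i}. P j" using j by (intro bexI[of _ j]) auto
    qed (use le in blast)
    have "(\<Sum>i\<in>{1..k}. (dd i - dd (i + 1)) * (if \<exists>j\<in>{1..t i}. P j then 1 else 0)) =
        (\<Sum>i\<in>{1..k}. if i0 \<le> i then dd i - dd (i + 1) else 0)"
      by (intro sum.cong refl) (use iff in auto)
    also have "\<dots> = (\<Sum>i\<in>{i\<in>{1..k}. i0 \<le> i}. dd i - dd (i + 1))"
      by (rule sum.inter_filter[symmetric]) simp
    also have "{i\<in>{1..k}. i0 \<le> i} = {i0..k}" using i01 by auto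
    also have "(\<Sum>i\<in>{i0..k}. dd i - dd (i + 1)) = real (d (t i0))"
      unfolding dd_telescope[OF i01 i0k] using i0k by (simp add: dd_def)
    finally show ?thesis .
  qed
  ultimately show ?thesis using that[of i0 j] i01 i0k jk j(2) bound by auto
qed

definition L :: "nat \<Rightarrow> nat" where "L n = Lcm (f ` {1..n})"

lemma f_image_nonzero: "0 \<notin> f ` {1..n}"
  using f_pos by (metis imageE less_irrefl)

lemma L_pos: "L n > 0"
proof -
  have "Lcm (f ` {1..n}) \<noteq> 0" by (subst Lcm_0_iff) (use f_image_nonzero in auto)
  then show ?thesis unfolding L_def by (simp only: neq0_conv)
qed

lemma prime_power_dvd_L_iff:
  assumes "prime p" "e > 0"
  shows "p ^ e dvd L n \<longleftrightarrow> (\<exists>m\<in>{1..n}. p ^ e dvd f m)"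
proof -
  have "p ^ e dvd L n \<longleftrightarrow> (\<exists>x\<in>f ` {1..n}. p ^ e dvd x)"
    unfolding L_def by (rule prime_power_dvd_Lcm_iff[OF _ f_image_nonzero assms]) simp
  also have "\<dots> \<longleftrightarrow> (\<exists>m\<in>{1..n}. p ^ e dvd f m)" by blast
  finally show ?thesis .
qed

lemma multiplicity_f:
  assumes "prime p"
  shows "multiplicity p (f m) = (\<Sum>j\<in>{1..t k}. d j * multiplicity p (a j * m + b j))"
proof -
  have "multiplicity p (f m) = (\<Sum>j\<in>{1..t k}. multiplicity p ((a j * m + b j) ^ d j))"
    unfolding f_eq
  proof (rule prime_elem_multiplicity_prod_distrib)
    show "prime_elem p" using assms by simp
    show "0 \<notin> (\<lambda>j. (a j * m + b j) ^ d j) ` {1..t k}"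
    proof
      assume "0 \<in> (\<lambda>j. (a j * m + b j) ^ d j) ` {1..t k}"
      then obtain j where j: "j \<in> {1..t k}" "0 = (a j * m + b j) ^ d j" by blast
      then show False using linear_pos[OF j(1), of m] zero_less_power[of "a j * m + b j" "d j"] by linarith
    qed
  qed simp
  also have "\<dots> = (\<Sum>j\<in>{1..t k}. d j * multiplicity p (a j * m + b j))"
  proof (rule sum.cong[OF refl])
    fix j assume j: "j \<in> {1..t k}"
    show "multiplicity p ((a j * m + b j) ^ d j) = d j * multiplicity p (a j * m + b j)"
      by (rule prime_elem_multiplicity_power_distrib[OF prime_imp_prime_elem[OF assms]])
        (use linear_pos[OF j, of m] in linarith)
  qed
  finally show ?thesis .
qed

lemma prime_dvd_f_iff:
  assumes "prime p"
  shows "p dvd f m \<longleftrightarrow> (\<exists>j\<in>{1..t k}. p dvd a j * m + b j)"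
proof -
  have "p dvd f m \<longleftrightarrow> (\<exists>j\<in>{1..t k}. p dvd (a j * m + b j) ^ d j)"
    unfolding f_eq using assms by (subst prime_dvd_prod_iff) auto
  also have "\<dots> \<longleftrightarrow> (\<exists>j\<in>{1..t k}. p dvd a j * m + b j)"
    using assms d_pos by (intro bex_cong refl prime_dvd_power_iff) auto
  finally show ?thesis .
qed

lemma prime_dvd_L_le:
  assumes "prime p" "p dvd L n"
  shows "p \<le> C * n"
proof -
  obtain m where m: "m \<in> {1..n}" "p dvd f m"
    using prime_power_dvd_L_iff[OF assms(1), of 1 n] assms(2) by auto
  then obtain j where j: "j \<in> {1..t k}" "p dvd a j * m + b j"
    using prime_dvd_f_iff[OF assms(1)] by blast
  have "p \<le> a j * m + b j" using j linear_pos by (intro dvd_imp_le) auto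
  then show ?thesis using linear_le[OF j(1), of m n] m by simp
qed

text \<open>Crude bound for the small primes: a power of \<open>p\<close> dividing the lcm divides a
  single value \<open>f m\<close>, which is at most \<open>(C * n) ^ D\<close>.\<close>

lemma multiplicity_L_le:
  assumes "prime p" "n > 0"
  shows "real (multiplicity p (L n)) * ln (real p) \<le> real D * ln (real (C * n))"
proof (cases "multiplicity p (L n) = 0")
  case True
  have "C * n \<ge> 1" using C_ge assms(2) by simp
  then have "real (C * n) \<ge> 1" by linarith
  then show ?thesis using True by (simp only: of_nat_0 mult_zero_left) (intro mult_nonneg_nonneg ln_ge_zero; simp)
next
  case False
  define e where "e = multiplicity p (L n)"
  have "p ^ e dvd L n" unfolding e_def by (rule multiplicity_dvd)
  then obtain m where m: "m \<in> {1..n}" "p ^ e dvd f m"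
    using prime_power_dvd_L_iff[OF assms(1)] False by (auto simp: e_def)
  have "p ^ e \<le> (C * n) ^ D"
    using dvd_imp_le[OF m(2) f_pos] f_le[of m n] m(1) by simp
  then have "real (p ^ e) \<le> real ((C * n) ^ D)" by (rule of_nat_mono)
  then have le: "real p ^ e \<le> real (C * n) ^ D" by (simp only: of_nat_power)
  have p0: "real p > 0" using prime_gt_0_nat[OF assms(1)] by simp
  have C0: "real (C * n) > 0" using C_ge assms(2) by simp
  have "real e * ln (real p) = ln (real p ^ e)" using p0 by (simp add: ln_realpow)
  also have "\<dots> \<le> ln (real (C * n) ^ D)" using le p0 C0 by (subst ln_le_cancel_iff) auto
  also have "\<dots> = real D * ln (real (C * n))" using C0 by (simp only: ln_realpow)
  finally show ?thesis by (simp add: e_def)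
qed

lemma multiplicity_L_large:
  assumes p: "prime p" "p > C * C" "p * p > C * n"
  shows "real (multiplicity p (L n)) =
    (\<Sum>i\<in>{1..k}. (dd i - dd (i + 1)) * (if \<exists>j\<in>{1..t i}. hits n p j then 1 else 0))"
proof (cases "\<exists>j\<in>{1..t k}. hits n p j")
  case False
  have "\<not> (\<exists>j\<in>{1..t i}. hits n p j)" if "i \<in> {1..k}" for i
    using False t_mono[of i k] that by fastforce
  moreover have "\<not> p dvd L n"
  proof
    assume "p dvd L n"
    then obtain m where m: "m \<in> {1..n}" "p dvd f m"
      using prime_power_dvd_L_iff[OF p(1), of 1 n] by auto
    then show False using False prime_dvd_f_iff[OF p(1)] by (auto simp: hits_def)
  qed
  ultimately show ?thesis by (simp add: not_dvd_imp_multiplicity_0)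
next
  case True
  then obtain j1 where j1: "j1 \<in> {1..t k}" "hits n p j1" by blast
  obtain i0 j where ij: "i0 \<in> {1..k}" "j \<in> {1..t k}" "hits n p j" "d j = d (t i0)"
    "\<And>j'. j' \<in> {1..t k} \<Longrightarrow> hits n p j' \<Longrightarrow> d j' \<le> d (t i0)"
    "(\<Sum>i\<in>{1..k}. (dd i - dd (i + 1)) * (if \<exists>j\<in>{1..t i}. hits n p j then 1 else 0)) = real (d (t i0))"
    by (rule layer_cake[of j1 "hits n p", OF j1]) (rule that)
  have nu: "\<not> is_unit p" using p(1) by auto
  have "multiplicity p (L n) = d (t i0)"
  proof (rule antisym)
    obtain m where m: "m \<in> {1..n}" "p dvd a j * m + b j" using ij(3) by (auto simp: hits_def)
    have "p ^ d j dvd (a j * m + b j) ^ d j" using m(2) by (rule dvd_power_same)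
    also have "\<dots> dvd f m" unfolding f_eq using ij(2) by (intro dvd_prodI) auto
    also have "f m dvd L n" unfolding L_def using m(1) by (intro dvd_Lcm) auto
    finally show "d (t i0) \<le> multiplicity p (L n)"
      using ij(4) L_pos[of n] nu by (intro multiplicity_geI) auto
  next
    define e where "e = multiplicity p (L n)"
    show "multiplicity p (L n) \<le> d (t i0)"
    proof (cases "e = 0")
      case False
      have "p ^ e dvd L n" unfolding e_def by (rule multiplicity_dvd)
      then obtain m where m: "m \<in> {1..n}" "p ^ e dvd f m"
        using prime_power_dvd_L_iff[OF p(1)] False by auto
      have "p dvd f m" using m(2) False by (meson dvd_power dvd_trans neq0_conv)
      then obtain j2 where j2: "j2 \<in> {1..t k}" "p dvd a j2 * m + b j2"
        using prime_dvd_f_iff[OF p(1)] by blast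
      have "multiplicity p (a j' * m + b j') = 0" if "j' \<in> {1..t k} - {j2}" for j'
        using hit_unique[OF p(1,2) j2(1) _ j2(2), of j'] that by (intro not_dvd_imp_multiplicity_0) auto
      then have "multiplicity p (f m) = (\<Sum>j\<in>{j2}. d j * multiplicity p (a j * m + b j))"
        unfolding multiplicity_f[OF p(1)] using j2(1) by (intro sum.mono_neutral_right) auto
      then have mf: "multiplicity p (f m) = d j2 * multiplicity p (a j2 * m + b j2)" by simp
      have m1: "multiplicity p (a j2 * m + b j2) \<le> 1"
      proof (rule ccontr)
        assume "\<not> multiplicity p (a j2 * m + b j2) \<le> 1"
        then have "p ^ 2 dvd a j2 * m + b j2" by (intro multiplicity_dvd') auto
        then have "p ^ 2 \<le> a j2 * m + b j2" using linear_pos[OF j2(1)] by (intro dvd_imp_le) auto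
        also have "\<dots> \<le> C * n" using linear_le[OF j2(1), of m n] m(1) by simp
        finally show False using p(3) by (simp add: power2_eq_square)
      qed
      have "e \<le> multiplicity p (f m)" using m(2) f_pos[of m] nu by (intro multiplicity_geI) auto
      also have "\<dots> \<le> d j2 * 1" unfolding mf by (intro mult_le_mono2 m1)
      also have "d j2 * 1 \<le> d (t i0)"
      proof -
        have "hits n p j2" unfolding hits_def using j2(2) m(1) by blast
        then show ?thesis using ij(5)[OF j2(1)] by simp
      qed
      finally show ?thesis by (simp add: e_def)
    qed (simp add: e_def)
  qed
  then show ?thesis using ij(6) by simp
qed

lemma hits_iff:
  assumes p: "prime p" "p > C" and j: "j \<in> {1..t k}" and r: "[p * r = 1] (mod q)"
  shows "hits n p j \<longleftrightarrow> p \<le> (a j * n + b j) div least_pos_res (a j) (b j * r)"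
proof -
  define c where "c = least_pos_res (a j) (b j * r)"
  have aj: "a j > 0" using a_pos j by auto
  have c: "c > 0" "[c = b j * r] (mod a j)"
    unfolding c_def by (rule least_pos_res_props[OF aj])+
  have ra: "[p * r = 1] (mod a j)" using r a_dvd_q[OF j] by (rule cong_dvd_modulus_nat)
  have le_iff: "p \<le> (a j * n + b j) div c \<longleftrightarrow> p * c \<le> a j * n + b j"
    using c(1) by (rule less_eq_div_iff_mult_less_eq)
  show ?thesis
    unfolding c_def[symmetric] le_iff
  proof
    assume "hits n p j"
    then obtain m c' where m: "m \<in> {1..n}" "a j * m + b j = p * c'" unfolding hits_def dvd_def by blast
    have "c' > 0" using m(2) linear_pos[OF j, of m] by (cases c') auto
    moreover have "[c' = b j * r] (mod a j)"
    proof -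
      have 1: "[p * r * c' = 1 * c'] (mod a j)" by (intro cong_mult ra cong_refl)
      have 2: "p * r * c' = (a j * m + b j) * r" unfolding m(2) by (simp only: mult_ac)
      have 3: "[(a j * m + b j) * r = b j * r] (mod a j)"
        by (simp add: Cong.cong_def distrib_right mult.assoc)
      show ?thesis using cong_trans[OF cong_sym[OF 1[unfolded 2]] 3] by simp
    qed
    ultimately have "c \<le> c'" unfolding c_def by (rule least_pos_res_le[OF aj])
    then have "p * c \<le> p * c'" by simp
    also have "\<dots> \<le> a j * n + b j" unfolding m(2)[symmetric] using m(1) by simp
    finally show "p * c \<le> a j * n + b j" .
  next
    assume le: "p * c \<le> a j * n + b j"
    \<comment> \<open>With \<open>p * c > b j\<close> the solution \<open>m\<close> of
      \<open>a j * m + b j = p * c\<close> is at least 1, as \<open>hits\<close> demands; this is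
      where \<open>p > C\<close> enters.\<close>
    have "b j < p" using ab_le_C[OF j] p(2) by simp
    also have "p \<le> p * c" using c(1) by simp
    finally have lt: "b j < p * c" .
    have 1: "[p * c = p * (b j * r)] (mod a j)" by (intro cong_mult c cong_refl)
    have 2: "p * (b j * r) = p * r * b j" by (simp only: mult_ac)
    have 3: "[p * r * b j = 1 * b j] (mod a j)" by (intro cong_mult ra cong_refl)
    have "[p * c = b j] (mod a j)" using cong_trans[OF 1[unfolded 2] 3] by simp
    then have "a j dvd p * c - b j" using cong_altdef_nat[of "b j" "p * c" "a j"] lt by simp
    then obtain m where m: "p * c - b j = a j * m" by (elim dvdE)
    have "m \<ge> 1" using m lt by (cases m) auto
    moreover have "a j * m \<le> a j * n" using m le by linarith
    then have "m \<le> n" using aj by simp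
    moreover have "a j * m + b j = p * c" using m lt by linarith
    ultimately show "hits n p j" unfolding hits_def by (intro bexI[of _ m]) auto
  qed
qed

lemma X_le:
  assumes "i \<in> {1..k}" "n \<ge> 1"
  shows "X i r n \<le> C * n"
proof -
  have "(a j * n + b j) div least_pos_res (a j) (b j * r) \<le> C * n" if "j \<in> {1..t i}" for j
  proof -
    have "j \<in> {1..t k}" using that t_mono[of i k] assms(1) by auto
    then show ?thesis using linear_le[of j n n] assms(2) div_le_dividend le_trans by (metis le_refl)
  qed
  then show ?thesis unfolding X_def using t_pos[of i] assms(1) by (subst Max_le_iff) auto
qed

lemma le_X_iff:
  assumes "i \<in> {1..k}"
  shows "p \<le> X i r n \<longleftrightarrow> (\<exists>j\<in>{1..t i}. p \<le> (a j * n + b j) div least_pos_res (a j) (b j * r))"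
  unfolding X_def using t_pos[of i] assms by (subst Max_ge_iff) auto

section \<open>Comparison with the sum over residue classes\<close>

definition R :: "nat set" where "R = {r \<in> {1..q}. coprime r q}"

definition inv_res :: "nat \<Rightarrow> nat" where "inv_res r = r ^ (totient q - 1)"

lemma inv_res:
  assumes "coprime r q"
  shows "[r * inv_res r = 1] (mod q)" "coprime (inv_res r) q"
proof -
  have "r * inv_res r = r ^ totient q"
    unfolding inv_res_def using q_pos by (metis Suc_pred' power_Suc totient_gt_0_iff)
  then show "[r * inv_res r = 1] (mod q)" using euler_theorem[OF assms] by simp
  show "coprime (inv_res r) q" using assms by (simp add: inv_res_def)
qed

lemma cong_inv_res_iff:
  assumes "coprime r q"
  shows "[p = inv_res r] (mod q) \<longleftrightarrow> [p * r = 1] (mod q)"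
proof -
  have "[p = inv_res r] (mod q) \<longleftrightarrow> [p * r = inv_res r * r] (mod q)"
    using assms by (simp add: cong_mult_rcancel_nat)
  also have "\<dots> \<longleftrightarrow> [p * r = 1] (mod q)"
    using inv_res(1)[OF assms] by (metis cong_sym cong_trans mult.commute)
  finally show ?thesis .
qed

text \<open>The exponent of \<open>p\<close> predicted by the thresholds. At most one
  \<open>r\<close> contributes, namely the inverse of \<open>p\<close> modulo \<open>q\<close>. It
  is the true exponent when \<open>p\<close> is large; summed against \<open>ln p\<close> it gives
  the main term \<open>V\<close>.\<close>

definition G :: "nat \<Rightarrow> nat \<Rightarrow> real" where
  "G n p = (\<Sum>r\<in>R. if [p = inv_res r] (mod q) then
      \<Sum>i\<in>{1..k}. (dd i - dd (i + 1)) * (if p \<le> X i r n then 1 else 0) else 0)"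

definition V :: "nat \<Rightarrow> real" where
  "V n = (\<Sum>r\<in>R. \<Sum>i\<in>{1..k}. (dd i - dd (i + 1)) * theta_ap q (inv_res r) (X i r n))"

lemma V_eq:
  assumes n: "n \<ge> 1"
  shows "V n = (\<Sum>p | prime p \<and> p \<le> C * n. G n p * ln (real p))"
proof -
  let ?P = "{p. prime p \<and> p \<le> C * n}"
  have th: "theta_ap q s (X i r n) = (\<Sum>p\<in>?P. if [p = s] (mod q) then (if p \<le> X i r n then 1 else 0) * ln (real p) else 0)"
    if "i \<in> {1..k}" for i r s
  proof -
    have "theta_ap q s (X i r n) = (\<Sum>p | prime p \<and> p \<le> X i r n \<and> [p = s] (mod q).
        if [p = s] (mod q) then (if p \<le> X i r n then 1 else 0) * ln (real p) else 0)"
      unfolding theta_ap_def by (intro sum.cong refl) auto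
    also have "\<dots> = (\<Sum>p\<in>?P. if [p = s] (mod q) then (if p \<le> X i r n then 1 else 0) * ln (real p) else 0)"
      using X_le[OF that n, of r] by (intro sum.mono_neutral_left) auto
    finally show ?thesis .
  qed
  have "V n = (\<Sum>r\<in>R. \<Sum>i\<in>{1..k}. \<Sum>p\<in>?P. (dd i - dd (i + 1)) *
      (if [p = inv_res r] (mod q) then (if p \<le> X i r n then 1 else 0) * ln (real p) else 0))"
    unfolding V_def by (intro sum.cong refl) (simp only: th sum_distrib_left)
  also have "\<dots> = (\<Sum>r\<in>R. \<Sum>p\<in>?P. \<Sum>i\<in>{1..k}. (dd i - dd (i + 1)) *
      (if [p = inv_res r] (mod q) then (if p \<le> X i r n then 1 else 0) * ln (real p) else 0))"
    by (intro sum.cong refl sum.swap)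
  also have "\<dots> = (\<Sum>p\<in>?P. \<Sum>r\<in>R. \<Sum>i\<in>{1..k}. (dd i - dd (i + 1)) *
      (if [p = inv_res r] (mod q) then (if p \<le> X i r n then 1 else 0) * ln (real p) else 0))"
    by (rule sum.swap)
  also have "\<dots> = (\<Sum>p\<in>?P. G n p * ln (real p))"
    unfolding G_def sum_distrib_right by (intro sum.cong refl) (simp add: sum_distrib_right mult.assoc)
  finally show ?thesis .
qed

lemma finite_R: "finite R" by (simp add: R_def)

lemma G_bounds: "0 \<le> G n p" "G n p \<le> real (card R) * dd 1"
proof -
  show "0 \<le> G n p"
    unfolding G_def using dd_diff_nonneg by (intro sum_nonneg) (auto intro!: sum_nonneg simp: less_imp_le)
  have "G n p \<le> (\<Sum>r\<in>R. dd 1)"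
    unfolding G_def
  proof (rule sum_mono)
    fix r
    have "(\<Sum>i\<in>{1..k}. (dd i - dd (i + 1)) * (if p \<le> X i r n then 1 else 0)) \<le> (\<Sum>i\<in>{1..k}. dd i - dd (i + 1))"
      using dd_diff_nonneg by (intro sum_mono) (auto simp: less_imp_le)
    also have "\<dots> = dd 1" using k by (intro dd_telescope) auto
    finally have "(\<Sum>i\<in>{1..k}. (dd i - dd (i + 1)) * (if p \<le> X i r n then 1 else 0)) \<le> dd 1" .
    moreover have "0 \<le> dd 1" by (simp add: dd_def)
    ultimately show "(if [p = inv_res r] (mod q) then \<Sum>i\<in>{1..k}. (dd i - dd (i + 1)) * (if p \<le> X i r n then 1 else 0) else 0) \<le> dd 1"
      by (cases "[p = inv_res r] (mod q)") (simp_all only: if_True if_False)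
  qed
  then show "G n p \<le> real (card R) * dd 1" by simp
qed

lemma G_large:
  assumes p: "prime p" "p > C * C" "p * p > C * n"
  shows "G n p = real (multiplicity p (L n))"
proof -
  have pC: "p > C" using p(2) C_ge by (meson le_square less_le_trans not_le)
  have cop: "coprime p q" by (rule coprime_q[OF p(1) pC])
  have "\<exists>r\<in>R. [p * r = 1] (mod q)"
  \<comment> \<open>For \<open>q = 1\<close> the representative in \<open>R\<close> is 1, while
    reducing modulo \<open>q\<close> would give 0.\<close>
  proof (cases "q = 1")
    case True
    then show ?thesis by (auto simp: R_def Cong.cong_def)
  next
    case False
    let ?r = "inv_res p mod q"
    have "coprime ?r q" using inv_res(2)[OF cop] q_pos by simp
    moreover have "?r \<noteq> 0"
    proof
      assume "?r = 0"
      then have "coprime 0 q" using \<open>coprime ?r q\<close> by (simp only:)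
      then show False using False by simp
    qed
    moreover have "?r \<le> q" using q_pos by (simp add: less_imp_le)
    moreover have "[p * ?r = 1] (mod q)" using inv_res(1)[OF cop] by (simp add: Cong.cong_def mod_mult_right_eq)
    ultimately show ?thesis by (intro bexI[of _ ?r]) (auto simp: R_def)
  qed
  then obtain r0 where r0: "r0 \<in> R" "[p * r0 = 1] (mod q)" by blast
  have uniq: "r = r0" if "r \<in> R" "[p * r = 1] (mod q)" for r
  proof -
    have "[p * r = p * r0] (mod q)" by (rule cong_trans[OF that(2) cong_sym[OF r0(2)]])
    then have c: "[r = r0] (mod q)" using cop by (simp add: cong_mult_lcancel_nat)
    have "x \<in> {1..q}" if "x \<in> R" for x using that by (simp add: R_def)
    then have r: "1 \<le> r" "r \<le> q" "1 \<le> r0" "r0 \<le> q" using that(1) r0(1) by fastforce+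
    show ?thesis
    proof (rule ccontr)
      assume "r \<noteq> r0"
      have "int q dvd int r - int r0" using c unfolding cong_int_iff[symmetric] cong_iff_dvd_diff .
      then have "int q \<le> \<bar>int r - int r0\<bar>"
        using \<open>r \<noteq> r0\<close> dvd_imp_le_int[of "int r - int r0" "int q"] by simp
      moreover have "\<bar>int r - int r0\<bar> < int q"
        using r unfolding abs_less_iff by auto
      ultimately show False by simp
    qed
  qed
  have "G n p = (\<Sum>r\<in>R. if r = r0 then
      \<Sum>i\<in>{1..k}. (dd i - dd (i + 1)) * (if p \<le> X i r n then 1 else 0) else 0)"
    unfolding G_def
  proof (rule sum.cong[OF refl])
    fix r assume r: "r \<in> R"
    then have "coprime r q" by (simp add: R_def)
    then have "[p = inv_res r] (mod q) \<longleftrightarrow> r = r0"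
      using cong_inv_res_iff[of r p] uniq[OF r] r0(2) by metis
    then show "(if [p = inv_res r] (mod q) then \<Sum>i\<in>{1..k}. (dd i - dd (i + 1)) * (if p \<le> X i r n then 1 else 0) else 0) =
       (if r = r0 then \<Sum>i\<in>{1..k}. (dd i - dd (i + 1)) * (if p \<le> X i r n then 1 else 0) else 0)" by simp
  qed
  also have "\<dots> = (\<Sum>i\<in>{1..k}. (dd i - dd (i + 1)) * (if p \<le> X i r0 n then 1 else 0))"
    using finite_R r0(1) by (simp add: sum.delta)
  also have "\<dots> = (\<Sum>i\<in>{1..k}. (dd i - dd (i + 1)) * (if \<exists>j\<in>{1..t i}. hits n p j then 1 else 0))"
  proof (intro sum.cong refl)
    fix i assume i: "i \<in> {1..k}"
    have "(\<exists>j\<in>{1..t i}. hits n p j) \<longleftrightarrow> p \<le> X i r0 n"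
      unfolding le_X_iff[OF i]
    proof (rule bex_cong[OF refl])
      fix j assume "j \<in> {1..t i}"
      then have "j \<in> {1..t k}" using t_mono[of i k] i by auto
      then show "hits n p j \<longleftrightarrow> p \<le> (a j * n + b j) div least_pos_res (a j) (b j * r0)"
        by (rule hits_iff[OF p(1) pC _ r0(2)])
    qed
    then show "(dd i - dd (i + 1)) * (if p \<le> X i r0 n then 1 else 0) =
        (dd i - dd (i + 1)) * (if \<exists>j\<in>{1..t i}. hits n p j then 1 else 0)" by simp
  qed
  also have "\<dots> = real (multiplicity p (L n))"
    by (rule multiplicity_L_large[OF p, symmetric])
  finally show ?thesis .
qed

text \<open>The requirement on \<open>n\<close> makes the two largeness conditions one: a prime with
  \<open>p \<le> C * C\<close> has \<open>p * p \<le> C ^ 4 \<le> C * n\<close>. So only primes with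
  \<open>p * p \<le> C * n\<close> survive in the difference; there are at most
  \<open>sqrt (C * n)\<close> of them, and each is estimated crudely.\<close>

lemma ln_L_V_bound:
  assumes n: "n \<ge> C * C * C"
  shows "\<bar>ln (real (L n)) - V n\<bar> \<le> (real D + real (card R) * dd 1) * (sqrt (real (C * n)) * ln (real (C * n)))"
proof -
  let ?P = "{p. prime p \<and> p \<le> C * n}" and ?S = "{p. prime p \<and> p * p \<le> C * n}"
  let ?K = "(real D + real (card R) * dd 1) * ln (real (C * n))"
  have n1: "n \<ge> 1" using n C_ge by (metis One_nat_def Suc_leI le_trans mult_pos_pos less_le_trans pos2)
  have "1 * 1 \<le> C * n" using C_ge n1 by (intro mult_le_mono) auto
  then have Cn: "real (C * n) \<ge> 1" by linarith
  have fin: "finite ?S" by (rule finite_subset[of _ "{..C * n}"]) (auto intro: le_trans[OF le_square])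
  have SP: "?S \<subseteq> ?P" by (auto intro: le_trans[OF le_square])
  have "ln (real (L n)) = (\<Sum>p\<in>?P. real (multiplicity p (L n)) * ln (real p))"
    by (rule ln_eq_sum_multiplicity[OF L_pos prime_dvd_L_le])
  then have "ln (real (L n)) - V n = (\<Sum>p\<in>?P. (real (multiplicity p (L n)) - G n p) * ln (real p))"
    unfolding V_eq[OF n1] by (simp add: sum_subtractf left_diff_distrib)
  also have "\<dots> = (\<Sum>p\<in>?S. (real (multiplicity p (L n)) - G n p) * ln (real p))"
  proof (rule sum.mono_neutral_right)
    show "\<forall>p\<in>?P - ?S. (real (multiplicity p (L n)) - G n p) * ln (real p) = 0"
    proof
      fix p assume p: "p \<in> ?P - ?S"
      then have p1: "prime p" "p * p > C * n" by auto
      have "C * C < p"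
      proof (rule ccontr)
        assume "\<not> C * C < p"
        then have "p * p \<le> (C * C) * (C * C)" by (intro mult_le_mono) auto
        also have "\<dots> = C * (C * C * C)" by simp
        also have "\<dots> \<le> C * n" using n by (intro mult_le_mono) auto
        finally show False using p1 by simp
      qed
      then show "(real (multiplicity p (L n)) - G n p) * ln (real p) = 0"
        using G_large[OF p1(1) _ p1(2)] by simp
    qed
  qed (use SP in auto)
  finally have eq: "ln (real (L n)) - V n = (\<Sum>p\<in>?S. (real (multiplicity p (L n)) - G n p) * ln (real p))" .
  have "\<bar>ln (real (L n)) - V n\<bar> \<le> (\<Sum>p\<in>?S. ?K)"
    unfolding eq
  proof (rule order_trans[OF sum_abs sum_mono])
    fix p assume p: "p \<in> ?S"
    then have p1: "prime p" "p \<le> C * n" using SP by auto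
    have lp: "0 \<le> ln (real p)" "ln (real p) \<le> ln (real (C * n))"
      using prime_ge_1_nat[OF p1(1)] p1(2) Cn by (auto simp del: of_nat_mult)
    have m: "real (multiplicity p (L n)) * ln (real p) \<le> real D * ln (real (C * n))"
      using n1 by (intro multiplicity_L_le p1) auto
    have g: "G n p * ln (real p) \<le> real (card R) * dd 1 * ln (real (C * n))"
      using G_bounds lp by (intro mult_mono) (auto simp: dd_def)
    have nn: "0 \<le> real (multiplicity p (L n)) * ln (real p)" "0 \<le> G n p * ln (real p)"
      using lp G_bounds by (intro mult_nonneg_nonneg; simp)+
    have aux: "\<bar>u - v\<bar> \<le> A + B" if "0 \<le> u" "0 \<le> v" "u \<le> A" "v \<le> B" for u v A B :: real
      using that by linarith
    show "\<bar>(real (multiplicity p (L n)) - G n p) * ln (real p)\<bar> \<le> ?K"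
      unfolding left_diff_distrib distrib_right by (rule aux[OF nn m g])
  qed
  also have "(\<Sum>p\<in>?S. ?K) = real (card ?S) * ?K" by (rule sum_constant)
  also have "\<dots> \<le> sqrt (real (C * n)) * ?K"
  proof (rule mult_right_mono[OF card_prime_square_le])
    have "dd 1 \<ge> 0" by (simp add: dd_def)
    then show "0 \<le> ?K" using Cn by (intro mult_nonneg_nonneg add_nonneg_nonneg ln_ge_zero) auto
  qed
  finally show ?thesis by (simp only: mult_ac)
qed

lemma V_tendsto:
  "(\<lambda>n. V n / real n) \<longlonglongrightarrow> (\<Sum>r\<in>R. \<Sum>i\<in>{1..k}. (dd i - dd (i + 1)) *
     (Max ((\<lambda>j. real (a j) / real (least_pos_res (a j) (b j * r))) ` {1..t i}) / real (totient q)))"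
proof -
  have "(\<lambda>n. theta_ap q (inv_res r) (X i r n) / real n) \<longlonglongrightarrow>
      Max ((\<lambda>j. real (a j) / real (least_pos_res (a j) (b j * r))) ` {1..t i}) / real (totient q)"
    if r: "r \<in> R" and i: "i \<in> {1..k}" for r i
  proof (rule theta_ap_compose[OF q_pos])
    have ne: "{1..t i} \<noteq> {}" using t_pos[of i] i by auto
    have jk: "j \<in> {1..t k}" if "j \<in> {1..t i}" for j using that t_mono[of i k] i by auto
    have cpos: "least_pos_res (a j) (b j * r) > 0" if "j \<in> {1..t i}" for j
      using jk[OF that] a_pos by (intro least_pos_res_props) auto
    show "coprime (inv_res r) q" using r by (intro inv_res) (simp add: R_def)
    have eq: "real (X i r n) / real n = Max ((\<lambda>j. real ((a j * n + b j) div least_pos_res (a j) (b j * r)) / real n) ` {1..t i})" for n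
    proof -
      have "mono (\<lambda>x. real x / real n)" by (intro monoI divide_right_mono) auto
      from mono_Max_commute[OF this, of "(\<lambda>j. (a j * n + b j) div least_pos_res (a j) (b j * r)) ` {1..t i}"]
      show ?thesis unfolding X_def using ne by (simp add: image_image)
    qed
    show "(\<lambda>n. real (X i r n) / real n) \<longlonglongrightarrow> Max ((\<lambda>j. real (a j) / real (least_pos_res (a j) (b j * r))) ` {1..t i})"
      unfolding eq by (intro tendsto_Max_image ne div_over_tendsto cpos) auto
    have "0 < real (a 1) / real (least_pos_res (a 1) (b 1 * r))"
      using cpos[of 1] a_pos[of 1] t_pos[of i] t_pos[of k] i k by auto
    also have "\<dots> \<le> Max ((\<lambda>j. real (a j) / real (least_pos_res (a j) (b j * r))) ` {1..t i})"
      using t_pos[of i] i by (intro Max_ge) auto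
    finally show "0 < Max ((\<lambda>j. real (a j) / real (least_pos_res (a j) (b j * r))) ` {1..t i})" .
  qed
  then have "(\<lambda>n. \<Sum>r\<in>R. \<Sum>i\<in>{1..k}. (dd i - dd (i + 1)) * (theta_ap q (inv_res r) (X i r n) / real n)) \<longlonglongrightarrow>
      (\<Sum>r\<in>R. \<Sum>i\<in>{1..k}. (dd i - dd (i + 1)) *
     (Max ((\<lambda>j. real (a j) / real (least_pos_res (a j) (b j * r))) ` {1..t i}) / real (totient q)))"
    by (intro tendsto_sum tendsto_mult tendsto_const)
  then show ?thesis by (simp add: V_def sum_divide_distrib)
qed

text \<open>Asymptotic equivalence is obtained by dividing by the limit constant, which must
  therefore not vanish. The index 1 belongs to every set \<open>{1..t i}\<close> and makes each
  maximum positive.\<close>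

lemma kappa_pos:
  "(\<Sum>r\<in>R. \<Sum>i\<in>{1..k}. (dd i - dd (i + 1)) *
     Max ((\<lambda>j. real (a j) / real (least_pos_res (a j) (b j * r))) ` {1..t i})) > 0"
proof (rule sum_pos[OF finite_R])
  have "1 \<in> R" using q_pos by (simp add: R_def Suc_le_eq)
  then show "R \<noteq> {}" by blast
  fix r
  show "(\<Sum>i\<in>{1..k}. (dd i - dd (i + 1)) *
     Max ((\<lambda>j. real (a j) / real (least_pos_res (a j) (b j * r))) ` {1..t i})) > 0"
  proof (rule sum_pos)
    fix i assume i: "i \<in> {1..k}"
    have a1: "a 1 > 0" using a_pos[of 1] t_pos[of k] k by auto
    have "0 < real (a 1) / real (least_pos_res (a 1) (b 1 * r))"
      using least_pos_res_props(1)[OF a1, of "b 1 * r"] a1 by auto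
    also have "\<dots> \<le> Max ((\<lambda>j. real (a j) / real (least_pos_res (a j) (b j * r))) ` {1..t i})"
      using t_pos[of i] i by (intro Max_ge) auto
    finally show "(dd i - dd (i + 1)) * Max ((\<lambda>j. real (a j) / real (least_pos_res (a j) (b j * r))) ` {1..t i}) > 0"
      using dd_diff_nonneg[of i] i by (intro mult_pos_pos) auto
  qed (use k in auto)
qed

theorem ln_L_asymptotic:
  "(\<lambda>n. ln (real (L n))) \<sim>[at_top] (\<lambda>n. real n / real (totient q) *
     (\<Sum>r\<in>R. \<Sum>i\<in>{1..k}. (dd i - dd (i + 1)) *
        Max ((\<lambda>j. real (a j) / real (least_pos_res (a j) (b j * r))) ` {1..t i})))"
proof -
  define \<kappa> where "\<kappa> = (\<Sum>r\<in>R. \<Sum>i\<in>{1..k}. (dd i - dd (i + 1)) *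
        Max ((\<lambda>j. real (a j) / real (least_pos_res (a j) (b j * r))) ` {1..t i}))"
  define K where "K = real D + real (card R) * dd 1"
  have \<kappa>: "\<kappa> > 0" unfolding \<kappa>_def by (rule kappa_pos)
  have phi: "real (totient q) > 0" using q_pos by simp
  have V: "(\<lambda>n. V n / real n) \<longlonglongrightarrow> \<kappa> / real (totient q)"
    using V_tendsto by (simp add: \<kappa>_def sum_divide_distrib)
  have err: "(\<lambda>n. (ln (real (L n)) - V n) / real n) \<longlonglongrightarrow> 0"
  proof (rule Lim_null_comparison)
    have C0: "real C > 0" using C_ge by simp
    show "(\<lambda>n. K * (sqrt (real C * real n) * ln (real C * real n)) / real n) \<longlonglongrightarrow> 0"
      by (rule sqrt_ln_over_tendsto[OF C0])
    show "\<forall>\<^sub>F n in sequentially. norm ((ln (real (L n)) - V n) / real n) \<le>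
        K * (sqrt (real C * real n) * ln (real C * real n)) / real n"
      using eventually_ge_at_top[of "C * C * C"]
    proof eventually_elim
      case (elim n)
      show ?case
        using divide_right_mono[OF ln_L_V_bound[OF elim], of "real n"]
        by (simp add: K_def abs_divide)
    qed
  qed
  have "(\<lambda>n. ln (real (L n)) / real n) \<longlonglongrightarrow> 0 + \<kappa> / real (totient q)"
    using tendsto_add[OF err V] by (simp add: diff_divide_distrib)
  then have "(\<lambda>n. ln (real (L n)) / real n / (\<kappa> / real (totient q))) \<longlonglongrightarrow> (0 + \<kappa> / real (totient q)) / (\<kappa> / real (totient q))"
    using \<kappa> phi by (intro tendsto_divide tendsto_const) auto
  then have "(\<lambda>n. ln (real (L n)) / (real n / real (totient q) * \<kappa>)) \<longlonglongrightarrow> 1"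
    using \<kappa> phi by (simp add: field_simps)
  then show ?thesis unfolding \<kappa>_def by (rule asymp_equivI')
qed

end

theorem theorem1p1:
  fixes k :: nat and t :: "nat \<Rightarrow> nat" and d a b :: "nat \<Rightarrow> nat"
  assumes hk: "k \<ge> 1"
    and ht0: "t 0 = 0"
    and ht_mono: "\<And>i. i < k \<Longrightarrow> t i < t (Suc i)"
    and hd_pos: "\<And>j. 1 \<le> j \<Longrightarrow> j \<le> t k \<Longrightarrow> d j > 0"
    and hd_block: "\<And>i j. 1 \<le> i \<Longrightarrow> i \<le> k \<Longrightarrow> t (i - 1) + 1 \<le> j \<Longrightarrow> j \<le> t i
                     \<Longrightarrow> d j = d (t i)"
    and hd_dec: "\<And>i. 1 \<le> i \<Longrightarrow> i < k \<Longrightarrow> d (t i) > d (t (Suc i))"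
    and ha_pos: "\<And>j. 1 \<le> j \<Longrightarrow> j \<le> t k \<Longrightarrow> a j > 0"
    and hb_pos: "\<And>j. 1 \<le> j \<Longrightarrow> j \<le> t k \<Longrightarrow> b j > 0"
    and hab_coprime: "\<And>j. 1 \<le> j \<Longrightarrow> j \<le> t k \<Longrightarrow> gcd (a j) (b j) = 1"
    and hab_distinct: "\<And>j1 j2. 1 \<le> j1 \<Longrightarrow> j1 \<le> t k \<Longrightarrow> 1 \<le> j2 \<Longrightarrow> j2 \<le> t k \<Longrightarrow>
                     j1 \<noteq> j2 \<Longrightarrow> a j1 * b j2 \<noteq> a j2 * b j1"
  defines "f \<equiv> (\<lambda>x::nat. \<Prod>i\<in>{1..k}. \<Prod>j\<in>{t (i - 1) + 1..t i}. (a j * x + b j) ^ d j)"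
    and "q \<equiv> Lcm (a ` {1..t k})"
    and "dd \<equiv> (\<lambda>i::nat. if i \<le> k then real (d (t i)) else 0)"
  shows "(\<lambda>n::nat. ln (real (Lcm (f ` {1..n}))))
          \<sim>[at_top] (\<lambda>n. real n / real (totient q) *
             (\<Sum>r\<in>{r\<in>{1..q}. coprime r q}.
                \<Sum>i\<in>{1..k}. (dd i - dd (i + 1)) *
                   Max ((\<lambda>j. real (a j) / real (least_pos_res (a j) (b j * r))) ` {1..t i})))"
proof -
  interpret lf: linear_factors k t d a b
    by unfold_locales (fact hk ht0 ht_mono hd_pos hd_block hd_dec ha_pos hb_pos hab_distinct)+
  have "lf.f = f" "lf.q = q" "lf.dd = dd"
    by (simp_all add: lf.f_def lf.q_def lf.dd_def f_def q_def dd_def fun_eq_iff)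
  then show ?thesis
    using lf.ln_L_asymptotic unfolding lf.L_def lf.R_def by simp
qed

end
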